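(* Let $t\geq 1$ be an integer, $\epsilon\in(0,1)$, and let $\mathcal{F}_1$ and $\mathcal{F}_2$ be two families of pseudo-discs in the plane with $|\mathcal{F}_1|=n$. Let $H$ be the hypergraph with vertex set $\mathcal{F}_1$ in which each $b \in \mathcal{F}_2$ defines the hyperedge $e_b=\{ a \in \mathcal{F}_1 : a \cap b \neq \emptyset \}$. If $\epsilon n \geq 2t$, then $H$ admits an $\epsilon$-$t$-net of size $O(t^5/\epsilon)$, where the implied constant is absolute.
   Context: A family of pseudo-discs is a family of simple closed Jordan regions in the plane such that the boundaries of any two members intersect in at most two points. For a hypergraph $H=(V,\mathcal{E})$ with $|V|=n$, an $\epsilon$-$t$-net is a set $N\subset\binom{V}{t}$ of $t$-tuples of vertices such that every hyperedge $e\in\mathcal{E}$ with $|e|\geq\epsilon n$ contains at least one $t$-tuple of $N$. *)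

theory Defs
  imports "HOL-Analysis.Analysis" "HOL-Library.Ramsey"
begin

(* The plane is complex, the type for which the library states the Jordan curve theorem. By that
   theorem the frontier of the region below is exactly the curve path_image c. *)
definition jordan_region :: "complex set \<Rightarrow> bool" where
  "jordan_region D \<longleftrightarrow>
     (\<exists>c. simple_path c \<and> pathfinish c = pathstart c \<and>
          D = path_image c \<union> inside (path_image c))"

definition pseudo_discs :: "complex set set \<Rightarrow> bool" where
  "pseudo_discs F \<longleftrightarrow>
     (\<forall>D\<in>F. jordan_region D) \<and>
     (\<forall>A\<in>F. \<forall>B\<in>F. A \<noteq> B \<longrightarrow>
        finite (frontier A \<inter> frontier B) \<and> card (frontier A \<inter> frontier B) \<le> 2)"

type_synonym 'a hypergraph = "'a set \<times> 'a set set"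

definition intersection_hypergraph :: "'a set set \<Rightarrow> 'a set set \<Rightarrow> 'a set hypergraph" where
  "intersection_hypergraph F1 F2 = (F1, (\<lambda>b. {a \<in> F1. a \<inter> b \<noteq> {}}) ` F2)"

(* Meant for finite vertex sets, where card is the true cardinality; the members of a net are
   unordered t-element sets of vertices. *)
definition eps_t_net :: "real \<Rightarrow> nat \<Rightarrow> 'a hypergraph \<Rightarrow> 'a set set \<Rightarrow> bool" where
  "eps_t_net \<epsilon> t H N \<longleftrightarrow>
     N \<subseteq> nsets (fst H) t \<and>
     (\<forall>e\<in>snd H. real (card e) \<ge> \<epsilon> * real (card (fst H)) \<longrightarrow> (\<exists>S\<in>N. S \<subseteq> e))"

end

theory Submission
  imports Defs "HOL-Complex_Analysis.Winding_Numbers"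
begin

text \<open>
  For a subfamily \<open>V\<close> of \<open>F1\<close> call two members adjacent if some member of \<open>F2\<close> meets exactly these
  two members of \<open>V\<close>. If five disjoint groups of members of \<open>V\<close>, each containing an adjacent pair,
  were connected and pairwise joined by adjacencies, one could draw a complete graph on five points
  with edges running through the corresponding discs. Two paths inside two pseudo-discs whose end
  points avoid the other disc have algebraic crossing number zero, so all independent edges of this
  drawing would cross zero times algebraically, which a parity argument excludes. Hence the
  adjacency graph has no clique minor on ten vertices and, by Mader's theorem, linearly many edges;
  the same argument shows that no five members of \<open>F1\<close> are shattered.

  The rest uses only these two facts. Clarkson--Shor sampling makes the graph of pairs lying in a
  common hyperedge of size at most \<open>m\<close> have \<open>O(m n)\<close> edges for every induced subgraph, and as every
  family of sets shatters at least as many sets as it has members, there are \<open>O(n m\<^sup>3)\<close> hyperedges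
  of size at most \<open>m\<close>. Haussler's packing argument then gives a family of \<open>O(t\<^sup>4 n / k)\<close> hyperedges
  of size about \<open>k\<close> such that all others of that size differ from one of them in less than
  \<open>k / (4 t)\<close> elements. Inside each of these, \<open>O(t)\<close> sets of size \<open>t\<close> suffice, by double sampling.
  The sizes \<open>k = 2\<^sup>j \<epsilon> n\<close> contribute a geometric series.
\<close>


section \<open>Crossing numbers of paths\<close>

text \<open>The adjacency graph is not drawn without crossings: discs may overlap in any number, and
  only the algebraic crossing number is under control, for paths whose ends avoid the other disc.
  Hence the five points must be private to their groups. A single disc need not have a private
  point, since every member of \<open>F2\<close> that meets it may meet other groups too. A group
  with an adjacent pair has one, inside the member of \<open>F2\<close> that realises the pair.
  Fusing ten branch sets in pairs yields five such groups; this is why the excluded minor has ten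
  vertices, and Mader's threshold for ten is the constant 512.

  The exponent of t is 1 + 3 + 1. Sampling at rate p = 128 t / k turns the separation k / (4 t) into
  32, large against the Vapnik-Chervonenkis dimension 4. The sample has p n expected elements, which
  gives one factor t; its traces have size O(t), and their number per element is cubic in that size;
  finally, each hyperedge of the packing costs 120 t sets.\<close>

text \<open>The winding number around \<open>0\<close> of \<open>\<gamma> s - \<delta> t\<close> as \<open>(s,t)\<close> runs along the boundary of the unit
  square, that is, the algebraic number of crossings of \<open>\<gamma>\<close> and \<open>\<delta>\<close>. It is meaningful only if no
  end point of one path lies on the other.\<close>

definition crossing :: "(real \<Rightarrow> complex) \<Rightarrow> (real \<Rightarrow> complex) \<Rightarrow> complex" where
  "crossing \<gamma> \<delta> =
     winding_number \<gamma> (pathstart \<delta>) + winding_number \<delta> (pathfinish \<gamma>)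
     - winding_number \<gamma> (pathfinish \<delta>) - winding_number \<delta> (pathstart \<gamma>)"

definition unlinked :: "(real \<Rightarrow> complex) \<Rightarrow> (real \<Rightarrow> complex) \<Rightarrow> bool" where
  "unlinked \<gamma> \<delta> \<longleftrightarrow> path \<gamma> \<and> path \<delta> \<and>
     pathstart \<delta> \<notin> path_image \<gamma> \<and> pathfinish \<delta> \<notin> path_image \<gamma> \<and>
     pathstart \<gamma> \<notin> path_image \<delta> \<and> pathfinish \<gamma> \<notin> path_image \<delta> \<and> crossing \<gamma> \<delta> = 0"

lemma crossing_swap: "crossing \<delta> \<gamma> = - crossing \<gamma> \<delta>"
  by (simp add: crossing_def)

lemma unlinked_sym: "unlinked \<gamma> \<delta> \<Longrightarrow> unlinked \<delta> \<gamma>"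
  using crossing_swap[of \<gamma> \<delta>] by (auto simp: unlinked_def)

lemma unlinked_join:
  assumes "unlinked \<gamma> \<delta>" "unlinked \<gamma>' \<delta>" "pathfinish \<gamma> = pathstart \<gamma>'"
  shows "unlinked (\<gamma> +++ \<gamma>') \<delta>"
proof -
  have "crossing (\<gamma> +++ \<gamma>') \<delta> = crossing \<gamma> \<delta> + crossing \<gamma>' \<delta>"
  proof -
    have "winding_number (\<gamma> +++ \<gamma>') z = winding_number \<gamma> z + winding_number \<gamma>' z"
      if "z \<in> {pathstart \<delta>, pathfinish \<delta>}" for z
      using assms that by (auto simp: unlinked_def winding_number_join)
    then show ?thesis by (simp add: crossing_def assms(3))
  qed
  then show ?thesis
    using assms by (simp add: unlinked_def path_image_join)
qed

lemma winding_number_continuous_log: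
  assumes "continuous_on {0..1} l" "\<And>s. s \<in> {0..1} \<Longrightarrow> \<gamma> s - z = exp (l s)"
  shows "winding_number \<gamma> z = (l 1 - l 0) / (2 * of_real pi * \<i>)"
proof -
  have "winding_number \<gamma> z = winding_number (\<lambda>w. \<gamma> w - z) 0"
    by (rule winding_number_offset)
  also have "\<dots> = winding_number (exp \<circ> l) 0"
    by (rule winding_number_cong) (use assms(2) in auto)
  also have "\<dots> = (l 1 - l 0) / (2 * of_real pi * \<i>)"
    using winding_number_compose_exp[of l] assms(1)
    by (simp add: path_def pathstart_def pathfinish_def)
  finally show ?thesis .
qed

text \<open>The difference \<open>\<gamma> s - \<delta> t\<close> has no zero on the unit square, so
  it has a continuous logarithm there. Each of the four winding numbers is a difference of its
  values at two corners, and around the square these cancel.\<close>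

lemma crossing_disjoint:
  assumes "path \<gamma>" "path \<delta>" "path_image \<gamma> \<inter> path_image \<delta> = {}"
  shows "crossing \<gamma> \<delta> = 0"
proof -
  let ?Q = "{0..1::real} \<times> {0..1::real}"
  have "continuous_on ?Q (\<lambda>x. \<gamma> (fst x) - \<delta> (snd x))"
    using assms unfolding path_def
    by (auto intro!: continuous_on_diff continuous_on_compose2[of "{0..1}" \<gamma> _ fst]
          continuous_on_compose2[of "{0..1}" \<delta> _ snd] continuous_on_fst continuous_on_snd
          continuous_on_id)
  moreover have "contractible ?Q"
    by (intro convex_imp_contractible convex_Times) auto
  moreover have "\<gamma> (fst x) - \<delta> (snd x) \<noteq> 0" if "x \<in> ?Q" for x
    using that assms(3) by (force simp: path_image_def)
  ultimately obtain L where L: "continuous_on ?Q L"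
      and L': "\<And>x. x \<in> ?Q \<Longrightarrow> \<gamma> (fst x) - \<delta> (snd x) = exp (L x)"
    by (rule continuous_logarithm_on_contractible) blast+
  have 1: "winding_number \<gamma> (\<delta> t) = (L (1,t) - L (0,t)) / (2 * of_real pi * \<i>)"
    if "t \<in> {0..1}" for t
    using that L'
    by (intro winding_number_continuous_log[of "\<lambda>s. L (s,t)"] continuous_on_compose2[OF L]
          continuous_intros) force+
  have 2: "winding_number \<delta> (\<gamma> s) = (L (s,1) - L (s,0)) / (2 * of_real pi * \<i>)"
    if s: "s \<in> {0..1}" for s
  proof -
    \<comment> \<open>The sign change shifts the logarithm by a constant, which drops out of
      differences.\<close>
    have "\<delta> t - \<gamma> s = exp (L (s,t) + of_real pi * \<i>)" if "t \<in> {0..1}" for t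
      using L'[of "(s,t)"] s that by (simp add: exp_add) (metis minus_diff_eq)
    then show ?thesis
      using s by (subst winding_number_continuous_log[of "\<lambda>t. L (s,t) + of_real pi * \<i>"])
        (auto intro!: continuous_on_compose2[OF L] continuous_intros)
  qed
  show ?thesis
    unfolding crossing_def pathstart_def pathfinish_def
    by (simp add: 1 2 diff_divide_distrib)
qed

lemma unlinked_disjoint:
  assumes "path \<gamma>" "path \<delta>" "path_image \<gamma> \<inter> path_image \<delta> = {}"
  shows "unlinked \<gamma> \<delta>"
proof -
  have "pathstart \<gamma> \<in> path_image \<gamma>" "pathfinish \<gamma> \<in> path_image \<gamma>"
    "pathstart \<delta> \<in> path_image \<delta>" "pathfinish \<delta> \<in> path_image \<delta>" by auto
  then show ?thesis
    using assms crossing_disjoint[OF assms] unfolding unlinked_def by blast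
qed

text \<open>Adding the equations of the fifteen independent pairs, each integer ambiguity of an
  argument change occurs an even number of times, while the half turns between
  \<open>P i - P k\<close> and \<open>P k - P i\<close> add up to an odd number.\<close>

lemma no_unlinked_K5:
  fixes P :: "nat \<Rightarrow> complex" and p :: "nat \<Rightarrow> nat \<Rightarrow> real \<Rightarrow> complex"
  assumes path: "\<And>i j. i < j \<Longrightarrow> j < 5 \<Longrightarrow>
      path (p i j) \<and> pathstart (p i j) = P i \<and> pathfinish (p i j) = P j"
    and avoid: "\<And>i j k. i < j \<Longrightarrow> j < 5 \<Longrightarrow> k < 5 \<Longrightarrow> k \<noteq> i \<Longrightarrow> k \<noteq> j \<Longrightarrow> P k \<notin> path_image (p i j)"
    and crossing: "\<And>i j k l. i < j \<Longrightarrow> j < 5 \<Longrightarrow> k < l \<Longrightarrow> l < 5 \<Longrightarrow> {i,j} \<inter> {k,l} = {} \<Longrightarrow>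
      crossing (p i j) (p k l) = 0"
  shows False
proof -
  define c :: complex where "c = 2 * of_real pi * \<i>"
  have c0: "c \<noteq> 0" by (simp add: c_def)
  have ex_int: "\<exists>n::int. u = v + of_int n" if "exp (c * u) = exp (c * v)" for u v
  proof -
    from that obtain n :: int where "c * u = c * v + of_real (real_of_int (2 * n) * pi) * \<i>"
      unfolding exp_eq by auto
    then have "c * u = c * (v + of_int n)"
      by (simp add: c_def algebra_simps)
    then show ?thesis using c0 by auto
  qed
  have neq: "P i \<noteq> P k" if "i < 5" "k < 5" "i \<noteq> k" for i k
  proof -
    obtain j where "j < 5" "j \<noteq> i" "j \<noteq> k"
    proof (rule that)
      let ?j = "if 0 \<notin> {i,k} then 0 else if 1 \<notin> {i,k} then 1 else (2::nat)"
      show "?j < 5" "?j \<noteq> i" "?j \<noteq> k" using \<open>i \<noteq> k\<close> by auto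
    qed
    then show ?thesis
    proof (cases "i < j")
      case True
      then show ?thesis
        using path[of i j] avoid[of i j k] that \<open>j < 5\<close> \<open>j \<noteq> k\<close> pathstart_in_path_image[of "p i j"] by auto
    next
      case False
      then show ?thesis
        using path[of j i] avoid[of j i k] that \<open>j \<noteq> i\<close> \<open>j \<noteq> k\<close> pathfinish_in_path_image[of "p j i"] by auto
    qed
  qed
  \<comment> \<open>A fixed branch of the logarithm of \<open>P i - P k\<close>, scaled so that a
    full turn is 1. Winding numbers agree with differences of \<open>a\<close> only up to the
    integers \<open>n\<close> obtained below.\<close>
  define a where "a k i = Ln (P i - P k) / c" for k i
  have a: "exp (c * a k i) = P i - P k" if "i < 5" "k < 5" "i \<noteq> k" for i k
    using neq[OF that] c0 by (simp add: a_def)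
  have "\<exists>n. \<forall>i j k. i < j \<longrightarrow> j < 5 \<longrightarrow> k < 5 \<longrightarrow> k \<noteq> i \<longrightarrow> k \<noteq> j \<longrightarrow>
      winding_number (p i j) (P k) = a k j - a k i + of_int (n i j k)"
  proof -
    have "\<exists>n. winding_number (p i j) (P k) = a k j - a k i + of_int n"
      if "i < j" "j < 5" "k < 5" "k \<noteq> i" "k \<noteq> j" for i j k
    proof -
      have "P j - P k = exp (c * winding_number (p i j) (P k)) * (P i - P k)"
        using winding_number_exp_2pi[of "p i j" "P k"] path[of i j] avoid[of i j k] that
        by (simp add: c_def)
      then have "exp (c * (winding_number (p i j) (P k) + a k i)) = exp (c * a k j)"
        using a[of j k] a[of i k] that by (simp add: distrib_left exp_add)
      from ex_int[OF this] show ?thesis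
        by (metis (no_types, lifting) add.commute add_diff_eq add_implies_diff)
    qed
    then show ?thesis by metis
  qed
  then obtain n where n: "\<And>i j k. i < j \<Longrightarrow> j < 5 \<Longrightarrow> k < 5 \<Longrightarrow> k \<noteq> i \<Longrightarrow> k \<noteq> j \<Longrightarrow>
      winding_number (p i j) (P k) = a k j - a k i + of_int (n i j k)" by blast
  \<comment> \<open>Reversing a vector is half a turn; these halves are the source of the odd
    number.\<close>
  have "\<exists>m. a k i = a i k + 1/2 + of_int m" if "i < 5" "k < 5" "i \<noteq> k" for i k
  proof -
    have "exp (c * (a i k + 1/2)) = - exp (c * a i k)"
      by (simp add: distrib_left exp_add c_def)
    also have "\<dots> = exp (c * a k i)" using a[of i k] a[of k i] that by simp
    finally show ?thesis using ex_int by metis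
  qed
  then obtain m where m: "\<And>i k. i < 5 \<Longrightarrow> k < 5 \<Longrightarrow> i \<noteq> k \<Longrightarrow> a k i = a i k + 1/2 + of_int (m i k)"
    by metis
  have eq: "(a k j - a k i + of_int (n i j k)) + (a j l - a j k + of_int (n k l j))
      - (a l j - a l i + of_int (n i j l)) - (a i l - a i k + of_int (n k l i)) = 0"
    if "i < j" "j < 5" "k < l" "l < 5" "i \<noteq> k" "i \<noteq> l" "j \<noteq> k" "j \<noteq> l" for i j k l
    using crossing[of i j k l] path[of i j] path[of k l] n[of i j k] n[of i j l] n[of k l i] n[of k l j] that
    by (simp add: crossing_def)
  \<comment> \<open>The twelve ambiguities in the equations for the three ways of splitting four
    points into two pairs. Signs are dropped because only the parity matters.\<close>
  define N where "N w x y z = n w x y + n w x z + n y z w + n y z x + n w y x + n w y z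
      + n x z w + n x z y + n w z x + n w z y + n x y w + n x y z" for w x y z
  have four: "odd (N w x y z)"
    if "w < x" "x < y" "y < z" "z < 5" for w x y z
  proof -
    have "of_int (n w x y + n y z x - n w x z - n y z w + n w y x + n x z y - n w y z - n x z w
        + n w z x + n x y z - n w z y - n x y w) = real_of_int (1 + 2 * (m x z + m w x - m w z))"
      using eq[of w x y z, THEN arg_cong[where f=Re]] eq[of w y x z, THEN arg_cong[where f=Re]]
        eq[of w z x y, THEN arg_cong[where f=Re]] m[of x z, THEN arg_cong[where f=Re]]
        m[of w x, THEN arg_cong[where f=Re]] m[of w z, THEN arg_cong[where f=Re]] that
      by simp
    then have "n w x y + n y z x - n w x z - n y z w + n w y x + n x z y - n w y z - n x z w
        + n w z x + n x y z - n w z y - n x y w = 1 + 2 * (m x z + m w x - m w z)"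
      using of_int_eq_iff by blast
    then have "N w x y z
        = 2 * (m x z + m w x - m w z + n w x z + n y z w + n w y z + n x z w + n w z y + n x y w) + 1"
      unfolding N_def by simp
    then have "\<exists>K. N w x y z = 2 * K + 1" by blast
    then show ?thesis by auto
  qed
  \<comment> \<open>The integer \<open>n i j k\<close> occurs for the two four-element sets formed
    by i, j, k and one further index, so the total is even although it adds up five odd
    numbers.\<close>
  have "odd (N 0 1 2 3 + N 0 1 2 4 + N 0 1 3 4 + N 0 2 3 4 + N 1 2 3 4)"
    using four[of 0 1 2 3] four[of 0 1 2 4] four[of 0 1 3 4] four[of 0 2 3 4] four[of 1 2 3 4]
    by simp
  moreover have "N 0 1 2 3 + N 0 1 2 4 + N 0 1 3 4 + N 0 2 3 4 + N 1 2 3 4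
     = 2 * (n 0 1 2 + n 0 1 3 + n 0 1 4 + n 0 2 1 + n 0 2 3 + n 0 2 4 + n 0 3 1 + n 0 3 2 + n 0 3 4
        + n 0 4 1 + n 0 4 2 + n 0 4 3 + n 1 2 0 + n 1 2 3 + n 1 2 4 + n 1 3 0 + n 1 3 2 + n 1 3 4
        + n 1 4 0 + n 1 4 2 + n 1 4 3 + n 2 3 0 + n 2 3 1 + n 2 3 4 + n 2 4 0 + n 2 4 1 + n 2 4 3
        + n 3 4 0 + n 3 4 1 + n 3 4 2)"
    by (simp add: N_def)
  ultimately show False by (metis dvd_triv_left)
qed

section \<open>Jordan regions\<close>

lemma jordan_regionE:
  assumes "jordan_region D"
  obtains c where "simple_path c" "pathfinish c = pathstart c" "frontier D = path_image c"
    "D = path_image c \<union> inside (path_image c)" "interior D = inside (path_image c)"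
    "- D = outside (path_image c)" "closure (interior D) = D"
proof -
  obtain c where c: "simple_path c" "pathfinish c = pathstart c"
    and D: "D = path_image c \<union> inside (path_image c)"
    using assms unfolding jordan_region_def by blast
  note J = Jordan_inside_outside[OF c]
  have out: "- D = outside (path_image c)"
    using J D by blast
  have cl: "closure (inside (path_image c)) = D"
    using J D by (metis closure_Un_frontier sup_commute)
  have "interior D = - closure (outside (path_image c))"
    using closure_complement[of D] out by simp
  also have "\<dots> = - (outside (path_image c) \<union> path_image c)"
    using J by (metis closure_Un_frontier)
  also have "\<dots> = inside (path_image c)"
    using J by blast
  finally have int: "interior D = inside (path_image c)" .
  have "closure D = D" using cl closure_closure by metis
  then have "frontier D = path_image c"
    using D int inside_no_overlap[of "path_image c"] unfolding frontier_def by blast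
  then show ?thesis
    using that c D int out cl by simp
qed

lemma jordan_region_facts:
  assumes "jordan_region D"
  shows "compact D" "connected (- D)" "connected (interior D)" "closure (interior D) = D"
    "interior D \<noteq> {}" "infinite (frontier D)" "\<not> bounded (- D)" "closure (- D) = - interior D"
    "D = interior D \<union> frontier D" "interior D \<inter> frontier D = {}"
proof -
  obtain c where c: "simple_path c" "pathfinish c = pathstart c" "frontier D = path_image c"
    "D = path_image c \<union> inside (path_image c)" "interior D = inside (path_image c)"
    "- D = outside (path_image c)" "closure (interior D) = D"
    using jordan_regionE[OF assms] by blast
  note J = Jordan_inside_outside[OF c(1,2)]
  show cl: "closure (interior D) = D" by fact
  show "connected (- D)" "\<not> bounded (- D)" using J c by auto
  show "connected (interior D)" "interior D \<noteq> {}" using J c by auto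
  show "compact D"
    using J c cl by (metis bounded_closure closed_closure compact_eq_bounded_closed)
  show "infinite (frontier D)"
    using c simple_path_image_uncountable uncountable_infinite by metis
  show "closure (- D) = - interior D" by (rule closure_complement)
  show "D = interior D \<union> frontier D" using c by auto
  show "interior D \<inter> frontier D = {}" by (auto simp: frontier_def)
qed

text \<open>A connected set on both sides would meet the frontier of \<open>interior D\<close>,
  which is all of \<open>frontier D\<close> because \<open>D\<close> is the closure of its
  interior.\<close>

lemma connected_subset_interior_or_exterior:
  fixes D S :: "complex set"
  assumes "jordan_region D" "connected S" "S \<inter> frontier D = {}"
  shows "S \<subseteq> interior D \<or> S \<subseteq> - D"
proof (rule ccontr)
  assume *: "\<not> ?thesis"
  have "S \<inter> interior D \<noteq> {}" using * jordan_region_facts(9)[OF assms(1)] assms(3) by blast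
  moreover have "S - interior D \<noteq> {}" using * by blast
  ultimately have "S \<inter> frontier (interior D) \<noteq> {}"
    using connected_Int_frontier[OF assms(2)] by blast
  moreover have "frontier (interior D) = frontier D"
    using jordan_region_facts(4)[OF assms(1)] by (simp add: frontier_def closure_closure)
      (metis frontier_def closure_closure interior_interior)
  ultimately show False using assms(3) by blast
qed

text \<open>The interior is open and connected and the frontier is a curve; a segment from an
  interior point to a boundary point, with no boundary point in between, ties the two
  together.\<close>

lemma path_connected_jordan_region:
  assumes "jordan_region D"
  shows "path_connected D"
proof -
  note F = jordan_region_facts[OF assms]
  obtain c where c: "simple_path c" "frontier D = path_image c"
    using jordan_regionE[OF assms] by metis
  have pcf: "path_connected (frontier D)"
    using c by (metis path_connected_path_image simple_path_imp_path)
  have pci: "path_connected (interior D)"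
    by (simp add: F(3) connected_open_path_connected)
  obtain z where z: "z \<in> interior D" using F(5) by blast
  obtain b where b: "b \<in> frontier D" "open_segment z b \<inter> frontier D = {}"
    using segment_to_point_exists[of "frontier D" z] F(6) by (metis finite.emptyI frontier_closed)
  have zb: "z \<noteq> b" using z b(1) F(10) by blast
  have "connected (insert z (open_segment z b))"
  proof (rule connected_intermediate_closure)
    show "connected (open_segment z b)" by (simp add: convex_connected)
    show "insert z (open_segment z b) \<subseteq> closure (open_segment z b)"
      using zb by (auto simp: open_closed_segment)
  qed auto
  moreover have "insert z (open_segment z b) \<inter> frontier D = {}" using z b F(10) by blast
  ultimately have "insert z (open_segment z b) \<subseteq> interior D"
    using connected_subset_interior_or_exterior[OF assms] z interior_subset by fastforce
  then have seg: "closed_segment z b \<subseteq> D"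
    using b F(9) by (auto simp: closed_segment_eq_open)
  have "path_connected (interior D \<union> closed_segment z b \<union> frontier D)"
    using z b by (intro path_connected_Un pcf pci path_connected_segment) auto
  moreover have "interior D \<union> closed_segment z b \<union> frontier D = D"
    using seg F(9) by blast
  ultimately show ?thesis by simp
qed

text \<open>The exterior of \<open>A\<close> is connected and misses the frontier of
  \<open>B\<close>. Being unbounded it does not fit into \<open>B\<close>, so it lies entirely
  outside.\<close>

lemma jordan_region_subset:
  assumes "jordan_region A" "jordan_region B" "frontier B \<subseteq> A"
  shows "B \<subseteq> A"
proof -
  note FA = jordan_region_facts[OF assms(1)] and FB = jordan_region_facts[OF assms(2)]
  have "- A \<subseteq> interior B \<or> - A \<subseteq> - B"
    using connected_subset_interior_or_exterior[OF assms(2) FA(2)] assms(3) by blast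
  moreover have "bounded (interior B)"
    using FB(1) interior_subset by (metis bounded_subset compact_imp_bounded)
  ultimately show ?thesis using FA(7) bounded_subset by blast
qed

text \<open>The connected set \<open>interior A\<close> misses the frontier of \<open>B\<close>; if
  it were inside \<open>B\<close>, taking closures would give the excluded inclusion.\<close>

lemma jordan_region_frontier_outside:
  assumes "jordan_region A" "jordan_region B" "frontier B \<inter> interior A = {}" "\<not> A \<subseteq> B"
  shows "interior A \<inter> B = {}"
proof -
  note FA = jordan_region_facts[OF assms(1)] and FB = jordan_region_facts[OF assms(2)]
  have "interior A \<subseteq> interior B \<or> interior A \<subseteq> - B"
    using connected_subset_interior_or_exterior[OF assms(2) FA(3)] assms(3) by blast
  moreover have "\<not> interior A \<subseteq> interior B"
    using assms(4) FA(4) FB(4) closure_mono by metis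
  ultimately show ?thesis by blast
qed

lemma jordan_region_frontier_arcs:
  assumes "jordan_region B" "p \<in> frontier B" "q \<in> frontier B" "p \<noteq> q"
  obtains u d where "arc u" "arc d" "pathstart u = p" "pathfinish u = q"
    "pathstart d = q" "pathfinish d = p" "path_image u \<inter> path_image d = {p,q}"
    "path_image u \<union> path_image d = frontier B"
proof -
  obtain c where c: "simple_path c" "pathfinish c = pathstart c" "frontier B = path_image c"
    using jordan_regionE[OF assms(1)] by metis
  show ?thesis
    by (rule exists_double_arc[OF c(1,2) assms(2,3)[unfolded c(3)] assms(4)], rule that)
      (simp_all add: c(3))
qed

lemma arc_side_of_jordan_region:
  assumes "jordan_region A" "arc u" "pathstart u = p" "pathfinish u = q"
    "path_image u \<inter> frontier A \<subseteq> {p,q}"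
  shows "path_image u - {p,q} \<subseteq> interior A \<or> path_image u - {p,q} \<subseteq> - A"
proof (rule connected_subset_interior_or_exterior[OF assms(1)])
  show "connected (path_image u - {p,q})"
    using connected_simple_path_endless[OF arc_imp_simple_path[OF assms(2)]] assms(3,4) by simp
  show "(path_image u - {p,q}) \<inter> frontier A = {}" using assms(5) by auto
qed

lemma closure_arc_endless:
  fixes u :: "real \<Rightarrow> complex"
  assumes "arc u" "pathstart u = p" "pathfinish u = q"
  shows "path_image u \<subseteq> closure (path_image u - {p,q})" "path_image u - {p,q} \<noteq> {}"
proof -
  have e: "path_image u - {p,q} = u ` {0<..<1}"
    using simple_path_endless[OF arc_imp_simple_path[OF assms(1)]] assms by simp
  then show "path_image u - {p,q} \<noteq> {}" by simp
  have "u ` closure {0<..<1} \<subseteq> closure (u ` {0<..<1})"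
    by (rule image_closure_subset[OF _ closed_closure closure_subset])
      (use assms(1) in \<open>simp add: arc_def path_def\<close>)
  then show "path_image u \<subseteq> closure (path_image u - {p,q})"
    unfolding e by (simp add: path_image_def)
qed

text \<open>The main case: the arc \<open>u\<close> of the boundary of \<open>B\<close> is a crosscut of \<open>A\<close>, which splits
  \<open>A\<close> into a part inside \<open>B\<close> and a part outside \<open>B\<close>.\<close>

lemma connected_interior_minus_crosscut:
  assumes A: "jordan_region A" and B: "jordan_region B" and ncover: "\<not> A \<subseteq> B" "\<not> B \<subseteq> A"
    and u: "arc u" "pathstart u = p" "pathfinish u = q" and "p \<noteq> q"
    and fB: "path_image u \<union> d = frontier B" and pq: "p \<in> frontier A" "q \<in> frontier A"
    and common: "frontier A \<inter> frontier B \<subseteq> {p,q}"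
    and uA: "path_image u - {p,q} \<subseteq> interior A" and dA: "d - {p,q} \<subseteq> - A"
  shows "connected (interior A - B)"
proof -
  note FA = jordan_region_facts[OF A] and FB = jordan_region_facts[OF B]
  obtain c where c: "frontier A = path_image c" "interior A = inside (path_image c)"
    using jordan_regionE[OF A] by metis
  obtain a1 a2 where a: "arc a1" "arc a2" "pathstart a1 = p" "pathfinish a1 = q"
    "pathstart a2 = p" "pathfinish a2 = q"
    "path_image a1 \<inter> path_image a2 = {p,q}" "path_image a1 \<union> path_image a2 = frontier A"
  proof -
    obtain v e where "arc v" "arc e" "pathstart v = p" "pathfinish v = q"
      "pathstart e = q" "pathfinish e = p" "path_image v \<inter> path_image e = {p,q}"
      "path_image v \<union> path_image e = frontier A"
      by (rule jordan_region_frontier_arcs[OF A pq \<open>p \<noteq> q\<close>])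
    then show ?thesis using that[of v "reversepath e"] by (simp add: arc_reversepath)
  qed
  have ends: "p \<in> path_image u" "q \<in> path_image u"
    using u pathstart_in_path_image pathfinish_in_path_image by metis+
  have endsB: "p \<in> frontier B" "q \<in> frontier B" using ends fB by blast+
  have u_ne: "path_image u - {p,q} \<noteq> {}" using closure_arc_endless[OF u] by blast
  have side: "path_image a - {p,q} \<subseteq> interior B \<or> path_image a - {p,q} \<subseteq> - B"
    if "a = a1 \<or> a = a2" for a
    using arc_side_of_jordan_region[OF B, of a p q] a common that by blast
  have "\<not> (path_image a1 - {p,q} \<subseteq> interior B \<and> path_image a2 - {p,q} \<subseteq> interior B)"
    using jordan_region_subset[OF B A] ncover(1) a(8) endsB FB(9) by blast
  \<comment> \<open>Otherwise \<open>B\<close> would avoid \<open>interior A\<close>, but the inner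
    points of \<open>u\<close> lie in both.\<close>
  moreover have "\<not> (path_image a1 - {p,q} \<subseteq> - B \<and> path_image a2 - {p,q} \<subseteq> - B)"
  proof
    assume *: "path_image a1 - {p,q} \<subseteq> - B \<and> path_image a2 - {p,q} \<subseteq> - B"
    have "frontier A \<inter> interior B = {}"
      using * a(8) endsB FB(10) interior_subset[of B] by blast
    then have "interior B \<inter> A = {}"
      by (rule jordan_region_frontier_outside[OF B A]) (rule ncover)
    then have "B \<subseteq> closure (- A)"
      using FB(4) closure_mono[of "interior B" "- A"] by blast
    then show False using u_ne uA fB FB(9) FA(8) by blast
  qed
  ultimately obtain b1 b2 where b: "{b1,b2} = {a1,a2}" "path_image b1 - {p,q} \<subseteq> interior B"
    "path_image b2 - {p,q} \<subseteq> - B"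
    using side by blast
  have bb: "arc b1" "arc b2" "pathstart b1 = p" "pathfinish b1 = q"
    "pathstart b2 = p" "pathfinish b2 = q"
    "path_image b1 \<inter> path_image b2 = {p,q}" "path_image b1 \<union> path_image b2 = frontier A"
    using a b(1) by (auto simp: doubleton_eq_iff Un_commute)
  have bu: "path_image b1 \<inter> path_image u = {p,q}" "path_image b2 \<inter> path_image u = {p,q}"
    using bb common fB ends by blast+
  define R1 where "R1 = inside (path_image b1 \<union> path_image u)"
  define R2 where "R2 = inside (path_image b2 \<union> path_image u)"
  have split: "R1 \<union> R2 \<union> (path_image u - {p,q}) = interior A"
  proof -
    have "path_image u \<inter> inside (path_image b1 \<union> path_image b2) \<noteq> {}"
      using u_ne uA c bb(8) by auto
    then show ?thesis
      using split_inside_simple_closed_curve[of b1 p q b2 u] bb u bu \<open>p \<noteq> q\<close> arc_imp_simple_path c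
      unfolding R1_def R2_def by metis
  qed
  have region: "connected (inside (path_image b \<union> path_image u))"
      "frontier (inside (path_image b \<union> path_image u)) = path_image b \<union> path_image u"
      "inside (path_image b \<union> path_image u) \<inter> (path_image b \<union> path_image u) = {}"
    if "b = b1 \<or> b = b2" for b
  proof -
    have s: "simple_path (b +++ reversepath u)"
      using that bb u bu by (auto intro!: simple_path_join_loop simp: arc_reversepath)
    have i: "path_image (b +++ reversepath u) = path_image b \<union> path_image u"
      using that bb u by (auto simp: path_image_join)
    have l: "pathfinish (b +++ reversepath u) = pathstart (b +++ reversepath u)"
      using that bb u by auto
    note J = Jordan_inside_outside[OF s l, unfolded i]
    show "connected (inside (path_image b \<union> path_image u))"
      "frontier (inside (path_image b \<union> path_image u)) = path_image b \<union> path_image u"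
      using J by auto
    show "inside (path_image b \<union> path_image u) \<inter> (path_image b \<union> path_image u) = {}"
      by simp
  qed
  have RB: "R1 \<inter> frontier B = {}" "R2 \<inter> frontier B = {}"
  proof -
    have "interior A \<inter> d \<subseteq> {p,q}" using dA interior_subset[of A] by blast
    then have "interior A \<inter> frontier B \<subseteq> path_image u"
      using fB ends by blast
    then show "R1 \<inter> frontier B = {}" "R2 \<inter> frontier B = {}"
      using split region(3)[of b1] region(3)[of b2] unfolding R1_def R2_def by blast+
  qed
  \<comment> \<open>Each of the two regions has the inner points of its arc \<open>b1\<close> or
    \<open>b2\<close> in its closure. These lie in the open set \<open>interior B\<close> or
    \<open>- B\<close>, which decides on which side of \<open>frontier B\<close> the region
    lies.\<close>
  have meet: "\<exists>x\<in>path_image b - {p,q}. x \<in> closure (inside (path_image b \<union> path_image u))"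
    if "b = b1 \<or> b = b2" for b
    using that bb closure_arc_endless(2)[of b p q] region(2)[of b] by (auto simp: frontier_def)
  have R1: "R1 \<subseteq> interior B"
  proof -
    have "R1 \<inter> interior B \<noteq> {}"
      using meet[of b1] b(2) open_Int_closure_eq_empty[of "interior B" R1] unfolding R1_def by auto
    then show ?thesis
      using connected_subset_interior_or_exterior[OF B _ RB(1)] region(1)[of b1] interior_subset
      unfolding R1_def by blast
  qed
  have R2: "R2 \<subseteq> - B"
  proof -
    have "R2 \<inter> - B \<noteq> {}"
      using meet[of b2] b(3) open_Int_closure_eq_empty[of "- B" R2] FB(1) compact_imp_closed
      unfolding R2_def by blast
    then show ?thesis
      using connected_subset_interior_or_exterior[OF B _ RB(2)] region(1)[of b2] interior_subset
      unfolding R2_def by blast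
  qed
  have "interior A - B = R2"
    using split R1 R2 interior_subset[of B] fB FB(9) by blast
  then show ?thesis using region(1)[of b2] by (simp add: R2_def)
qed

text \<open>The common boundary points are padded to exactly two points of
  \<open>frontier B\<close>, which cut that curve into two arcs, each inside or outside
  \<open>A\<close> up to its ends. Both inside would give \<open>B \<subseteq> A\<close>; both
  outside leaves \<open>interior A\<close> untouched; one of each kind is the crosscut case.\<close>

lemma connected_interior_minus:
  assumes A: "jordan_region A" and B: "jordan_region B" and ncover: "\<not> A \<subseteq> B" "\<not> B \<subseteq> A"
    and fin: "finite (frontier A \<inter> frontier B)" "card (frontier A \<inter> frontier B) \<le> 2"
  shows "connected (interior A - B)"
proof -
  note FA = jordan_region_facts[OF A] and FB = jordan_region_facts[OF B]
  obtain T where T: "frontier A \<inter> frontier B \<subseteq> T" "T \<subseteq> frontier B" "card T = 2"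
  proof -
    obtain n where n: "2 = card (frontier A \<inter> frontier B) + n" using fin(2) le_Suc_ex by blast
    obtain S where S: "S \<subseteq> frontier B - frontier A" "finite S" "card S = n"
      using infinite_arbitrarily_large[of "frontier B - frontier A" n] FB(6) fin(1)
      by (metis Diff_Int2 Diff_infinite_finite Diff_cancel Int_Diff Int_commute inf.idem Diff_Int)
    have "card ((frontier A \<inter> frontier B) \<union> S) = 2"
      using S n fin(1) by (subst card_Un_disjoint) auto
    then show ?thesis using that[of "(frontier A \<inter> frontier B) \<union> S"] S(1) by blast
  qed
  then obtain p q where pq: "p \<noteq> q" "T = {p,q}" by (meson card_2_iff)
  obtain u d where ud: "arc u" "arc d" "pathstart u = p" "pathfinish u = q"
    "pathstart d = q" "pathfinish d = p" "path_image u \<inter> path_image d = {p,q}"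
    "path_image u \<union> path_image d = frontier B"
    by (rule jordan_region_frontier_arcs[OF B, of p q]) (use T pq in auto)
  have side_u: "path_image u - {p,q} \<subseteq> interior A \<or> path_image u - {p,q} \<subseteq> - A"
    using T(1) pq(2) ud(8) by (intro arc_side_of_jordan_region[OF A ud(1,3,4)]) auto
  have "path_image d - {q,p} \<subseteq> interior A \<or> path_image d - {q,p} \<subseteq> - A"
    using T(1) pq(2) ud(8) by (intro arc_side_of_jordan_region[OF A ud(2,5,6)]) auto
  then have side: "path_image d - {p,q} \<subseteq> interior A \<or> path_image d - {p,q} \<subseteq> - A"
    by (simp only: insert_commute)
  note cl = closure_arc_endless[OF ud(1,3,4)] closure_arc_endless[OF ud(2,5,6)]
  have dq: "path_image d \<subseteq> closure (path_image d - {p,q})"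
    using closure_arc_endless(1)[OF ud(2,5,6)] by (simp add: insert_commute)
  have ends: "p \<in> path_image u" "q \<in> path_image u" "p \<in> path_image d" "q \<in> path_image d"
    using ud(7) by auto
  \<comment> \<open>The padding may have added points off \<open>frontier A\<close>. With arcs on
    both sides this cannot happen, as p and q are limits of interior and of exterior points of
    \<open>A\<close>.\<close>
  have both: "p \<in> frontier A \<and> q \<in> frontier A"
    if "path_image v - {p,q} \<subseteq> interior A" "path_image w - {p,q} \<subseteq> - A" 
      "{v,w} = {u,d}" for v w
  proof -
    have "{p,q} \<subseteq> closure (path_image x - {p,q})" if "x = u \<or> x = d" for x
      using that ends cl(1) dq by blast
    then have "{p,q} \<subseteq> closure (interior A)" "{p,q} \<subseteq> closure (- A)"
      using that closure_mono[OF that(1)] closure_mono[OF that(2)] by (auto simp: doubleton_eq_iff)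
    then show ?thesis using FA(4,8,9) by blast
  qed
  consider "path_image u - {p,q} \<subseteq> interior A" "path_image d - {p,q} \<subseteq> interior A"
    | "path_image u - {p,q} \<subseteq> - A" "path_image d - {p,q} \<subseteq> - A"
    | "path_image u - {p,q} \<subseteq> interior A" "path_image d - {p,q} \<subseteq> - A"
    | "path_image d - {p,q} \<subseteq> interior A" "path_image u - {p,q} \<subseteq> - A"
    using side side_u by blast
  then show ?thesis
  proof cases
    case 1
    have "path_image u \<subseteq> A" "path_image d \<subseteq> A"
      using cl(1) dq closure_mono[OF 1(1)] closure_mono[OF 1(2)] FA(4) by auto
    then have "B \<subseteq> A" using jordan_region_subset[OF A B] ud(8) by blast
    then show ?thesis using ncover by blast
  next
    case 2
    have "path_image u \<subseteq> closure (- A)" "path_image d \<subseteq> closure (- A)"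
      using cl(1) dq closure_mono[OF 2(1)] closure_mono[OF 2(2)] by auto
    then have "frontier B \<inter> interior A = {}" using ud(8) FA(8) by blast
    then have "interior A \<inter> B = {}"
      by (rule jordan_region_frontier_outside[OF A B]) (rule ncover)
    then have "interior A - B = interior A" by blast
    then show ?thesis using FA(3) by simp
  next
    case 3
    then show ?thesis
      using connected_interior_minus_crosscut[OF A B ncover ud(1,3,4) pq(1) ud(8)] both[OF 3] T pq
      by blast
  next
    case 4
    then show ?thesis
      using connected_interior_minus_crosscut[OF A B ncover ud(2,5,6), of "path_image u"]
        both[OF 4] T pq ud(8) by (auto simp: insert_commute Un_commute)
  qed
qed


section \<open>Moving a path in one pseudo-disc off another pseudo-disc\<close>

text \<open>A path from z to a far point \<open>Z\<close> in the complement of \<open>K\<close>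
  keeps a positive distance from \<open>K\<close>. Loops closer to \<open>K\<close> than that miss
  the path, so their winding number is the same at z as at \<open>Z\<close>, where it
  vanishes.\<close>

lemma winding_number_zero_near_compact:
  fixes K :: "complex set"
  assumes "compact K" "connected (- K)" "z \<notin> K"
  obtains \<eta> where "\<eta> > 0" "\<And>\<rho>. path \<rho> \<Longrightarrow> pathfinish \<rho> = pathstart \<rho> \<Longrightarrow>
      path_image \<rho> \<subseteq> (\<Union>x\<in>K. ball x \<eta>) \<Longrightarrow> z \<notin> path_image \<rho> \<and> winding_number \<rho> z = 0"
proof -
  obtain r where r: "r > 0" "K \<subseteq> ball 0 r"
    using bounded_subset_ballD[OF compact_imp_bounded[OF assms(1)]] by blast
  define Z where "Z = complex_of_real (r + 1)"
  have "Z \<notin> K" using r by (auto simp: Z_def)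
  moreover have "path_connected (- K)"
    using assms(1,2) by (simp add: compact_imp_closed connected_open_path_connected open_Compl)
  ultimately obtain g where g: "path g" "path_image g \<subseteq> - K" "pathstart g = z" "pathfinish g = Z"
    using assms(3) unfolding path_connected_def by (metis ComplI)
  obtain e where e: "e > 0" "\<And>x y. x \<in> K \<Longrightarrow> y \<in> path_image g \<Longrightarrow> e \<le> dist x y"
    using separate_compact_closed[OF assms(1) closed_path_image[OF g(1)]] g(2) by blast
  show ?thesis
  proof (rule that)
    \<comment> \<open>The bound 1 keeps the loop inside the open ball of radius r + 1, on whose
      boundary \<open>Z\<close> lies.\<close>
    show "min e 1 > 0" using e by simp
    fix \<rho> assume \<rho>: "path \<rho>" "pathfinish \<rho> = pathstart \<rho>"
      "path_image \<rho> \<subseteq> (\<Union>x\<in>K. ball x (min e 1))"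
    have dis: "path_image g \<inter> path_image \<rho> = {}"
      using \<rho>(3) e(2) by force
    have zz: "z \<in> path_image g" "Z \<in> path_image g"
      using g pathstart_in_path_image pathfinish_in_path_image by metis+
    have "winding_number \<rho> z = winding_number \<rho> Z"
      by (rule winding_number_eq[OF \<rho>(1,2) zz connected_path_image[OF g(1)] dis])
    also have "\<dots> = 0"
    proof (rule winding_number_zero_outside[OF \<rho>(1) convex_ball \<rho>(2)])
      show "Z \<notin> ball 0 (r + 1)" using r by (simp add: Z_def)
      show "path_image \<rho> \<subseteq> ball 0 (r + 1)"
      proof
        fix y assume "y \<in> path_image \<rho>"
        then obtain x where x: "x \<in> K" "dist x y < 1" using \<rho>(3) by force
        then have "norm x < r" using r by auto
        moreover have "norm y \<le> norm x + dist x y"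
          by (metis dist_0_norm dist_triangle)
        ultimately show "y \<in> ball 0 (r + 1)" using x by simp
      qed
    qed
    finally show "z \<notin> path_image \<rho> \<and> winding_number \<rho> z = 0" using dis zz by blast
  qed
qed

text \<open>The end points may lie on the frontier of \<open>A\<close>, so they are joined to nearby
  interior points by short segments. Such a segment may leave \<open>A\<close>, which is why the
  path is confined only to a neighbourhood of \<open>A\<close>.\<close>

lemma path_near_interior:
  assumes A: "jordan_region A" and "closed B" and con: "connected (interior A - B)"
    and x: "x \<in> A - B" and y: "y \<in> A - B" and "\<eta> > 0"
  obtains g where "path g" "pathstart g = x" "pathfinish g = y" "path_image g \<inter> B = {}"
    "path_image g \<subseteq> (\<Union>z\<in>A. ball z \<eta>)"
proof -
  have near: "\<exists>x'. x' \<in> interior A - B \<and> closed_segment x x' \<subseteq> ball x \<eta> - B" if "x \<in> A - B" for x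
  proof -
    have "open (- B)" "x \<in> - B" using \<open>closed B\<close> that by auto
    then obtain r where r: "r > 0" "ball x r \<subseteq> - B" by (rule openE)
    have "x \<in> closure (interior A)" using that jordan_region_facts(4)[OF A] by simp
    then obtain x' where x': "x' \<in> interior A" "dist x' x < min r \<eta>"
      using r(1) \<open>\<eta> > 0\<close> closure_approachable by (metis min_less_iff_conj)
    then have "closed_segment x x' \<subseteq> ball x (min r \<eta>)"
      using r(1) \<open>\<eta> > 0\<close> by (intro closed_segment_subset) (auto simp: dist_commute)
    moreover have "x' \<in> closed_segment x x'" by simp
    ultimately show ?thesis using x' r(2) by (intro exI[of _ x']) (auto simp: subset_iff)
  qed
  obtain x' where x': "x' \<in> interior A - B" "closed_segment x x' \<subseteq> ball x \<eta> - B"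
    using near[OF x] by blast
  obtain y' where y': "y' \<in> interior A - B" "closed_segment y y' \<subseteq> ball y \<eta> - B"
    using near[OF y] by blast
  have "path_connected (interior A - B)"
    using con \<open>closed B\<close> by (simp add: connected_open_path_connected open_Diff)
  then obtain h where h: "path h" "path_image h \<subseteq> interior A - B" "pathstart h = x'" "pathfinish h = y'"
    using x' y' unfolding path_connected_def by metis
  let ?g = "linepath x x' +++ h +++ linepath y' y"
  have im: "path_image ?g = closed_segment x x' \<union> path_image h \<union> closed_segment y y'"
    using h by (simp add: path_image_join closed_segment_commute Un_assoc)
  have "path_image h \<subseteq> (\<Union>z\<in>A. ball z \<eta>)"
    using h(2) interior_subset[of A] \<open>\<eta> > 0\<close> by fastforce
  then show ?thesis
    using x y x' y' h im by (intro that[of ?g]) auto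
qed

text \<open>The path \<open>\<gamma>\<close> may be replaced by one close to \<open>A\<close> that avoids \<open>B\<close>: the two differ by a
  loop near \<open>A\<close>, which does not wind around the end points of \<open>\<delta>\<close>.\<close>

lemma unlinked_in_pseudo_discs:
  assumes A: "jordan_region A" and B: "jordan_region B"
    and fin: "finite (frontier A \<inter> frontier B)" "card (frontier A \<inter> frontier B) \<le> 2"
    and \<gamma>: "path \<gamma>" "path_image \<gamma> \<subseteq> A" "pathstart \<gamma> \<notin> B" "pathfinish \<gamma> \<notin> B"
    and \<delta>: "path \<delta>" "path_image \<delta> \<subseteq> B" "pathstart \<delta> \<notin> A" "pathfinish \<delta> \<notin> A"
  shows "unlinked \<gamma> \<delta>"
proof -
  note FA = jordan_region_facts[OF A] and FB = jordan_region_facts[OF B]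
  have ends: "pathstart \<gamma> \<in> A - B" "pathfinish \<gamma> \<in> A - B"
    "pathstart \<delta> \<in> B - A" "pathfinish \<delta> \<in> B - A"
    using \<gamma> \<delta> by auto
  \<comment> \<open>The end points of the two paths witness that neither disc contains the
    other.\<close>
  have con: "connected (interior A - B)"
    using connected_interior_minus[OF A B _ _ fin] ends by blast
  obtain \<eta>1 where \<eta>1: "\<eta>1 > 0" "\<And>\<rho>. path \<rho> \<Longrightarrow> pathfinish \<rho> = pathstart \<rho> \<Longrightarrow>
      path_image \<rho> \<subseteq> (\<Union>x\<in>A. ball x \<eta>1) \<Longrightarrow>
      pathstart \<delta> \<notin> path_image \<rho> \<and> winding_number \<rho> (pathstart \<delta>) = 0"
    by (rule winding_number_zero_near_compact[OF FA(1,2) \<delta>(3)]) blast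
  obtain \<eta>2 where \<eta>2: "\<eta>2 > 0" "\<And>\<rho>. path \<rho> \<Longrightarrow> pathfinish \<rho> = pathstart \<rho> \<Longrightarrow>
      path_image \<rho> \<subseteq> (\<Union>x\<in>A. ball x \<eta>2) \<Longrightarrow>
      pathfinish \<delta> \<notin> path_image \<rho> \<and> winding_number \<rho> (pathfinish \<delta>) = 0"
    by (rule winding_number_zero_near_compact[OF FA(1,2) \<delta>(4)]) blast
  define \<eta> where "\<eta> = min \<eta>1 \<eta>2"
  have "\<eta> > 0" using \<eta>1 \<eta>2 by (simp add: \<eta>_def)
  then obtain g where g: "path g" "pathstart g = pathstart \<gamma>" "pathfinish g = pathfinish \<gamma>"
      "path_image g \<inter> B = {}" "path_image g \<subseteq> (\<Union>z\<in>A. ball z \<eta>)"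
    using path_near_interior[OF A compact_imp_closed[OF FB(1)] con ends(1,2)] by blast
  let ?\<rho> = "\<gamma> +++ reversepath g"
  have loop: "path ?\<rho>" "pathfinish ?\<rho> = pathstart ?\<rho>"
    using g \<gamma> by auto
  have im: "path_image ?\<rho> = path_image \<gamma> \<union> path_image g"
    using g by (simp add: path_image_join)
  have "path_image \<gamma> \<subseteq> (\<Union>z\<in>A. ball z \<eta>)" using \<gamma>(2) \<open>\<eta> > 0\<close> by fastforce
  then have sub: "path_image ?\<rho> \<subseteq> (\<Union>z\<in>A. ball z \<eta>)" using g(5) im by blast
  have "(\<Union>z\<in>A. ball z \<eta>) \<subseteq> (\<Union>z\<in>A. ball z \<eta>1)" "(\<Union>z\<in>A. ball z \<eta>) \<subseteq> (\<Union>z\<in>A. ball z \<eta>2)"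
    by (auto simp: \<eta>_def)
  then have "path_image ?\<rho> \<subseteq> (\<Union>z\<in>A. ball z \<eta>1)" "path_image ?\<rho> \<subseteq> (\<Union>z\<in>A. ball z \<eta>2)"
    using sub by (meson order_trans)+
  then have w: "z \<notin> path_image ?\<rho> \<and> winding_number ?\<rho> z = 0" if "z \<in> {pathstart \<delta>, pathfinish \<delta>}" for z
    using \<eta>1(2)[OF loop] \<eta>2(2)[OF loop] that by (metis insertE singletonD)
  have "winding_number \<gamma> z = winding_number g z" if "z \<in> {pathstart \<delta>, pathfinish \<delta>}" for z
  proof -
    have "winding_number ?\<rho> z = winding_number \<gamma> z - winding_number g z"
      using w[OF that] im g \<gamma>(1) by (subst winding_number_join) (auto simp: winding_number_reversepath)
    then show ?thesis using w[OF that] by simp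
  qed
  then have "crossing \<gamma> \<delta> = crossing g \<delta>"
    using g by (simp add: crossing_def)
  also have "\<dots> = 0"
    using crossing_disjoint[OF g(1) \<delta>(1)] g(4) \<delta>(2) by blast
  finally show ?thesis
    using \<gamma> \<delta> by (auto simp: unlinked_def)
qed

lemma unlinked_pseudo_discs:
  assumes "pseudo_discs F" "A \<in> F" "B \<in> F"
    and \<gamma>: "path \<gamma>" "path_image \<gamma> \<subseteq> A" "pathstart \<gamma> \<notin> B" "pathfinish \<gamma> \<notin> B"
    and \<delta>: "path \<delta>" "path_image \<delta> \<subseteq> B" "pathstart \<delta> \<notin> A" "pathfinish \<delta> \<notin> A"
  shows "unlinked \<gamma> \<delta>"
proof (rule unlinked_in_pseudo_discs[OF _ _ _ _ \<gamma> \<delta>])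
  have "A \<noteq> B" using \<gamma>(2,3) pathstart_in_path_image by blast
  then show "finite (frontier A \<inter> frontier B)" "card (frontier A \<inter> frontier B) \<le> 2"
    using assms(1-3) unfolding pseudo_discs_def by blast+
  show "jordan_region A" "jordan_region B"
    using assms(1-3) unfolding pseudo_discs_def by blast+
qed

section \<open>Routes through two families of pseudo-discs\<close>

definition meeting :: "'a set set \<Rightarrow> 'a set \<Rightarrow> 'a set set" where
  "meeting V b = {a \<in> V. a \<inter> b \<noteq> {}}"

lemma meetingE:
  assumes "a \<in> meeting V b"
  obtains q where "q \<in> a" "q \<in> b"
  using assms unfolding meeting_def by blast

locale two_pseudo_disc_families =
  fixes F1 F2 :: "complex set set"
  assumes F1: "pseudo_discs F1" and F2: "pseudo_discs F2"
begin

text \<open>The points at which a route inside the group \<open>X\<close> may pass from one disc to the next. They lie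
  in no disc that belongs to a group disjoint from \<open>X\<close>.\<close>

definition junctions :: "complex set set \<Rightarrow> complex set set \<Rightarrow> complex set" where
  "junctions V X = {q. \<exists>a\<in>X. \<exists>b\<in>F2. meeting V b \<subseteq> X \<and> q \<in> a \<inter> b}"

lemma junctionsI:
  "a \<in> X \<Longrightarrow> b \<in> F2 \<Longrightarrow> meeting V b \<subseteq> X \<Longrightarrow> q \<in> a \<Longrightarrow> q \<in> b \<Longrightarrow> q \<in> junctions V X"
  unfolding junctions_def by blast

text \<open>Each piece runs inside one disc and begins and ends at junctions, so that the statement
  about paths in two pseudo-discs applies to any two pieces and \<open>unlinked_join\<close> extends
  it to whole routes.\<close>

inductive route :: "complex set set \<Rightarrow> complex set set \<Rightarrow> (real \<Rightarrow> complex) \<Rightarrow> bool"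
  for V X where
  vertex: "a \<in> X \<Longrightarrow> path \<gamma> \<Longrightarrow> path_image \<gamma> \<subseteq> a \<Longrightarrow> pathstart \<gamma> \<in> junctions V X \<Longrightarrow>
    pathfinish \<gamma> \<in> junctions V X \<Longrightarrow> route V X \<gamma>"
| edge: "b \<in> F2 \<Longrightarrow> meeting V b \<subseteq> X \<Longrightarrow> path \<gamma> \<Longrightarrow> path_image \<gamma> \<subseteq> b \<Longrightarrow>
    pathstart \<gamma> \<in> junctions V X \<Longrightarrow> pathfinish \<gamma> \<in> junctions V X \<Longrightarrow> route V X \<gamma>"
| join: "route V X \<gamma> \<Longrightarrow> route V X \<gamma>' \<Longrightarrow> pathfinish \<gamma> = pathstart \<gamma>' \<Longrightarrow> route V X (\<gamma> +++ \<gamma>')"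

lemma route_path:
  "route V X \<gamma> \<Longrightarrow> path \<gamma> \<and> pathstart \<gamma> \<in> junctions V X \<and> pathfinish \<gamma> \<in> junctions V X"
  by (induction rule: route.induct) auto

lemma junctions_mono: "X \<subseteq> Y \<Longrightarrow> junctions V X \<subseteq> junctions V Y"
  unfolding junctions_def by blast

text \<open>A junction of \<open>X\<close> lies in a member of \<open>F2\<close> that meets only
  members of \<open>X\<close>, and in a member of \<open>X\<close>. The former would meet any member
  of \<open>Y\<close> through the point, the latter would be met by any disc of \<open>F2\<close>
  reserved for \<open>Y\<close>.\<close>

lemma junctions_avoid:
  assumes "q \<in> junctions V X" "X \<inter> Y = {}" "X \<subseteq> V" "Y \<subseteq> V"
  shows "a \<in> Y \<Longrightarrow> q \<notin> a" "meeting V b \<subseteq> Y \<Longrightarrow> q \<notin> b"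
proof -
  obtain a' b' where ab: "a' \<in> X" "meeting V b' \<subseteq> X" "q \<in> a'" "q \<in> b'"
    using assms(1) unfolding junctions_def by blast
  have meetI: "c \<in> meeting V d" if "c \<in> V" "q \<in> c" "q \<in> d" for c d
    using that unfolding meeting_def by blast
  show "q \<notin> a" if "a \<in> Y" using meetI[of a b'] ab that assms(2-4) by blast
  show "q \<notin> b" if "meeting V b \<subseteq> Y" using meetI[of a' b] ab that assms(2-4) by blast
qed

lemma junctions_avoid_route:
  assumes "route V Y \<gamma>" "q \<in> junctions V X" "X \<inter> Y = {}" "X \<subseteq> V" "Y \<subseteq> V"
  shows "q \<notin> path_image \<gamma>"
  using assms
proof (induction rule: route.induct)
  case (join \<gamma> \<gamma>')
  then show ?case by (simp add: path_image_join)
next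
  case (vertex a \<gamma>)
  then show ?case using junctions_avoid(1)[of q V X Y a] by blast
next
  case (edge b \<gamma>)
  then show ?case using junctions_avoid(2)[of q V X Y b] by blast
qed

text \<open>Induction on both routes leaves two pieces. Pieces in discs of the same family have ends
  avoiding the other disc, so the pseudo-disc property applies; pieces in discs of different
  families are disjoint, because a member of \<open>F2\<close> reserved for one group does not meet
  the other group.\<close>

lemma unlinked_routes:
  assumes "route V X \<gamma>" "route V Y \<delta>" "X \<inter> Y = {}" "X \<subseteq> V" "Y \<subseteq> V" "V \<subseteq> F1"
  shows "unlinked \<gamma> \<delta>"
  using assms(1)
proof (induction rule: route.induct)
  case (join \<gamma> \<gamma>')
  then show ?case by (simp add: unlinked_join)
next
  case (vertex a \<gamma>)
  note \<gamma> = vertex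
  have av: "q \<notin> a" if "q \<in> junctions V Y" for q
    using junctions_avoid(1)[OF that, of X a] assms \<gamma> by blast
  show ?case using assms(2)
  proof (induction rule: route.induct)
    case (vertex a' \<delta>)
    then show ?case
      using unlinked_pseudo_discs[OF F1, of a a' \<gamma> \<delta>] \<gamma> av assms(3-)
        junctions_avoid(1)[OF \<gamma>(4), of Y a'] junctions_avoid(1)[OF \<gamma>(5), of Y a'] by blast
  next
    case (edge b \<delta>)
    then have "a \<inter> b = {}" using \<gamma>(1) assms(3-5) unfolding meeting_def by blast
    then show ?case using \<gamma> edge by (intro unlinked_disjoint) blast+
  next
    case (join \<delta> \<delta>')
    then show ?case by (meson unlinked_join unlinked_sym)
  qed
next
  case (edge b \<gamma>)
  note \<gamma> = edge
  have av: "q \<notin> b" if "q \<in> junctions V Y" for q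
    using junctions_avoid(2)[OF that, of X b] assms \<gamma> by blast
  show ?case using assms(2)
  proof (induction rule: route.induct)
    case (vertex a \<delta>)
    then have "a \<inter> b = {}" using \<gamma>(2) assms(3-5) unfolding meeting_def by blast
    then show ?case using \<gamma> vertex by (intro unlinked_disjoint) blast+
  next
    case (edge b' \<delta>)
    then show ?case
      using unlinked_pseudo_discs[OF F2, of b b' \<gamma> \<delta>] \<gamma> av assms(3-)
        junctions_avoid(2)[OF \<gamma>(5), of Y b'] junctions_avoid(2)[OF \<gamma>(6), of Y b'] by blast
  next
    case (join \<delta> \<delta>')
    then show ?case by (meson unlinked_join unlinked_sym)
  qed
qed

definition linked_by_route :: "complex set set \<Rightarrow> complex set set \<Rightarrow> complex \<Rightarrow> complex \<Rightarrow> bool" where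
  "linked_by_route V X p q \<longleftrightarrow> (\<exists>\<gamma>. route V X \<gamma> \<and> pathstart \<gamma> = p \<and> pathfinish \<gamma> = q)"

lemma linked_by_route_trans:
  "linked_by_route V X p q \<Longrightarrow> linked_by_route V X q r \<Longrightarrow> linked_by_route V X p r"
  unfolding linked_by_route_def by (metis route.join pathstart_join pathfinish_join)

lemma linked_by_route_vertex:
  assumes "a \<in> X" "X \<subseteq> F1" "p \<in> a" "q \<in> a" "p \<in> junctions V X" "q \<in> junctions V X"
  shows "linked_by_route V X p q"
proof -
  have "path_connected a"
    using assms F1 path_connected_jordan_region unfolding pseudo_discs_def by blast
  then obtain \<gamma> where "path \<gamma>" "path_image \<gamma> \<subseteq> a" "pathstart \<gamma> = p" "pathfinish \<gamma> = q"
    using assms unfolding path_connected_def by metis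
  then show ?thesis
    using assms route.vertex unfolding linked_by_route_def by blast
qed

lemma linked_by_route_edge:
  assumes "b \<in> F2" "meeting V b \<subseteq> X" "p \<in> b" "q \<in> b" "p \<in> junctions V X" "q \<in> junctions V X"
  shows "linked_by_route V X p q"
proof -
  have "path_connected b"
    using assms F2 path_connected_jordan_region unfolding pseudo_discs_def by blast
  then obtain \<gamma> where "path \<gamma>" "path_image \<gamma> \<subseteq> b" "pathstart \<gamma> = p" "pathfinish \<gamma> = q"
    using assms unfolding path_connected_def by metis
  then show ?thesis
    using assms route.edge unfolding linked_by_route_def by blast
qed

text \<open>Two edges without a common end run through disjoint unions of groups, and so are
  unlinked; a fifth point belongs to a group disjoint from those of an edge, and so is
  avoided.\<close>

lemma no_K5_of_routes:
  fixes X :: "nat \<Rightarrow> complex set set" and P :: "nat \<Rightarrow> complex"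
  assumes V: "V \<subseteq> F1" and X: "\<And>i. i < 5 \<Longrightarrow> X i \<subseteq> V"
    and disj: "\<And>i j. i < 5 \<Longrightarrow> j < 5 \<Longrightarrow> i \<noteq> j \<Longrightarrow> X i \<inter> X j = {}"
    and P: "\<And>i. i < 5 \<Longrightarrow> P i \<in> junctions V (X i)"
    and link: "\<And>i j. i < j \<Longrightarrow> j < 5 \<Longrightarrow> linked_by_route V (X i \<union> X j) (P i) (P j)"
  shows False
proof -
  have "\<forall>i j. \<exists>\<gamma>. i < j \<longrightarrow> j < (5::nat) \<longrightarrow>
      route V (X i \<union> X j) \<gamma> \<and> pathstart \<gamma> = P i \<and> pathfinish \<gamma> = P j"
    using link unfolding linked_by_route_def by blast
  then obtain p where p: "\<And>i j. i < j \<Longrightarrow> j < 5 \<Longrightarrow>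
      route V (X i \<union> X j) (p i j) \<and> pathstart (p i j) = P i \<and> pathfinish (p i j) = P j"
    by metis
  show False
  proof (rule no_unlinked_K5[of p P])
    show "path (p i j) \<and> pathstart (p i j) = P i \<and> pathfinish (p i j) = P j" if "i < j" "j < 5" for i j
      using p[OF that] route_path by blast
  next
    fix i j k :: nat assume *: "i < j" "j < 5" "k < 5" "k \<noteq> i" "k \<noteq> j"
    have "X k \<inter> (X i \<union> X j) = {}" using disj[of k i] disj[of k j] * by auto
    then show "P k \<notin> path_image (p i j)"
      using junctions_avoid_route[of V "X i \<union> X j" "p i j" "P k" "X k"] p[of i j] P[of k] X * by auto
  next
    fix i j k l :: nat
    assume *: "i < j" "j < 5" "k < l" "l < 5" "{i,j} \<inter> {k,l} = {}"
    have "(X i \<union> X j) \<inter> (X k \<union> X l) = {}"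
      using disj[of i k] disj[of i l] disj[of j k] disj[of j l] * by auto
    then have "unlinked (p i j) (p k l)"
      using unlinked_routes[of V "X i \<union> X j" "p i j" "X k \<union> X l" "p k l"] p[of i j] p[of k l] X * V
      by auto
    then show "crossing (p i j) (p k l) = 0" by (simp add: unlinked_def)
  qed
qed

text \<open>Single discs can serve as groups here: shattering supplies a member of \<open>F2\<close>
  meeting only the disc \<open>f i\<close>, hence a junction, and one meeting exactly
  \<open>f i\<close> and \<open>f j\<close>, hence the edge between them.\<close>

lemma no_shattered_five:
  assumes "V \<subseteq> F1" "card V = 5" "\<And>S. S \<subseteq> V \<Longrightarrow> \<exists>b\<in>F2. meeting V b = S"
  shows False
proof -
  have "finite V" using assms(2) card.infinite by fastforce
  then obtain f where f: "bij_betw f {..<5::nat} V"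
    using assms(2) bij_betw_from_nat_into_finite[of V] by (metis lessThan_atLeast0 ex_bij_betw_nat_finite)
  have fV: "f i \<in> V" if "i < 5" for i using f that by (auto simp: bij_betw_def)
  have finj: "f i \<noteq> f j" if "i < 5" "j < 5" "i \<noteq> j" for i j
    using f that by (auto simp: bij_betw_def inj_on_def)
  have "\<exists>p. p \<in> f i \<and> p \<in> junctions V {f i}" if i: "i < 5" for i
  proof -
    obtain b where b: "b \<in> F2" "meeting V b = {f i}" using assms(3)[of "{f i}"] fV[OF i] by auto
    then obtain p where "p \<in> f i" "p \<in> b" using meetingE[of "f i" V b] by auto
    then show "\<exists>p. p \<in> f i \<and> p \<in> junctions V {f i}"
      using b junctionsI[of "f i" "{f i}" b V p] by auto
  qed
  then obtain P where P: "\<And>i. i < 5 \<Longrightarrow> P i \<in> f i \<and> P i \<in> junctions V {f i}" by metis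
  show False
  proof (rule no_K5_of_routes[of V "\<lambda>i. {f i}" P])
    fix i j :: nat assume *: "i < j" "j < 5"
    let ?X = "{f i} \<union> {f j}"
    obtain b where b: "b \<in> F2" "meeting V b = {f i, f j}"
      using assms(3)[of "{f i, f j}"] fV * by auto
    obtain q r where qr: "q \<in> f i \<inter> b" "r \<in> f j \<inter> b"
      using meetingE[of "f i" V b] meetingE[of "f j" V b] b(2) by (metis IntI insertCI)
    have J: "q \<in> junctions V ?X" "r \<in> junctions V ?X"
      using b qr junctionsI[of "f i" ?X b V q] junctionsI[of "f j" ?X b V r] by auto
    have JP: "P i \<in> junctions V ?X" "P j \<in> junctions V ?X"
      using P[of i] P[of j] * junctions_mono[of "{f i}" ?X V] junctions_mono[of "{f j}" ?X V] by auto
    have X: "?X \<subseteq> F1" using fV[of i] fV[of j] * assms(1) by auto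
    have "linked_by_route V ?X (P i) q" "linked_by_route V ?X r (P j)"
      using linked_by_route_vertex[of "f i" ?X "P i" q] linked_by_route_vertex[of "f j" ?X r "P j"] 
        J JP X qr P[of i] P[of j] * by auto
    moreover have "linked_by_route V ?X q r"
      using linked_by_route_edge[of b V ?X q r] b qr J by auto
    ultimately show "linked_by_route V ?X (P i) (P j)" using linked_by_route_trans by blast
  qed (use assms(1) fV finj P in auto)
qed

definition adjacent :: "complex set set \<Rightarrow> complex set \<Rightarrow> complex set \<Rightarrow> bool" where
  "adjacent V a a' \<longleftrightarrow> a \<noteq> a' \<and> (\<exists>b\<in>F2. meeting V b = {a,a'})"

text \<open>A walk in the adjacency graph is followed by alternating between the discs at its
  vertices and the members of \<open>F2\<close> that realise its edges.\<close>

lemma linked_by_route_connected: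
  assumes "X \<subseteq> V" "V \<subseteq> F1" "a \<in> X" "p \<in> a" "p \<in> junctions V X"
    and "(a,a') \<in> {(x,y). x \<in> X \<and> y \<in> X \<and> adjacent V x y}\<^sup>*"
    and "q \<in> a'" "q \<in> junctions V X"
  shows "linked_by_route V X p q"
  using assms(6-8)
proof (induction arbitrary: q rule: rtrancl_induct)
  case base
  then show ?case using linked_by_route_vertex assms by blast
next
  case (step x y)
  then obtain b where b: "b \<in> F2" "meeting V b = {x,y}" and xy: "x \<in> X" "y \<in> X"
    unfolding adjacent_def by blast
  obtain r s where rs: "r \<in> x \<inter> b" "s \<in> y \<inter> b"
    using meetingE[of x V b] meetingE[of y V b] b(2) by (metis IntI insertCI)
  have J: "r \<in> junctions V X" "s \<in> junctions V X"
    using b rs xy junctionsI[of x X b V r] junctionsI[of y X b V s] by auto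
  have "linked_by_route V X p r" using step.IH[of r] rs J by blast
  moreover have "linked_by_route V X r s" using linked_by_route_edge[of b] b rs J xy by auto
  moreover have "linked_by_route V X s q"
    using linked_by_route_vertex[of y] xy rs J step.prems assms(1,2) by blast
  ultimately show ?case using linked_by_route_trans by blast
qed

end

section \<open>Clique minors in dense graphs\<close>

definition connected_in :: "('a \<Rightarrow> 'a \<Rightarrow> bool) \<Rightarrow> 'a set \<Rightarrow> bool" where
  "connected_in E X \<longleftrightarrow> (\<forall>x\<in>X. \<forall>y\<in>X. (x,y) \<in> {(u,v). u \<in> X \<and> v \<in> X \<and> E u v}\<^sup>*)"

definition touching :: "('a \<Rightarrow> 'a \<Rightarrow> bool) \<Rightarrow> 'a set \<Rightarrow> 'a set \<Rightarrow> bool" where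
  "touching E X Y \<longleftrightarrow> (\<exists>x\<in>X. \<exists>y\<in>Y. E x y)"

lemma touching_commute: "symp E \<Longrightarrow> touching E X Y \<longleftrightarrow> touching E Y X"
  unfolding touching_def by (meson sympD)

lemma touching_Un: "touching E (X \<union> Y) Z \<longleftrightarrow> touching E X Z \<or> touching E Y Z"
  unfolding touching_def by blast

lemma connected_in_Un:
  assumes "symp E" "connected_in E X" "connected_in E Y" "touching E X Y"
  shows "connected_in E (X \<union> Y)"
proof -
  let ?R = "\<lambda>S. {(u,v). u \<in> S \<and> v \<in> S \<and> E u v}\<^sup>*"
  have mono: "?R X \<subseteq> ?R (X \<union> Y)" "?R Y \<subseteq> ?R (X \<union> Y)" by (intro rtrancl_mono; blast)+
  obtain x y where xy: "x \<in> X" "y \<in> Y" "E x y" using assms(4) unfolding touching_def by blast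
  then have s: "(x,y) \<in> ?R (X \<union> Y)" "(y,x) \<in> ?R (X \<union> Y)"
    using assms(1) by (auto intro!: r_into_rtrancl dest: sympD)
  have X: "(u,v) \<in> ?R (X \<union> Y)" if "u \<in> X" "v \<in> X" for u v
    using assms(2) mono(1) that unfolding connected_in_def by blast
  have Y: "(u,v) \<in> ?R (X \<union> Y)" if "u \<in> Y" "v \<in> Y" for u v
    using assms(3) mono(2) that unfolding connected_in_def by blast
  have XY: "(u,v) \<in> ?R (X \<union> Y)" if "u \<in> X" "v \<in> Y" for u v
    using rtrancl_trans[OF X[OF that(1) xy(1)] rtrancl_trans[OF s(1) Y[OF xy(2) that(2)]]] .
  have YX: "(u,v) \<in> ?R (X \<union> Y)" if "u \<in> Y" "v \<in> X" for u v
    using rtrancl_trans[OF Y[OF that(1) xy(2)] rtrancl_trans[OF s(2) X[OF xy(1) that(2)]]] .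
  show ?thesis unfolding connected_in_def using X Y XY YX by blast
qed

definition neighbours :: "('a \<Rightarrow> 'a \<Rightarrow> bool) \<Rightarrow> 'a set set \<Rightarrow> 'a set \<Rightarrow> 'a set set" where
  "neighbours E P X = {Y \<in> P. Y \<noteq> X \<and> touching E X Y}"

text \<open>Every edge is counted in both directions.\<close>

definition degree_sum :: "('a \<Rightarrow> 'a \<Rightarrow> bool) \<Rightarrow> 'a set set \<Rightarrow> nat" where
  "degree_sum E P = (\<Sum>X\<in>P. card (neighbours E P X))"

lemma degree_sum_insert:
  assumes "symp E" "finite Q" "Z \<notin> Q"
  shows "degree_sum E (insert Z Q) = degree_sum E Q + 2 * card (neighbours E Q Z)"
proof -
  have nb: "card (neighbours E (insert Z Q) X) = card (neighbours E Q X) + (if touching E Z X then 1 else 0)"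
    if "X \<in> Q" for X
  proof -
    have "neighbours E (insert Z Q) X = neighbours E Q X \<union> (if touching E Z X then {Z} else {})"
      using that assms(3) touching_commute[OF assms(1), of Z X] unfolding neighbours_def by auto
    moreover have "finite (neighbours E Q X)" "Z \<notin> neighbours E Q X"
      using assms unfolding neighbours_def by auto
    ultimately show ?thesis by simp
  qed
  have "neighbours E (insert Z Q) Z = neighbours E Q Z"
    unfolding neighbours_def by auto
  then have "degree_sum E (insert Z Q)
      = card (neighbours E Q Z) + (\<Sum>X\<in>Q. card (neighbours E (insert Z Q) X))"
    using assms unfolding degree_sum_def by simp
  also have "(\<Sum>X\<in>Q. card (neighbours E (insert Z Q) X))
      = degree_sum E Q + (\<Sum>X\<in>Q. if touching E Z X then 1 else 0)"
    unfolding degree_sum_def by (simp add: nb sum.distrib)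
  also have "(\<Sum>X\<in>Q. if touching E Z X then 1 else 0) = card (neighbours E Q Z)"
  proof -
    have "neighbours E Q Z = {X \<in> Q. touching E Z X}"
      using assms(3) unfolding neighbours_def by auto
    then show ?thesis using assms(2) by (simp add: sum.If_cases Int_def)
  qed
  finally show ?thesis by simp
qed

text \<open>Contracting an edge destroys that edge and identifies the two edges to each common
  neighbour; everything counts twice in a degree sum.\<close>

lemma degree_sum_merge:
  assumes "symp E" "finite P" "X \<in> P" "Y \<in> P" "X \<noteq> Y" "touching E X Y" "X \<union> Y \<notin> P - {X,Y}"
  shows "degree_sum E P
    = degree_sum E (insert (X \<union> Y) (P - {X,Y})) + 2 + 2 * card (neighbours E P X \<inter> neighbours E P Y)"
proof -
  define Q where "Q = P - {X,Y}"
  have fin: "finite Q" and notin: "X \<notin> Q" "Y \<notin> insert X Q" and P: "P = insert Y (insert X Q)"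
    using assms unfolding Q_def by auto
  have nY: "neighbours E (insert X Q) Y = insert X (neighbours E Q Y)"
    using assms(5,6) touching_commute[OF assms(1), of X Y] unfolding neighbours_def by auto
  have "card (neighbours E (insert X Q) Y) = Suc (card (neighbours E Q Y))"
    unfolding nY using fin notin by (subst card_insert_disjoint) (auto simp: neighbours_def)
  then have "degree_sum E P = degree_sum E Q + 2 * card (neighbours E Q X)
      + 2 * card (neighbours E Q Y) + 2"
    unfolding P using degree_sum_insert[OF assms(1) _ notin(2)] degree_sum_insert[OF assms(1) fin notin(1)]
      fin by simp
  also have "card (neighbours E Q X) + card (neighbours E Q Y)
      = card (neighbours E Q X \<union> neighbours E Q Y) + card (neighbours E Q X \<inter> neighbours E Q Y)"
    using fin by (intro card_Un_Int) (auto simp: neighbours_def)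
  then have "degree_sum E Q + 2 * card (neighbours E Q X) + 2 * card (neighbours E Q Y) + 2
      = degree_sum E Q + 2 * card (neighbours E Q X \<union> neighbours E Q Y) + 2
        + 2 * card (neighbours E Q X \<inter> neighbours E Q Y)" by simp
  also have "neighbours E Q X \<union> neighbours E Q Y = neighbours E Q (X \<union> Y)"
    using assms(7) unfolding neighbours_def Q_def by (auto simp: touching_Un)
  also have "degree_sum E Q + 2 * card (neighbours E Q (X \<union> Y)) = degree_sum E (insert (X \<union> Y) Q)"
    using degree_sum_insert[OF assms(1) fin, of "X \<union> Y"] assms(7) unfolding Q_def by simp
  also have "neighbours E Q X \<inter> neighbours E Q Y = neighbours E P X \<inter> neighbours E P Y"
    unfolding neighbours_def Q_def by auto
  finally show ?thesis unfolding Q_def .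
qed

text \<open>Contractions are represented by merging members of \<open>P\<close>. Requiring a whole
  member of \<open>P\<close> inside each branch set serves the induction: when \<open>P\<close> is
  the neighbourhood of a vertex, that vertex touches every branch set.\<close>

definition clique_minor :: "('a \<Rightarrow> 'a \<Rightarrow> bool) \<Rightarrow> 'a set set \<Rightarrow> nat \<Rightarrow> (nat \<Rightarrow> 'a set) \<Rightarrow> bool" where
  "clique_minor E P h f \<longleftrightarrow>
     (\<forall>i<h. f i \<subseteq> \<Union>P \<and> (\<exists>Y\<in>P. Y \<subseteq> f i) \<and> connected_in E (f i)) \<and>
     (\<forall>i<h. \<forall>j<i. f i \<inter> f j = {} \<and> touching E (f i) (f j))"

text \<open>Mader's argument: contract edges as long as the density survives; afterwards every edge lies
  in many triangles, so that the neighbourhood of a vertex is dense.\<close>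

theorem clique_minor_of_dense:
  assumes "symp E" "finite P" "P \<noteq> {}" "disjoint P" "{} \<notin> P" "\<And>X. X \<in> P \<Longrightarrow> connected_in E X"
    and "degree_sum E P \<ge> 2 ^ Suc h * card P"
  shows "\<exists>f. clique_minor E P (Suc h) f"
  using assms(2-)
proof (induction h arbitrary: P)
  case 0
  then obtain X where "X \<in> P" by blast
  then have "clique_minor E P (Suc 0) (\<lambda>_. X)"
    using 0(5)[of X] unfolding clique_minor_def by (intro conjI allI impI) auto
  then show ?case by blast
next
  case (Suc h)
  note outer = Suc.IH
  show ?case
    using Suc.prems
  proof (induction "card P" arbitrary: P rule: less_induct)
    case less
    have fin: "finite P" and disj: "disjoint P" by fact+
    have dj: "A \<inter> B = {}" if "A \<in> P" "B \<in> P" "A \<noteq> B" for A B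
      using disj that unfolding disjoint_def by blast
    define merge where "merge X Y = insert (X \<union> Y) (P - {X,Y})" for X Y
    have new: "X \<union> Y \<notin> P - {X,Y}" if "X \<in> P" "Y \<in> P" for X Y
    proof
      assume "X \<union> Y \<in> P - {X,Y}"
      then have "X \<inter> (X \<union> Y) = {}" using that by (intro dj) auto
      then have "X = {}" by blast
      then show False using that less.prems by blast
    qed
    show ?case
    proof (cases "\<exists>X\<in>P. \<exists>Y\<in>P. X \<noteq> Y \<and> touching E X Y \<and>
        degree_sum E (merge X Y) \<ge> 2 ^ Suc (Suc h) * card (merge X Y)")
      case True
      then obtain X Y where XY: "X \<in> P" "Y \<in> P" "X \<noteq> Y" "touching E X Y"
        "degree_sum E (merge X Y) \<ge> 2 ^ Suc (Suc h) * card (merge X Y)" by blast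
      have U: "\<Union>(merge X Y) = \<Union>P" using XY unfolding merge_def by auto
      have "\<exists>f. clique_minor E (merge X Y) (Suc (Suc h)) f"
      proof (rule less.hyps)
        have "card (P - {X,Y}) + 2 = card P"
          using XY fin card_mono[of P "{X,Y}"] by (simp add: card_Diff_subset)
        then show "card (merge X Y) < card P"
          using new[OF XY(1,2)] fin unfolding merge_def by simp
        show "finite (merge X Y)" "merge X Y \<noteq> {}" using fin unfolding merge_def by auto
        show "disjoint (merge X Y)"
        proof -
          have "(X \<union> Y) \<inter> Z = {}" if "Z \<in> P - {X,Y}" for Z
            using that dj[of X Z] dj[of Y Z] XY(1,2) by blast
          then show ?thesis
            unfolding merge_def disjoint_def using dj by (simp add: Int_commute)
        qed
        show "{} \<notin> merge X Y" using XY less.prems unfolding merge_def by auto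
        show "connected_in E Z" if "Z \<in> merge X Y" for Z
          using that XY less.prems(5) connected_in_Un[OF assms(1)] unfolding merge_def by blast
        show "2 ^ Suc (Suc h) * card (merge X Y) \<le> degree_sum E (merge X Y)" by fact
      qed
      then obtain f where f: "clique_minor E (merge X Y) (Suc (Suc h)) f" by blast
      have "\<exists>Z\<in>P. Z \<subseteq> f i" if Z: "\<exists>Z\<in>merge X Y. Z \<subseteq> f i" for i
      proof -
        obtain Z where "Z \<in> merge X Y" "Z \<subseteq> f i" using Z by blast
        then show ?thesis using XY(1) unfolding merge_def by (cases "Z = X \<union> Y") auto
      qed
      then have "clique_minor E P (Suc (Suc h)) f"
        using f unfolding clique_minor_def U by simp
      then show ?thesis by blast
    next
      case False
      \<comment> \<open>If contracting an edge drops the density below the threshold, the degree sum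
        must fall by more than the \<open>2 ^ Suc (Suc h)\<close> allotted to the lost vertex. By
        \<open>degree_sum_merge\<close> this forces many common neighbours.\<close>
      have common: "card (neighbours E P X \<inter> neighbours E P Y) \<ge> 2 ^ Suc h"
        if "X \<in> P" "Y \<in> P" "X \<noteq> Y" "touching E X Y" for X Y
      proof -
        have "card (P - {X,Y}) + 2 = card P"
          using that fin card_mono[of P "{X,Y}"] by (simp add: card_Diff_subset)
        then have c: "card (merge X Y) + 1 = card P"
          using new[OF that(1,2)] fin unfolding merge_def by simp
        have "degree_sum E (merge X Y) < 2 ^ Suc (Suc h) * card (merge X Y)"
          using False that by (meson not_le)
        moreover have "degree_sum E P \<ge> 2 ^ Suc (Suc h) * card P" by fact
        moreover have "2 ^ Suc (Suc h) * card P = 2 ^ Suc (Suc h) * card (merge X Y) + 2 ^ Suc (Suc h)"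
          unfolding c[symmetric] by simp
        moreover have "degree_sum E P = degree_sum E (merge X Y) + 2
            + 2 * card (neighbours E P X \<inter> neighbours E P Y)"
          unfolding merge_def by (rule degree_sum_merge[OF assms(1) fin that new[OF that(1,2)]])
        ultimately have "2 * 2 ^ Suc h < 2 + 2 * card (neighbours E P X \<inter> neighbours E P Y)"
          by simp
        then show ?thesis by linarith
      qed
      have "degree_sum E P > 0"
      proof -
        have "card P > 0" using less.prems(2) fin by (simp add: card_gt_0_iff)
        then have "2 ^ Suc (Suc h) * card P > 0" by simp
        then show ?thesis using less.prems(6) by linarith
      qed
      then obtain X where X: "X \<in> P" "card (neighbours E P X) \<noteq> 0"
        unfolding degree_sum_def by (metis less_irrefl sum.neutral)
      define N where "N = neighbours E P X"
      have N: "N \<subseteq> P" "X \<notin> N" "finite N" "N \<noteq> {}"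
        using X fin unfolding N_def neighbours_def by auto
      have NT: "touching E X Y" if "Y \<in> N" for Y using that unfolding N_def neighbours_def by auto
      have deg: "card (neighbours E N Y) \<ge> 2 ^ Suc h" if "Y \<in> N" for Y
      proof -
        have "neighbours E N Y = neighbours E P X \<inter> neighbours E P Y"
          unfolding N_def neighbours_def by auto
        then show ?thesis using common[of X Y] that N NT X by auto
      qed
      \<comment> \<open>Common neighbours of \<open>X\<close> and a vertex of \<open>N\<close> again
        lie in \<open>N\<close>, so \<open>N\<close> meets the threshold for one branch set fewer,
        and \<open>X\<close> itself is the missing one.\<close>
      have "degree_sum E N \<ge> 2 ^ Suc h * card N"
        unfolding degree_sum_def using sum_mono[of N "\<lambda>_. 2 ^ Suc h", OF deg] by (simp add: mult.commute)
      then have "\<exists>f. clique_minor E N (Suc h) f"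
        using N disj less.prems by (intro outer) (auto simp: disjoint_def)
      then obtain f where f: "clique_minor E N (Suc h) f" by blast
      define g where "g = f(Suc h := X)"
      have fi: "f i \<subseteq> \<Union>N" "\<exists>Y\<in>N. Y \<subseteq> f i" "connected_in E (f i)" if "i < Suc h" for i
        using f that unfolding clique_minor_def by blast+
      have Xd: "X \<inter> f i = {}" if "i < Suc h" for i
      proof -
        have "X \<inter> Y = {}" if "Y \<in> N" for Y using that N X(1) by (intro dj) auto
        then show ?thesis using fi(1)[OF that] by blast
      qed
      have tX: "touching E X (f i)" if "i < Suc h" for i
        using fi(2)[OF that] NT unfolding touching_def by blast
      have "clique_minor E P (Suc (Suc h)) g"
        unfolding clique_minor_def
      proof (intro conjI allI impI)
        fix i assume i: "i < Suc (Suc h)"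
        show "g i \<subseteq> \<Union>P"
          using fi(1)[of i] N(1) X(1) i unfolding g_def by (cases "i = Suc h") auto
        show "\<exists>Y\<in>P. Y \<subseteq> g i"
          using fi(2)[of i] N(1) X(1) i unfolding g_def by (cases "i = Suc h") auto
        show "connected_in E (g i)"
          using fi(3)[of i] less.prems(5) X(1) i unfolding g_def by (cases "i = Suc h") auto
        fix j assume j: "j < i"
        show "g i \<inter> g j = {}"
          using Xd[of j] f i j unfolding g_def clique_minor_def by (cases "i = Suc h") auto
        show "touching E (g i) (g j)"
          using tX[of j] f i j unfolding g_def clique_minor_def by (cases "i = Suc h") auto
      qed
      then show ?thesis by blast
    qed
  qed
qed

section \<open>Sparsity of Delaunay graphs\<close>

lemma degree_sum_singletons:
  assumes "finite V" "symp E" "irreflp E"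
  shows "degree_sum E ((\<lambda>a. {a}) ` V) = 2 * card {{a,a'} |a a'. a \<in> V \<and> a' \<in> V \<and> E a a'}"
proof -
  let ?P = "(\<lambda>a. {a}) ` V" and ?D = "{{a,a'} |a a'. a \<in> V \<and> a' \<in> V \<and> E a a'}"
  let ?O = "{(a,a'). a \<in> V \<and> a' \<in> V \<and> E a a'}"
  let ?s = "\<lambda>(a,a'). {a,a'}"
  have "card (neighbours E ?P {a}) = card {a'\<in>V. E a a'}" for a
  proof -
    have "neighbours E ?P {a} = (\<lambda>a. {a}) ` {a'\<in>V. E a a'}"
      using assms(3) unfolding neighbours_def touching_def irreflp_def by auto
    then show ?thesis by (simp add: card_image)
  qed
  then have "degree_sum E ?P = (\<Sum>a\<in>V. card {a'\<in>V. E a a'})"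
    unfolding degree_sum_def by (simp add: sum.reindex)
  also have "\<dots> = card (SIGMA a:V. {a'\<in>V. E a a'})"
    using assms(1) by simp
  also have "(SIGMA a:V. {a'\<in>V. E a a'}) = ?O" by auto
  finally have 1: "degree_sum E ?P = card ?O" .
  have finO: "finite ?O" by (rule finite_subset[of _ "V \<times> V"]) (use assms(1) in auto)
  have im: "?s ` ?O = ?D" by (auto simp: image_def)
  have "card ?O = (\<Sum>S\<in>?D. card {p\<in>?O. ?s p = S})"
    using sum.image_gen[OF finO, of "\<lambda>_. 1::nat" ?s] unfolding im by simp
  also have "\<dots> = (\<Sum>S\<in>?D. 2)"
  proof (rule sum.cong)
    fix S assume "S \<in> ?D"
    then obtain a a' where a: "S = {a,a'}" "a \<in> V" "a' \<in> V" "E a a'" by blast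
    have ne: "a \<noteq> a'" using a(4) assms(3) by (auto simp: irreflp_def)
    have "{p\<in>?O. ?s p = S} = {(a,a'),(a',a)}"
      using a assms(2) by (auto simp: doubleton_eq_iff dest: sympD)
    then show "card {p\<in>?O. ?s p = S} = 2" using ne by simp
  qed simp
  finally show ?thesis using 1 by simp
qed

context two_pseudo_disc_families
begin

theorem delaunay_edges_linear:
  assumes V: "finite V" "V \<subseteq> F1"
  shows "card {S. card S = 2 \<and> (\<exists>b\<in>F2. meeting V b = S)} \<le> 512 * card V"
proof (rule ccontr)
  let ?D = "{S. card S = 2 \<and> (\<exists>b\<in>F2. meeting V b = S)}"
  let ?E = "adjacent V"
  let ?P = "(\<lambda>a. {a}) ` V"
  assume *: "\<not> card ?D \<le> 512 * card V"
  have sym: "symp ?E" unfolding symp_def adjacent_def by (metis insert_commute)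
  have irr: "irreflp ?E" unfolding irreflp_def adjacent_def by blast
  have D: "?D = {{a,a'} |a a'. a \<in> V \<and> a' \<in> V \<and> ?E a a'}"
  proof (intro equalityI subsetI)
    fix S assume "S \<in> ?D"
    then obtain b a a' where "b \<in> F2" "meeting V b = S" "S = {a,a'}" "a \<noteq> a'"
      by (auto simp: card_2_iff)
    moreover then have "{a,a'} \<subseteq> V" unfolding meeting_def by blast
    ultimately show "S \<in> {{a,a'} |a a'. a \<in> V \<and> a' \<in> V \<and> ?E a a'}"
      unfolding adjacent_def by blast
  next
    fix S assume "S \<in> {{a,a'} |a a'. a \<in> V \<and> a' \<in> V \<and> ?E a a'}"
    then show "S \<in> ?D" unfolding adjacent_def mem_Collect_eq card_2_iff by metis
  qed
  have ne: "V \<noteq> {}" using * unfolding D by auto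
  \<comment> \<open>Edges count twice in \<open>degree_sum\<close>, so more than 512 of them per
    vertex exceed the threshold \<open>2 ^ Suc 9\<close>.\<close>
  have "\<exists>f. clique_minor ?E ?P (Suc 9) f"
  proof (rule clique_minor_of_dense[OF sym])
    show "disjoint ?P" unfolding disjoint_def by auto
    show "connected_in ?E X" if "X \<in> ?P" for X using that unfolding connected_in_def by auto
    have "card ?P = card V" by (simp add: card_image)
    then show "2 ^ Suc 9 * card ?P \<le> degree_sum ?E ?P"
      using * degree_sum_singletons[OF V(1) sym irr] unfolding D by simp
  qed (use V ne in auto)
  then obtain f where f: "clique_minor ?E ?P 10 f" by auto
  have fV: "f i \<subseteq> V" and fc: "connected_in ?E (f i)" if "i < 10" for i
    using f that unfolding clique_minor_def by auto
  have fd: "f i \<inter> f j = {}" "touching ?E (f i) (f j)" if "i < 10" "j < 10" "i \<noteq> j" for i j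
    using f that touching_commute[OF sym] unfolding clique_minor_def by (metis Int_commute nat_neq_iff)+
  \<comment> \<open>The two halves of \<open>X i\<close> touch; this adjacency provides the junction
    \<open>P i\<close>.\<close>
  define X where "X i = f (2*i) \<union> f (2*i+1)" for i
  have XV: "X i \<subseteq> V" and Xc: "connected_in ?E (X i)" if "i < 5" for i
    using fV[of "2*i"] fV[of "2*i+1"] fc[of "2*i"] fc[of "2*i+1"] fd(2)[of "2*i" "2*i+1"] that
      connected_in_Un[OF sym] unfolding X_def by auto
  have "\<exists>a q. a \<in> X i \<and> q \<in> a \<and> q \<in> junctions V (X i)" if i: "i < 5" for i
  proof -
    obtain a a' where a: "a \<in> X i" "a' \<in> X i" "?E a a'"
      using fd(2)[of "2*i" "2*i+1"] i unfolding touching_def X_def by auto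
    then obtain b where b: "b \<in> F2" "meeting V b = {a,a'}" unfolding adjacent_def by blast
    then obtain q where "q \<in> a" "q \<in> b" using meetingE[of a V b] by blast
    then show ?thesis using junctionsI[of a "X i" b V q] a b by auto
  qed
  then obtain a P where aP: "\<And>i. i < 5 \<Longrightarrow> a i \<in> X i \<and> P i \<in> a i \<and> P i \<in> junctions V (X i)"
    by metis
  show False
  proof (rule no_K5_of_routes[of V X P])
    show "X i \<inter> X j = {}" if "i < 5" "j < 5" "i \<noteq> j" for i j
    proof -
      have "2*i \<noteq> 2*j+1" "2*i+1 \<noteq> 2*j" by presburger+
      then show ?thesis
        using fd(1)[of "2*i" "2*j"] fd(1)[of "2*i" "2*j+1"] fd(1)[of "2*i+1" "2*j"]
          fd(1)[of "2*i+1" "2*j+1"] that unfolding X_def by auto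
    qed
    fix i j :: nat assume ij: "i < j" "j < 5"
    have "touching ?E (X i) (X j)"
      using fd(2)[of "2*i" "2*j"] ij unfolding X_def touching_def by auto
    then have "connected_in ?E (X i \<union> X j)"
      using Xc[of i] Xc[of j] ij by (intro connected_in_Un[OF sym]) auto
    then have "(a i, a j) \<in> {(x,y). x \<in> X i \<union> X j \<and> y \<in> X i \<union> X j \<and> adjacent V x y}\<^sup>*"
      using aP[of i] aP[of j] ij unfolding connected_in_def by auto
    then show "linked_by_route V (X i \<union> X j) (P i) (P j)"
      using aP[of i] aP[of j] ij XV[of i] XV[of j] V(2)
        junctions_mono[of "X i" "X i \<union> X j" V] junctions_mono[of "X j" "X i \<union> X j" V]
      by (intro linked_by_route_connected[of "X i \<union> X j" V "a i" "P i" "a j" "P j"]) auto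
  qed (use V XV aP in auto)
qed

end

section \<open>Shattering and cliques\<close>

definition shatters :: "'a set set \<Rightarrow> 'a set \<Rightarrow> bool" where
  "shatters F S \<longleftrightarrow> (\<forall>T\<subseteq>S. \<exists>e\<in>F. e \<inter> S = T)"

lemma shattersD: "shatters F S \<Longrightarrow> T \<subseteq> S \<Longrightarrow> \<exists>e\<in>F. e \<inter> S = T"
  unfolding shatters_def by blast

lemma shatters_mono: "shatters F S \<Longrightarrow> F \<subseteq> F' \<Longrightarrow> shatters F' S"
  unfolding shatters_def by (meson subsetD)

lemma shatters_insert:
  assumes "x \<notin> S" and "shatters {e. x \<notin> e \<and> e \<in> F \<and> insert x e \<in> F} S"
  shows "shatters F (insert x S)"
  unfolding shatters_def
proof (intro allI impI)
  fix T assume T: "T \<subseteq> insert x S"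
  then obtain e where e: "x \<notin> e" "e \<in> F" "insert x e \<in> F" "e \<inter> S = T - {x}"
    using shattersD[OF assms(2), of "T - {x}"] by blast
  show "\<exists>e\<in>F. e \<inter> insert x S = T"
  proof (cases "x \<in> T")
    case True
    then show ?thesis using e T by (intro bexI[of _ "insert x e"]) auto
  next
    case False
    then show ?thesis using e T by (intro bexI[of _ e]) auto
  qed
qed

lemma shatters_remove:
  assumes "x \<notin> S" "shatters ((\<lambda>e. e - {x}) ` F) S"
  shows "shatters F S"
  unfolding shatters_def
proof (intro allI impI)
  fix T assume "T \<subseteq> S"
  then obtain e where "e \<in> F" "(e - {x}) \<inter> S = T" using shattersD[OF assms(2)] by blast
  moreover have "(e - {x}) \<inter> S = e \<inter> S" using assms(1) by blast
  ultimately show "\<exists>e\<in>F. e \<inter> S = T" by auto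
qed

text \<open>Pajor's form of the Sauer-Shelah lemma. Deleting x merges pairs e,
  \<open>insert x e\<close>; so the size of \<open>F\<close> is the number of traces plus the number
  of merged pairs. Sets shattered by the traces do not contain x, while those shattered by the
  merged pairs remain shattered by \<open>F\<close> after adding x, so nothing is counted
  twice.\<close>

lemma card_le_shattered:
  assumes "finite X" "F \<subseteq> Pow X"
  shows "card F \<le> card {S. S \<subseteq> X \<and> shatters F S}"
  using assms
proof (induction X arbitrary: F)
  case empty
  show ?case
  proof (cases "F = {}")
    case False
    then have "F = {{}}" using empty by auto
    then have "{S. S \<subseteq> {} \<and> shatters F S} = {{}}" unfolding shatters_def by auto
    then show ?thesis using \<open>F = {{}}\<close> by simp
  qed simp
next
  case (insert x X)
  define F1 where "F1 = (\<lambda>e. e - {x}) ` F"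
  define F2 where "F2 = {e. x \<notin> e \<and> e \<in> F \<and> insert x e \<in> F}"
  have finF: "finite F" using insert finite_subset by fastforce
  have sub: "F1 \<subseteq> Pow X" "F2 \<subseteq> Pow X" using insert.prems unfolding F1_def F2_def by auto
  define Fa where "Fa = {e\<in>F. x \<notin> e}"
  define Fb where "Fb = {e\<in>F. x \<in> e}"
  have "card F = card Fa + card Fb"
  proof -
    have "F = Fa \<union> Fb" "Fa \<inter> Fb = {}" unfolding Fa_def Fb_def by auto
    then show ?thesis using finF by (metis card_Un_disjoint finite_Un)
  qed
  also have "card Fb = card ((\<lambda>e. e - {x}) ` Fb)"
    unfolding Fb_def by (intro card_image[symmetric] inj_onI) blast
  also have "card Fa + card ((\<lambda>e. e - {x}) ` Fb)
      = card (Fa \<union> (\<lambda>e. e - {x}) ` Fb) + card (Fa \<inter> (\<lambda>e. e - {x}) ` Fb)"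
    using finF by (intro card_Un_Int) (auto simp: Fa_def Fb_def)
  also have "Fa \<union> (\<lambda>e. e - {x}) ` Fb = F1"
  proof -
    have "Fa = (\<lambda>e. e - {x}) ` Fa" unfolding Fa_def by (auto simp: image_iff)
    moreover have "F = Fa \<union> Fb" unfolding Fa_def Fb_def by auto
    ultimately show ?thesis unfolding F1_def by (metis image_Un)
  qed
  also have "Fa \<inter> (\<lambda>e. e - {x}) ` Fb = F2"
    unfolding Fa_def Fb_def F2_def by (auto simp: image_iff insert_absorb)
  finally have card_F: "card F = card F1 + card F2" .
  let ?S1 = "{S. S \<subseteq> X \<and> shatters F1 S}" and ?S2 = "{S. S \<subseteq> X \<and> shatters F2 S}"
  have fin: "finite ?S1" "finite ?S2" using insert.hyps(1) by auto
  have inj: "inj_on (insert x) ?S2"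
    by (rule inj_on_inverseI[of _ "\<lambda>Q. Q - {x}"]) (use insert.hyps(2) in auto)
  have "card F \<le> card ?S1 + card ?S2"
    using insert.IH[OF sub(1)] insert.IH[OF sub(2)] card_F by simp
  also have "\<dots> = card (?S1 \<union> insert x ` ?S2)"
    using fin inj insert.hyps(2) by (subst card_Un_disjoint) (auto simp: card_image)
  also have "\<dots> \<le> card {S. S \<subseteq> insert x X \<and> shatters F S}"
  proof (rule card_mono)
    show "finite {S. S \<subseteq> insert x X \<and> shatters F S}" using insert.hyps(1) by simp
    have "shatters F S" if "S \<in> ?S1" for S
      using that insert.hyps(2) shatters_remove[of x S F] unfolding F1_def by blast
    moreover have "shatters F (insert x S)" if "S \<in> ?S2" for S
      using that insert.hyps(2) shatters_insert[of x S F] unfolding F2_def by blast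
    ultimately show "?S1 \<union> insert x ` ?S2 \<subseteq> {S. S \<subseteq> insert x X \<and> shatters F S}" by auto
  qed
  finally show ?case .
qed

section \<open>Weighted one-inclusion graphs\<close>

lemma sum_Pow_insert:
  fixes g :: "'a set \<Rightarrow> 'b::comm_monoid_add"
  assumes "finite X" "x \<notin> X"
  shows "sum g (Pow (insert x X)) = (\<Sum>Q\<in>Pow X. g Q + g (insert x Q))"
proof -
  have inj: "inj_on (insert x) (Pow X)"
    by (rule inj_on_inverseI[of _ "\<lambda>Q. Q - {x}"]) (use assms(2) in auto)
  have "sum g (Pow (insert x X)) = sum g (Pow X) + sum g (insert x ` Pow X)"
    unfolding Pow_insert using assms by (intro sum.union_disjoint) auto
  also have "sum g (insert x ` Pow X) = (\<Sum>Q\<in>Pow X. g (insert x Q))"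
    using sum.reindex[OF inj] by simp
  finally show ?thesis by (simp add: sum.distrib)
qed

text \<open>Haussler's bound on the density of the one-inclusion graph, for weighted vertices. In the
  induction the two halves of the cube are replaced by their pointwise maximum and minimum; the
  support of the minimum has smaller Vapnik-Chervonenkis dimension.\<close>

lemma weighted_one_inclusion_density:
  fixes w :: "'a set \<Rightarrow> nat"
  assumes "finite X" "\<And>S. S \<subseteq> X \<Longrightarrow> shatters {Q. Q \<subseteq> X \<and> w Q > 0} S \<Longrightarrow> card S \<le> d"
  shows "(\<Sum>x\<in>X. \<Sum>Q\<in>Pow (X - {x}). min (w Q) (w (insert x Q))) \<le> d * (\<Sum>Q\<in>Pow X. w Q)"
  using assms
proof (induction X arbitrary: w d)
  case empty
  then show ?case by simp
next
  case (insert x X)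
  note fin = insert.hyps(1) and x = insert.hyps(2)
  define w1 where "w1 Q = max (w Q) (w (insert x Q))" for Q
  define w2 where "w2 Q = min (w Q) (w (insert x Q))" for Q
  define D where "D v Y = (\<Sum>y\<in>Y. \<Sum>Q\<in>Pow (Y - {y}). min (v Q) (v (insert y Q)))" for v :: "'a set \<Rightarrow> nat" and Y
  have vc1: "card S \<le> d" if S: "S \<subseteq> X" "shatters {Q. Q \<subseteq> X \<and> w1 Q > 0} S" for S
  proof (rule insert.prems)
    show "S \<subseteq> insert x X" using S by blast
    have "{Q. Q \<subseteq> X \<and> w1 Q > 0} \<subseteq> (\<lambda>e. e - {x}) ` {Q. Q \<subseteq> insert x X \<and> w Q > 0}"
    proof
      fix Q assume Q: "Q \<in> {Q. Q \<subseteq> X \<and> w1 Q > 0}"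
      then have "Q = Q - {x}" "Q = insert x Q - {x}" using x by auto
      moreover have "w Q > 0 \<or> w (insert x Q) > 0" using Q unfolding w1_def by auto
      ultimately show "Q \<in> (\<lambda>e. e - {x}) ` {Q. Q \<subseteq> insert x X \<and> w Q > 0}"
        using Q by blast
    qed
    then have "shatters ((\<lambda>e. e - {x}) ` {Q. Q \<subseteq> insert x X \<and> w Q > 0}) S"
      using shatters_mono[OF S(2)] by blast
    then show "shatters {Q. Q \<subseteq> insert x X \<and> w Q > 0} S"
      using shatters_remove[of x S] S(1) x by blast
  qed
  have vc2: "card S + 1 \<le> d" if S: "S \<subseteq> X" "shatters {Q. Q \<subseteq> X \<and> w2 Q > 0} S" for S
  proof -
    have "{Q. Q \<subseteq> X \<and> w2 Q > 0} \<subseteq> {e. x \<notin> e \<and> e \<in> {Q. Q \<subseteq> insert x X \<and> w Q > 0}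
        \<and> insert x e \<in> {Q. Q \<subseteq> insert x X \<and> w Q > 0}}"
      using x unfolding w2_def by auto
    then have "shatters {e. x \<notin> e \<and> e \<in> {Q. Q \<subseteq> insert x X \<and> w Q > 0}
        \<and> insert x e \<in> {Q. Q \<subseteq> insert x X \<and> w Q > 0}} S"
      using shatters_mono[OF S(2)] by blast
    then have "shatters {Q. Q \<subseteq> insert x X \<and> w Q > 0} (insert x S)"
      using S(1) x by (intro shatters_insert) auto
    then have "card (insert x S) \<le> d" using S(1) by (intro insert.prems) auto
    moreover have "finite S" "x \<notin> S" using S(1) fin x finite_subset by auto
    ultimately show ?thesis by simp
  qed
  have IH1: "D w1 X \<le> d * sum w1 (Pow X)"
    unfolding D_def by (rule insert.IH) (rule vc1)
  have IH2: "D w2 X \<le> (d - 1) * sum w2 (Pow X)"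
    unfolding D_def
  proof (rule insert.IH)
    show "card S \<le> d - 1" if "S \<subseteq> X" "shatters {Q. Q \<subseteq> X \<and> w2 Q > 0} S" for S
      using vc2[OF that] by simp
  qed
  \<comment> \<open>The subtraction d - 1 is truncated; when d = 0 it is harmless only because the
    weight \<open>w2\<close> then vanishes.\<close>
  have d1: "d \<ge> 1" if pos: "sum w2 (Pow X) \<noteq> 0"
  proof -
    obtain Q where "Q \<subseteq> X" "w2 Q > 0" using pos by (auto simp: fin)
    then have "shatters {Q. Q \<subseteq> X \<and> w2 Q > 0} {}" unfolding shatters_def by auto
    then show ?thesis using vc2[of "{}"] by simp
  qed
  \<comment> \<open>Of two minima over parallel edges in direction y, the smaller is the minimum of
    all four weights, and the larger is bounded by both maxima taken in direction x.\<close>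
  have step: "(\<Sum>Q\<in>Pow (insert x X - {y}). min (w Q) (w (insert y Q)))
      \<le> (\<Sum>Q\<in>Pow (X - {y}). min (w1 Q) (w1 (insert y Q)) + min (w2 Q) (w2 (insert y Q)))"
    if "y \<in> X" for y
  proof -
    have "insert x X - {y} = insert x (X - {y})" using that x by auto
    then have "(\<Sum>Q\<in>Pow (insert x X - {y}). min (w Q) (w (insert y Q)))
      = (\<Sum>Q\<in>Pow (X - {y}). min (w Q) (w (insert y Q)) + min (w (insert x Q)) (w (insert y (insert x Q))))"
      using sum_Pow_insert[of "X - {y}" x] fin x by simp
    also have "\<dots> \<le> (\<Sum>Q\<in>Pow (X - {y}). min (w1 Q) (w1 (insert y Q)) + min (w2 Q) (w2 (insert y Q)))"
      unfolding w1_def w2_def insert_commute[of x y] by (intro sum_mono) linarith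
    finally show ?thesis .
  qed
  \<comment> \<open>The edges in direction x contribute exactly the total weight of
    \<open>w2\<close>; this term restores the dimension lost in passing to d - 1.\<close>
  have "(\<Sum>y\<in>insert x X. \<Sum>Q\<in>Pow (insert x X - {y}). min (w Q) (w (insert y Q)))
      = (\<Sum>Q\<in>Pow X. w2 Q) + (\<Sum>y\<in>X. \<Sum>Q\<in>Pow (insert x X - {y}). min (w Q) (w (insert y Q)))"
    using fin x by (simp add: w2_def)
  also have "\<dots> \<le> sum w2 (Pow X) + (D w1 X + D w2 X)"
    unfolding D_def sum.distrib[symmetric] by (intro add_left_mono sum_mono step)
  also have "\<dots> \<le> sum w2 (Pow X) + (d * sum w1 (Pow X) + (d - 1) * sum w2 (Pow X))"
    using IH1 IH2 by simp
  also have "\<dots> = d * (sum w1 (Pow X) + sum w2 (Pow X))"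
    using d1 by (cases d) (auto simp: algebra_simps)
  also have "sum w1 (Pow X) + sum w2 (Pow X) = sum w (Pow (insert x X))"
    unfolding sum_Pow_insert[OF fin x] sum.distrib[symmetric] w1_def w2_def
    by (intro sum.cong) auto
  finally show ?case .
qed

section \<open>Counting small subsets and cliques\<close>

lemma card_subsets_le_power:
  assumes "finite N"
  shows "card {T. T \<subseteq> N \<and> card T \<le> j} \<le> (card N + 1) ^ j"
proof (induction j)
  case 0
  have "{T. T \<subseteq> N \<and> card T \<le> 0} = {{}}" using finite_subset[OF _ assms] by (auto simp: card_eq_0_iff)
  then show ?case by simp
next
  case (Suc j)
  \<comment> \<open>\<open>None\<close> stands for adding no further element to a set of size at
    most j.\<close>
  let ?A = "insert None (Some ` N)" and ?B = "{T. T \<subseteq> N \<and> card T \<le> j}"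
  let ?f = "\<lambda>(z,T). case z of None \<Rightarrow> T | Some y \<Rightarrow> insert y T"
  have finB: "finite ?B" using assms by simp
  have "{T. T \<subseteq> N \<and> card T \<le> Suc j} \<subseteq> ?f ` (?A \<times> ?B)"
  proof
    fix T assume T: "T \<in> {T. T \<subseteq> N \<and> card T \<le> Suc j}"
    show "T \<in> ?f ` (?A \<times> ?B)"
    proof (cases "card T \<le> j")
      case True
      then show ?thesis using T by (intro image_eqI[of _ _ "(None, T)"]) auto
    next
      case False
      then obtain y where y: "y \<in> T" by fastforce
      have "finite T" using T assms finite_subset by auto
      then have "card (T - {y}) \<le> j" using T y by auto
      then show ?thesis using T y by (intro image_eqI[of _ _ "(Some y, T - {y})"]) auto
    qed
  qed
  then have "card {T. T \<subseteq> N \<and> card T \<le> Suc j} \<le> card (?A \<times> ?B)"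
    using assms finB by (meson card_image_le card_mono finite_SigmaI finite_imageI finite_insert order_trans)
  also have "\<dots> = (card N + 1) * card ?B"
    using assms by (simp add: card_cartesian_product card_image)
  also have "\<dots> \<le> (card N + 1) * (card N + 1) ^ j" using Suc by (intro mult_left_mono) auto
  finally show ?case by simp
qed

text \<open>Sparsity yields a vertex of degree at most 2k. A clique through it is determined by at
  most j of its neighbours, which leaves \<open>(2 * k + 1) ^ j\<close> choices; the remaining
  cliques survive the removal of the vertex, and induced subgraphs stay sparse.\<close>

lemma card_small_cliques:
  assumes "finite R"
    and "\<And>R'. R' \<subseteq> R \<Longrightarrow> card {S\<in>G. S \<subseteq> R' \<and> card S = 2} \<le> k * card R'"
  shows "card {S. S \<subseteq> R \<and> S \<noteq> {} \<and> card S \<le> Suc j \<and> (\<forall>T\<subseteq>S. card T = 2 \<longrightarrow> T \<in> G)}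
    \<le> card R * (2 * k + 1) ^ j"
  using assms
proof (induction "card R" arbitrary: R rule: less_induct)
  case less
  define C where "C R = {S. S \<subseteq> R \<and> S \<noteq> {} \<and> card S \<le> Suc j \<and> (\<forall>T\<subseteq>S. card T = 2 \<longrightarrow> T \<in> G)}" for R
  show ?case
  proof (cases "R = {}")
    case True
    then have "C R = {}" unfolding C_def by auto
    then show ?thesis unfolding C_def[symmetric] by simp
  next
    case False
    have fin: "finite R" by fact
    define Ed where "Ed = {S\<in>G. S \<subseteq> R \<and> card S = 2}"
    have finE: "finite Ed" using fin unfolding Ed_def by (auto intro: finite_subset[of _ "Pow R"])
    have "(\<Sum>v\<in>R. card {S\<in>Ed. v \<in> S}) = (\<Sum>v\<in>R. \<Sum>S\<in>Ed. if v \<in> S then 1 else 0)"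
      using finE by (simp add: sum.If_cases Int_def)
    also have "\<dots> = (\<Sum>S\<in>Ed. \<Sum>v\<in>R. if v \<in> S then 1 else 0)" by (rule sum.swap)
    also have "\<dots> = (\<Sum>S\<in>Ed. 2)"
    proof (rule sum.cong)
      fix S assume "S \<in> Ed"
      then have "R \<inter> {v. v \<in> S} = S" "card S = 2" unfolding Ed_def by auto
      then show "(\<Sum>v\<in>R. if v \<in> S then 1 else 0) = (2::nat)" using fin by (simp add: sum.If_cases)
    qed simp
    also have "\<dots> \<le> 2 * (k * card R)" using less.prems(2)[of R] unfolding Ed_def by simp
    finally have "(\<Sum>v\<in>R. card {S\<in>Ed. v \<in> S}) \<le> (\<Sum>v\<in>R. 2 * k)" by (simp add: mult_ac)
    then obtain v where v: "v \<in> R" "card {S\<in>Ed. v \<in> S} \<le> 2 * k"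
      using sum_strict_mono[OF fin False, of "\<lambda>_. 2 * k" "\<lambda>v. card {S\<in>Ed. v \<in> S}"]
      by (meson leD leI)
    define N where "N = {u\<in>R. u \<noteq> v \<and> {u,v} \<in> G}"
    have finN: "finite N" using fin unfolding N_def by simp
    have "card N \<le> 2 * k"
    proof -
      have "card N = card ((\<lambda>u. {u,v}) ` N)"
        unfolding N_def by (intro card_image[symmetric] inj_onI) (auto simp: doubleton_eq_iff)
      also have "\<dots> \<le> card {S\<in>Ed. v \<in> S}"
        by (rule card_mono[OF finite_subset[OF _ finE]]) (use v(1) in \<open>auto simp: N_def Ed_def\<close>)
      finally show ?thesis using v(2) by simp
    qed
    have split: "C R \<subseteq> C (R - {v}) \<union> insert v ` {T. T \<subseteq> N \<and> card T \<le> j}"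
    proof
      fix S assume S: "S \<in> C R"
      show "S \<in> C (R - {v}) \<union> insert v ` {T. T \<subseteq> N \<and> card T \<le> j}"
      proof (cases "v \<in> S")
        case False
        then show ?thesis using S unfolding C_def by auto
      next
        case True
        have "u \<in> N" if "u \<in> S - {v}" for u
        proof -
          have "{u,v} \<subseteq> S" "card {u,v} = 2" using that True by auto
          then have "{u,v} \<in> G" using S unfolding C_def by blast
          then show ?thesis using that S unfolding N_def C_def by auto
        qed
        moreover have "card (S - {v}) \<le> j"
          using S True finite_subset[OF _ fin] unfolding C_def by auto
        ultimately have "S - {v} \<in> {T. T \<subseteq> N \<and> card T \<le> j}" by blast
        moreover have "S = insert v (S - {v})" using True by blast
        ultimately show ?thesis by blast
      qed
    qed
    have IH: "card (C (R - {v})) \<le> card (R - {v}) * (2 * k + 1) ^ j"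
      unfolding C_def
    proof (rule less.hyps)
      show "card (R - {v}) < card R" using v(1) fin by (meson card_Diff1_less)
      show "finite (R - {v})" using fin by simp
      show "card {S\<in>G. S \<subseteq> R' \<and> card S = 2} \<le> k * card R'" if "R' \<subseteq> R - {v}" for R'
        using that by (intro less.prems(2)) blast
    qed
    have "card (C R) \<le> card (C (R - {v})) + card {T. T \<subseteq> N \<and> card T \<le> j}"
    proof -
      have f1: "finite (C (R - {v}))" using fin unfolding C_def by simp
      have f2: "finite {T. T \<subseteq> N \<and> card T \<le> j}" using finN by simp
      have "card (C R) \<le> card (C (R - {v}) \<union> insert v ` {T. T \<subseteq> N \<and> card T \<le> j})"
        using f1 f2 by (intro card_mono split) auto
      also have "\<dots> \<le> card (C (R - {v})) + card (insert v ` {T. T \<subseteq> N \<and> card T \<le> j})"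
        by (rule card_Un_le)
      finally show ?thesis using card_image_le[OF f2, of "insert v"] by linarith
    qed
    also have "card {T. T \<subseteq> N \<and> card T \<le> j} \<le> (2 * k + 1) ^ j"
      using card_subsets_le_power[OF finN, of j] power_mono[of "card N + 1" "2 * k + 1" j] \<open>card N \<le> 2 * k\<close>
      by linarith
    also have "card (C (R - {v})) + (2 * k + 1) ^ j \<le> (card (R - {v}) + 1) * (2 * k + 1) ^ j"
      using IH by simp
    also have "card (R - {v}) + 1 = card R"
      using v(1) fin card_gt_0_iff[of R] by (simp add: card_Diff_singleton) (metis Suc_pred card_gt_0_iff empty_iff)
    finally show ?thesis unfolding C_def by simp
  qed
qed

section \<open>Packing\<close>

text \<open>The weight of \<open>R\<close> when every element of \<open>V\<close> is chosen independently with probability \<open>p\<close>.\<close>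

definition bern :: "real \<Rightarrow> 'a set \<Rightarrow> 'a set \<Rightarrow> real" where
  "bern p V R = p ^ card R * (1 - p) ^ card (V - R)"

lemma bern_nonneg: "0 \<le> p \<Longrightarrow> p \<le> 1 \<Longrightarrow> 0 \<le> bern p V R"
  by (simp add: bern_def)

text \<open>The probability that the random set has trace \<open>Q\<close> on e. It comes from
  expanding the product of the sums \<open>f i + g i\<close>, where the factors set to 0 kill every
  subset with another trace.\<close>

lemma bern_cylinder:
  assumes "finite V" "Q \<subseteq> e" "e \<subseteq> V"
  shows "(\<Sum>R\<in>Pow V. if R \<inter> e = Q then bern p V R else 0) = p ^ card Q * (1 - p) ^ card (e - Q)"
proof -
  define f where "f i = (if i \<in> e - Q then 0 else p)" for i
  define g where "g i = (if i \<in> Q then 0 else 1 - p)" for i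
  have summand: "prod f R * prod g (V - R) = (if R \<inter> e = Q then bern p V R else 0)" if R: "R \<in> Pow V" for R
  proof (cases "R \<inter> e = Q")
    case True
    then have "\<And>i. i \<in> R \<Longrightarrow> f i = p" "\<And>i. i \<in> V - R \<Longrightarrow> g i = 1 - p"
      unfolding f_def g_def by auto
    then show ?thesis using True by (simp add: bern_def)
  next
    case False
    then consider i where "i \<in> R" "i \<in> e - Q" | i where "i \<in> V - R" "i \<in> Q"
      using assms(2,3) by blast
    then have "prod f R = 0 \<or> prod g (V - R) = 0"
    proof cases
      case 1
      then have "f i = 0" by (simp add: f_def)
      then show ?thesis using 1 R assms(1) finite_subset[of R V] by auto
    next
      case 2
      then have "g i = 0" by (simp add: g_def)
      then show ?thesis using 2 assms(1) by auto
    qed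
    then show ?thesis using False by auto
  qed
  have "(\<Sum>R\<in>Pow V. if R \<inter> e = Q then bern p V R else 0) = (\<Sum>R\<in>Pow V. prod f R * prod g (V - R))"
    by (rule sum.cong) (simp_all add: summand)
  also have "\<dots> = (\<Prod>i\<in>V. f i + g i)" using prod_add[OF assms(1), of f g] by simp
  also have "\<dots> = (\<Prod>i\<in>e. f i + g i)"
    using assms by (intro prod.mono_neutral_right) (auto simp: f_def g_def)
  also have "\<dots> = (\<Prod>i\<in>Q \<union> (e - Q). f i + g i)" using assms(2) by (simp add: Un_absorb1)
  also have "\<dots> = (\<Prod>i\<in>Q. f i + g i) * (\<Prod>i\<in>e - Q. f i + g i)"
    using assms finite_subset by (intro prod.union_disjoint) (auto intro: finite_subset)
  also have "(\<Prod>i\<in>Q. f i + g i) = (\<Prod>i\<in>Q. p)"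
    by (rule prod.cong) (auto simp: f_def g_def)
  also have "(\<Prod>i\<in>e - Q. f i + g i) = (\<Prod>i\<in>e - Q. 1 - p)"
    by (rule prod.cong) (auto simp: f_def g_def)
  finally show ?thesis by simp
qed

lemma bern_sum: "finite V \<Longrightarrow> (\<Sum>R\<in>Pow V. bern p V R) = 1"
  using bern_cylinder[of V "{}" "{}" p] by simp

lemma bern_expected_card:
  assumes "finite V" "e \<subseteq> V"
  shows "(\<Sum>R\<in>Pow V. bern p V R * real (card (R \<inter> e))) = p * real (card e)"
proof -
  have fe: "finite e" using assms finite_subset by blast
  have "real (card (R \<inter> e)) = (\<Sum>x\<in>e. if x \<in> R then 1 else 0)" for R
    using fe by (simp add: sum.If_cases Int_commute)
  then have "(\<Sum>R\<in>Pow V. bern p V R * real (card (R \<inter> e)))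
      = (\<Sum>R\<in>Pow V. \<Sum>x\<in>e. if x \<in> R then bern p V R else 0)"
    by (simp add: sum_distrib_left if_distrib cong: if_cong)
  also have "\<dots> = (\<Sum>x\<in>e. \<Sum>R\<in>Pow V. if x \<in> R then bern p V R else 0)" by (rule sum.swap)
  also have "\<dots> = (\<Sum>x\<in>e. p)"
  proof (rule sum.cong)
    fix x assume "x \<in> e"
    have "(\<Sum>R\<in>Pow V. if x \<in> R then bern p V R else 0) = (\<Sum>R\<in>Pow V. if R \<inter> {x} = {x} then bern p V R else 0)"
      by (rule sum.cong) auto
    also have "\<dots> = p ^ card {x} * (1 - p) ^ card ({x} - {x})"
      using assms \<open>x \<in> e\<close> by (intro bern_cylinder) auto
    finally show "(\<Sum>R\<in>Pow V. if x \<in> R then bern p V R else 0) = p" by simp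
  qed simp
  finally show ?thesis by simp
qed

text \<open>Removing x from \<open>R\<close> changes the weight by the factor (1 - p) / p. This lets
  a sum over samples with a distinguished member be read as one over smaller samples and a fresh
  element; the packing argument bounds it from above in the first reading and from below in the
  second.\<close>

lemma bern_exchange:
  fixes g :: "'a \<Rightarrow> 'a set \<Rightarrow> real"
  assumes "finite V"
  shows "(1 - p) * (\<Sum>R\<in>Pow V. bern p V R * (\<Sum>x\<in>R. g x (R - {x})))
    = p * (\<Sum>R\<in>Pow V. bern p V R * (\<Sum>x\<in>V - R. g x R))"
proof -
  have fin: "finite R" if "R \<in> Pow V" for R using that assms finite_subset by auto
  have "(1 - p) * (\<Sum>R\<in>Pow V. bern p V R * (\<Sum>x\<in>R. g x (R - {x})))
      = (\<Sum>(R,x)\<in>(SIGMA R:Pow V. R). (1 - p) * bern p V R * g x (R - {x}))"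
    using assms fin by (subst sum.Sigma[symmetric]) (auto simp: sum_distrib_left mult_ac)
  also have "\<dots> = (\<Sum>(R,x)\<in>(SIGMA R:Pow V. V - R). p * bern p V R * g x R)"
  proof (rule sum.reindex_bij_witness[of _ "\<lambda>(R,x). (insert x R, x)" "\<lambda>(R,x). (R - {x}, x)"])
    fix a assume "a \<in> (SIGMA R:Pow V. R)"
    then obtain R x where a: "a = (R,x)" "R \<subseteq> V" "x \<in> R" by auto
    have fR: "finite R" using a fin by auto
    have 1: "card R = Suc (card (R - {x}))" using fR a(3) by (metis card.remove)
    have 2: "V - (R - {x}) = insert x (V - R)" using a by auto
    have "card (V - (R - {x})) = Suc (card (V - R))"
      unfolding 2 using assms a(3) by simp
    then have "(1 - p) * bern p V R = p * bern p V (R - {x})"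
      unfolding bern_def 1 by simp
    then show "(case case a of (R,x) \<Rightarrow> (R - {x}, x) of (R,x) \<Rightarrow> p * bern p V R * g x R)
        = (case a of (R,x) \<Rightarrow> (1 - p) * bern p V R * g x (R - {x}))"
      by (simp add: a(1))
  qed (auto simp: insert_absorb)
  also have "\<dots> = p * (\<Sum>R\<in>Pow V. bern p V R * (\<Sum>x\<in>V - R. g x R))"
    using assms fin by (subst sum.Sigma[symmetric]) (auto simp: sum_distrib_left mult_ac)
  finally show ?thesis .
qed

section \<open>Haussler's packing argument\<close>

text \<open>Double counting of the pairs of members of \<open>C\<close> that x tells apart.
  Separation makes the total at least of order \<open>\<delta>\<close> times the number of pairs,
  whereas one x tells apart at most the product of the sizes of its two sides, hence at most
  \<open>card C\<close> times the smaller side. Members agree on \<open>R\<close>, so only x outside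
  \<open>R\<close> count.\<close>

lemma separated_class_split:
  assumes "finite V" "finite C" "C \<noteq> {}" "\<And>e. e \<in> C \<Longrightarrow> e \<subseteq> V \<and> e \<inter> R = Q"
    and sep: "\<And>e e'. e \<in> C \<Longrightarrow> e' \<in> C \<Longrightarrow> e \<noteq> e' \<Longrightarrow> \<delta> \<le> real (card (e - e') + card (e' - e))"
  shows "\<delta> / 2 * (real (card C) - 1)
    \<le> (\<Sum>x\<in>V - R. real (min (card {e\<in>C. x \<notin> e}) (card {e\<in>C. x \<in> e})))"
proof -
  let ?b = "real (card C)"
  have b: "?b > 0" using assms(2,3) by (simp add: card_gt_0_iff)
  define S where "S = (\<Sum>x\<in>V - R. card {e\<in>C. x \<in> e} * card {e\<in>C. x \<notin> e})"
  have diff: "{x\<in>V - R. x \<in> e \<and> x \<notin> e'} = e - e'" if "e \<in> C" "e' \<in> C" for e e'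
    using assms(4)[OF that(1)] assms(4)[OF that(2)] by blast
  have "S = (\<Sum>x\<in>V - R. card {(e,e')\<in>C \<times> C. x \<in> e \<and> x \<notin> e'})"
    unfolding S_def
  proof (rule sum.cong)
    fix x
    have "{(e,e')\<in>C \<times> C. x \<in> e \<and> x \<notin> e'} = {e\<in>C. x \<in> e} \<times> {e\<in>C. x \<notin> e}" by auto
    then show "card {e\<in>C. x \<in> e} * card {e\<in>C. x \<notin> e} = card {(e,e')\<in>C \<times> C. x \<in> e \<and> x \<notin> e'}"
      by (simp add: card_cartesian_product)
  qed simp
  also have "\<dots> = (\<Sum>x\<in>V - R. \<Sum>(e,e')\<in>C \<times> C. if x \<in> e \<and> x \<notin> e' then 1 else 0)"
    using assms(2) by (intro sum.cong refl)
      (simp add: sum.If_cases case_prod_unfold Int_def, rule arg_cong[where f=card], auto)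
  also have "\<dots> = (\<Sum>(e,e')\<in>C \<times> C. \<Sum>x\<in>V - R. if x \<in> e \<and> x \<notin> e' then 1 else 0)"
    unfolding case_prod_unfold by (rule sum.swap)
  also have "\<dots> = (\<Sum>(e,e')\<in>C \<times> C. card (e - e'))"
  proof (intro sum.cong refl, clarify)
    fix e e' assume "e \<in> C" "e' \<in> C"
    then show "(\<Sum>x\<in>V - R. if x \<in> e \<and> x \<notin> e' then 1 else 0) = card (e - e')"
      using assms(1) diff[of e e'] by (simp add: sum.If_cases Int_def)
  qed
  finally have S1: "S = (\<Sum>(e,e')\<in>C \<times> C. card (e - e'))" .
  also have "\<dots> = (\<Sum>(e,e')\<in>C \<times> C. card (e' - e))"
    by (rule sum.reindex_bij_witness[of _ prod.swap prod.swap]) auto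
  finally have S2: "S = (\<Sum>(e,e')\<in>C \<times> C. card (e' - e))" .
  have "\<delta> * (?b * (?b - 1)) = (\<Sum>(e,e')\<in>C \<times> C. if e \<noteq> e' then \<delta> else 0)"
  proof -
    have "(\<Sum>(e,e')\<in>C \<times> C. if e \<noteq> e' then \<delta> else 0) = (\<Sum>e\<in>C. \<Sum>e'\<in>C. if e \<noteq> e' then \<delta> else 0)"
      using assms(2) by (simp add: sum.cartesian_product)
    also have "\<dots> = (\<Sum>e\<in>C. (?b - 1) * \<delta>)"
    proof (rule sum.cong)
      fix e assume e: "e \<in> C"
      have "C \<inter> {e'. e \<noteq> e'} = C - {e}" by auto
      then have "(\<Sum>e'\<in>C. if e \<noteq> e' then \<delta> else 0) = real (card (C - {e})) * \<delta>"
        using assms(2) by (simp add: sum.If_cases)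
      also have "real (card (C - {e})) = ?b - 1"
        using e assms(2) b by (simp add: card_Diff_singleton of_nat_diff Suc_leI card_gt_0_iff)
      finally show "(\<Sum>e'\<in>C. if e \<noteq> e' then \<delta> else 0) = (?b - 1) * \<delta>" .
    qed simp
    finally show ?thesis by (simp add: mult_ac)
  qed
  also have "\<dots> \<le> (\<Sum>(e,e')\<in>C \<times> C. real (card (e - e') + card (e' - e)))"
    using sep by (intro sum_mono) auto
  also have "\<dots> = real (S + S)"
    by (subst (2) S2, subst S1) (simp add: sum.distrib case_prod_unfold)
  finally have "\<delta> * (?b * (?b - 1)) \<le> 2 * real S" by simp
  moreover have "real S \<le> (\<Sum>x\<in>V - R. ?b * real (min (card {e\<in>C. x \<notin> e}) (card {e\<in>C. x \<in> e})))"
    unfolding S_def of_nat_sum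
  proof (rule sum_mono)
    fix x
    let ?l = "card {e\<in>C. x \<in> e}" and ?r = "card {e\<in>C. x \<notin> e}"
    have le: "?l \<le> card C" "?r \<le> card C" using assms(2) by (auto intro: card_mono)
    have "?l * ?r = max ?l ?r * min ?r ?l" by (simp add: max_def min_def)
    also have "\<dots> \<le> card C * min ?r ?l" using le by (intro mult_right_mono) auto
    finally have "real (?l * ?r) \<le> real (card C * min ?r ?l)" by (simp only: of_nat_le_iff)
    then show "real (?l * ?r) \<le> ?b * real (min ?r ?l)" by (simp only: of_nat_mult)
  qed
  ultimately have "\<delta> * (?b * (?b - 1))
      \<le> 2 * (?b * (\<Sum>x\<in>V - R. real (min (card {e\<in>C. x \<notin> e}) (card {e\<in>C. x \<in> e}))))"
    unfolding sum_distrib_left[symmetric] by linarith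
  moreover have "?b * (\<delta> / 2 * (?b - 1)) = \<delta> * (?b * (?b - 1)) / 2" by simp
  ultimately have "?b * (\<delta> / 2 * (?b - 1))
      \<le> ?b * (\<Sum>x\<in>V - R. real (min (card {e\<in>C. x \<notin> e}) (card {e\<in>C. x \<in> e})))"
    by linarith
  then show ?thesis using b by (simp only: mult_le_cancel_left_pos)
qed

lemma shatters_traces:
  assumes "S \<subseteq> R" "shatters ((\<lambda>e. e \<inter> R) ` F) S"
  shows "shatters F S"
  unfolding shatters_def
proof (intro allI impI)
  fix T assume "T \<subseteq> S"
  then obtain e where "e \<in> F" "e \<inter> R \<inter> S = T" using shattersD[OF assms(2)] by blast
  moreover have "e \<inter> R \<inter> S = e \<inter> S" using assms(1) by blast
  ultimately show "\<exists>e\<in>F. e \<inter> S = T" by auto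
qed

text \<open>The weight of an edge in the one-inclusion graph of the traces, averaged over a random
  sample, is estimated twice: the dimension bounds it from above, and separation inside each class
  of members with equal trace bounds it from below. If few traces are expected, the classes are
  large, and the lower bound limits the size of \<open>F\<close>.\<close>

lemma haussler_packing:
  assumes V: "finite V" and F: "F \<subseteq> Pow V"
    and vc: "\<And>S. S \<subseteq> V \<Longrightarrow> shatters F S \<Longrightarrow> card S \<le> d"
    and sep: "\<And>e e'. e \<in> F \<Longrightarrow> e' \<in> F \<Longrightarrow> e \<noteq> e' \<Longrightarrow> \<delta> \<le> real (card (e - e') + card (e' - e))"
    and p: "0 < p" "p < 1"
  shows "p * \<delta> / 2 * (real (card F) - (\<Sum>R\<in>Pow V. bern p V R * real (card ((\<lambda>e. e \<inter> R) ` F))))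
    \<le> real d * real (card F)"
proof -
  have finF: "finite F" using V F finite_subset by blast
  define w where "w R Q = card {e\<in>F. e \<inter> R = Q}" for R Q
  define T where "T R = (\<lambda>e. e \<inter> R) ` F" for R
  \<comment> \<open>Total weight of the edges in direction x among the traces on
    \<open>insert x R\<close>, a trace weighing as much as the number of members of \<open>F\<close>
    that have it.\<close>
  define g where "g x R = real (\<Sum>Q\<in>Pow R. min (w (insert x R) Q) (w (insert x R) (insert x Q)))" for x R
  have sub: "(\<lambda>e. e \<inter> R) ` F \<subseteq> Pow R" for R by auto
  have sum_w: "(\<Sum>Q\<in>Pow R. w R Q) = card F" if "R \<subseteq> V" for R
    using sum.group[OF finF _ sub[of R], of "\<lambda>_. 1::nat"] that V finite_subset unfolding w_def by auto
  have sum_wT: "(\<Sum>Q\<in>T R. w R Q) = card F" for R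
    using sum.image_gen[OF finF, of "\<lambda>_. 1::nat" "\<lambda>e. e \<inter> R"] unfolding w_def T_def by simp
  have upper: "(\<Sum>x\<in>R. g x (R - {x})) \<le> real d * real (card F)" if "R \<in> Pow V" for R
  proof -
    have R: "R \<subseteq> V" "finite R" using that V finite_subset by auto
    have "(\<Sum>x\<in>R. \<Sum>Q\<in>Pow (R - {x}). min (w R Q) (w R (insert x Q))) \<le> d * (\<Sum>Q\<in>Pow R. w R Q)"
    proof (rule weighted_one_inclusion_density[OF R(2)])
      fix S assume S: "S \<subseteq> R" "shatters {Q. Q \<subseteq> R \<and> w R Q > 0} S"
      have "{Q. Q \<subseteq> R \<and> w R Q > 0} \<subseteq> (\<lambda>e. e \<inter> R) ` F"
        unfolding w_def by (auto simp: card_gt_0_iff)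
      then have "shatters ((\<lambda>e. e \<inter> R) ` F) S"
        by (rule shatters_mono[OF S(2)])
      then show "card S \<le> d" using S(1) R(1) shatters_traces by (intro vc) auto
    qed
    then have "real (\<Sum>x\<in>R. \<Sum>Q\<in>Pow (R - {x}). min (w R Q) (w R (insert x Q))) \<le> real (d * card F)"
      using sum_w[OF R(1)] by (simp only: of_nat_le_iff)
    moreover have "(\<Sum>x\<in>R. g x (R - {x})) = (\<Sum>x\<in>R. real (\<Sum>Q\<in>Pow (R - {x}). min (w R Q) (w R (insert x Q))))"
      unfolding g_def by (intro sum.cong) (auto simp: insert_absorb)
    ultimately show ?thesis by simp
  qed
  have lower: "\<delta> / 2 * (real (card F) - real (card (T R))) \<le> (\<Sum>x\<in>V - R. g x R)" if "R \<in> Pow V" for R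
  proof -
    have R: "R \<subseteq> V" "finite R" using that V finite_subset by auto
    have finT: "finite (T R)" using finF unfolding T_def by simp
    have "\<delta> / 2 * (real (card F) - real (card (T R))) = (\<Sum>Q\<in>T R. \<delta> / 2 * (real (w R Q) - 1))"
    proof -
      have "(\<Sum>Q\<in>T R. \<delta> / 2 * (real (w R Q) - 1)) = \<delta> / 2 * ((\<Sum>Q\<in>T R. real (w R Q)) - real (card (T R)))"
        unfolding sum_distrib_left[symmetric] sum_subtractf by simp
      then show ?thesis unfolding sum_wT[of R, symmetric] of_nat_sum by simp
    qed
    also have "\<dots> \<le> (\<Sum>Q\<in>T R. \<Sum>x\<in>V - R. real (min (w (insert x R) Q) (w (insert x R) (insert x Q))))"
    proof (rule sum_mono)
      fix Q assume Q: "Q \<in> T R"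
      let ?C = "{e\<in>F. e \<inter> R = Q}"
      have "\<delta> / 2 * (real (card ?C) - 1)
          \<le> (\<Sum>x\<in>V - R. real (min (card {e\<in>?C. x \<notin> e}) (card {e\<in>?C. x \<in> e})))"
        using V finF F Q sep by (intro separated_class_split[where Q=Q]) (auto simp: T_def)
      also have "\<dots> = (\<Sum>x\<in>V - R. real (min (w (insert x R) Q) (w (insert x R) (insert x Q))))"
      proof (rule sum.cong)
        fix x assume x: "x \<in> V - R"
        have QR: "Q \<subseteq> R" using Q unfolding T_def by auto
        have "{e\<in>?C. x \<notin> e} = {e\<in>F. e \<inter> insert x R = Q}" "{e\<in>?C. x \<in> e} = {e\<in>F. e \<inter> insert x R = insert x Q}"
          using x QR by auto
        then show "real (min (card {e\<in>?C. x \<notin> e}) (card {e\<in>?C. x \<in> e}))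
            = real (min (w (insert x R) Q) (w (insert x R) (insert x Q)))"
          unfolding w_def by simp
      qed simp
      finally show "\<delta> / 2 * (real (w R Q) - 1)
          \<le> (\<Sum>x\<in>V - R. real (min (w (insert x R) Q) (w (insert x R) (insert x Q))))"
        by (simp add: w_def)
    qed
    also have "\<dots> \<le> (\<Sum>Q\<in>Pow R. \<Sum>x\<in>V - R. real (min (w (insert x R) Q) (w (insert x R) (insert x Q))))"
      using R(2) by (intro sum_mono2) (auto simp: T_def intro!: sum_nonneg)
    also have "\<dots> = (\<Sum>x\<in>V - R. g x R)"
      unfolding g_def of_nat_sum by (rule sum.swap)
    finally show ?thesis .
  qed
  have p': "0 \<le> p" "p \<le> 1" using p by auto
  let ?E = "\<lambda>h. \<Sum>R\<in>Pow V. bern p V R * h R"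
  have "?E (\<lambda>R. \<delta> / 2 * (real (card F) - real (card (T R)))) \<le> ?E (\<lambda>R. \<Sum>x\<in>V - R. g x R)"
    using bern_nonneg[OF p'] lower by (intro sum_mono mult_left_mono) auto
  moreover have "?E (\<lambda>R. \<delta> / 2 * (real (card F) - real (card (T R))))
      = \<delta> / 2 * (real (card F) - ?E (\<lambda>R. real (card (T R))))"
  proof -
    have "?E (\<lambda>R. \<delta> / 2 * (real (card F) - real (card (T R))))
        = \<delta> / 2 * real (card F) * (\<Sum>R\<in>Pow V. bern p V R) - \<delta> / 2 * ?E (\<lambda>R. real (card (T R)))"
      by (simp add: sum_distrib_left sum_subtractf right_diff_distrib mult_ac)
    then show ?thesis using bern_sum[OF V, of p] by (simp add: algebra_simps)
  qed
  ultimately have "\<delta> / 2 * (real (card F) - ?E (\<lambda>R. real (card (T R)))) \<le> ?E (\<lambda>R. \<Sum>x\<in>V - R. g x R)"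
    by simp
  then have "p * (\<delta> / 2 * (real (card F) - ?E (\<lambda>R. real (card (T R))))) \<le> p * ?E (\<lambda>R. \<Sum>x\<in>V - R. g x R)"
    using p' by (intro mult_left_mono) auto
  also have "\<dots> = (1 - p) * ?E (\<lambda>R. \<Sum>x\<in>R. g x (R - {x}))"
    using bern_exchange[OF V, of p g] by simp
  also have "\<dots> \<le> (1 - p) * ?E (\<lambda>R. real d * real (card F))"
    using bern_nonneg[OF p'] upper p' by (intro sum_mono mult_left_mono) auto
  also have "?E (\<lambda>R. real d * real (card F)) = real d * real (card F)"
    using bern_sum[OF V, of p] by (simp add: sum_distrib_right[symmetric])
  also have "(1 - p) * (real d * real (card F)) \<le> real d * real (card F)"
    using p' by (simp add: mult_left_le_one_le)
  finally show ?thesis unfolding T_def by simp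
qed

section \<open>Nets by double sampling\<close>

text \<open>Of 2r independent draws at most r / 2 are expected to fall into g, so by Markov's
  inequality at least half of all sequences have no more than r of them there.\<close>

lemma markov_functions:
  assumes "finite \<T>" "g \<subseteq> \<T>" "4 * card g \<le> card \<T>"
  shows "card (PiE {..<2*r} (\<lambda>_. \<T>)) \<le> 2 * card {f \<in> PiE {..<2*r} (\<lambda>_. \<T>). card {j\<in>{..<2*r}. f j \<in> g} \<le> r}"
proof -
  let ?\<Omega> = "PiE {..<2*r} (\<lambda>_. \<T>)"
  let ?c = "\<lambda>f. card {j\<in>{..<2*r}. f j \<in> g}"
  have fin: "finite ?\<Omega>" using assms(1) by (simp add: finite_PiE)
  have one: "4 * card {f\<in>?\<Omega>. f j \<in> g} \<le> card ?\<Omega>" if j: "j < 2*r" for j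
  proof -
    have eq: "{f\<in>?\<Omega>. f j \<in> g} = PiE {..<2*r} (\<lambda>i. if i = j then g else \<T>)"
      using assms(2) j by (auto simp: PiE_def Pi_def split: if_splits)
    have "card {f\<in>?\<Omega>. f j \<in> g} = (\<Prod>i\<in>{..<2*r}. card (if i = j then g else \<T>))"
      unfolding eq by (rule card_PiE) simp
    also have "\<dots> = card g * (\<Prod>i\<in>{..<2*r} - {j}. card \<T>)"
      using j by (subst prod.remove[of _ j]) auto
    finally have "card {f\<in>?\<Omega>. f j \<in> g} = card g * (\<Prod>i\<in>{..<2*r} - {j}. card \<T>)" .
    then have "4 * card {f\<in>?\<Omega>. f j \<in> g} = 4 * card g * (\<Prod>i\<in>{..<2*r} - {j}. card \<T>)"
      by (simp only: mult.assoc)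
    also have "\<dots> \<le> card \<T> * (\<Prod>i\<in>{..<2*r} - {j}. card \<T>)"
      using assms(3) by (rule mult_le_mono1)
    also have "\<dots> = (\<Prod>i\<in>{..<2*r}. card \<T>)"
      by (rule prod.remove[symmetric]) (use j in auto)
    also have "\<dots> = card ?\<Omega>" by (simp add: card_PiE)
    finally show ?thesis .
  qed
  have "(\<Sum>f\<in>?\<Omega>. ?c f) = (\<Sum>f\<in>?\<Omega>. \<Sum>j\<in>{..<2*r}. if f j \<in> g then 1 else 0)"
    by (simp add: sum.If_cases Int_def)
  also have "\<dots> = (\<Sum>j\<in>{..<2*r}. \<Sum>f\<in>?\<Omega>. if f j \<in> g then 1 else 0)" by (rule sum.swap)
  also have "\<dots> = (\<Sum>j\<in>{..<2*r}. card {f\<in>?\<Omega>. f j \<in> g})"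
    using fin by (simp add: sum.If_cases Int_def)
  finally have "4 * (\<Sum>f\<in>?\<Omega>. ?c f) = (\<Sum>j\<in>{..<2*r}. 4 * card {f\<in>?\<Omega>. f j \<in> g})"
    by (simp add: sum_distrib_left)
  also have "\<dots> \<le> (\<Sum>j\<in>{..<2*r}. card ?\<Omega>)" using one by (intro sum_mono) auto
  finally have total: "2 * (\<Sum>f\<in>?\<Omega>. ?c f) \<le> r * card ?\<Omega>" by simp
  let ?B = "{f\<in>?\<Omega>. \<not> ?c f \<le> r}"
  have "(r + 1) * card ?B = (\<Sum>f\<in>?B. r + 1)" by simp
  also have "\<dots> \<le> (\<Sum>f\<in>?B. ?c f)" by (intro sum_mono) auto
  also have "\<dots> \<le> (\<Sum>f\<in>?\<Omega>. ?c f)" using fin by (intro sum_mono2) auto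
  finally have "2 * ((r + 1) * card ?B) \<le> r * card ?\<Omega>" using total by linarith
  also have "\<dots> \<le> (r + 1) * card ?\<Omega>" by simp
  finally have "2 * card ?B \<le> card ?\<Omega>"
    by (metis (no_types, lifting) Suc_eq_plus1 mult.left_commute mult_le_cancel1 zero_less_Suc)
  moreover have "card ?\<Omega> = card {f\<in>?\<Omega>. ?c f \<le> r} + card ?B"
  proof -
    have "?\<Omega> = {f\<in>?\<Omega>. ?c f \<le> r} \<union> ?B" by blast
    moreover have "{f\<in>?\<Omega>. ?c f \<le> r} \<inter> ?B = {}" by blast
    ultimately show ?thesis using fin by (metis (no_types, lifting) card_Un_disjoint finite_Un)
  qed
  ultimately show ?thesis by linarith
qed

definition swap_on :: "'i set \<Rightarrow> ('i \<Rightarrow> 'a) \<times> ('i \<Rightarrow> 'a) \<Rightarrow> ('i \<Rightarrow> 'a) \<times> ('i \<Rightarrow> 'a)" where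
  "swap_on \<sigma> z = ((\<lambda>j. if j \<in> \<sigma> then snd z j else fst z j), (\<lambda>j. if j \<in> \<sigma> then fst z j else snd z j))"

lemma swap_on_swap_on: "swap_on \<sigma> (swap_on \<sigma> z) = z"
  by (simp add: swap_on_def fun_eq_iff prod_eq_iff)

text \<open>Where exactly one of \<open>f j\<close> and \<open>f' j\<close> lies in h, the
  requirement on the first sample dictates whether to swap. Only indices with both in h are free,
  and each of them counts in the second sample, so there are at most r.\<close>

lemma card_swaps_le:
  fixes f f' :: "nat \<Rightarrow> 'a"
  shows "card {\<sigma>. \<sigma> \<subseteq> {..<s} \<and> (\<forall>j<s. fst (swap_on \<sigma> (f,f')) j \<in> h) \<and>
      card {j\<in>{..<s}. snd (swap_on \<sigma> (f,f')) j \<in> h} \<le> r} \<le> 2 ^ r" (is "card ?A \<le> _")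
proof (cases "?A = {}")
  case False
  define J where "J = {j\<in>{..<s}. f j \<in> h \<and> f' j \<in> h}"
  have finJ: "finite J" unfolding J_def by simp
  from False obtain \<sigma> where \<sigma>: "\<sigma> \<in> ?A" by blast
  then have "J \<subseteq> {j\<in>{..<s}. snd (swap_on \<sigma> (f,f')) j \<in> h}"
    unfolding J_def swap_on_def by auto
  then have "card J \<le> card {j\<in>{..<s}. snd (swap_on \<sigma> (f,f')) j \<in> h}" by (intro card_mono) auto
  then have cJ: "card J \<le> r" using \<sigma> by simp
  have det: "j \<in> \<sigma> \<longleftrightarrow> (if j \<in> J then j \<in> \<sigma> \<inter> J else j < s \<and> f' j \<in> h)" if "\<sigma> \<in> ?A" for \<sigma> j
  proof -
    have "j \<in> \<sigma> \<Longrightarrow> j < s" and "j < s \<Longrightarrow> (if j \<in> \<sigma> then f' j else f j) \<in> h"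
      using that unfolding swap_on_def by auto
    then show ?thesis unfolding J_def by (auto split: if_splits)
  qed
  have "inj_on (\<lambda>\<sigma>. \<sigma> \<inter> J) ?A"
  proof (rule inj_onI)
    fix \<sigma> \<tau> assume st: "\<sigma> \<in> ?A" "\<tau> \<in> ?A" "\<sigma> \<inter> J = \<tau> \<inter> J"
    show "\<sigma> = \<tau>"
    proof (rule set_eqI)
      show "j \<in> \<sigma> \<longleftrightarrow> j \<in> \<tau>" for j
      proof (cases "j \<in> J")
        case True
        then show ?thesis using st(3) by blast
      next
        case False
        then show ?thesis using det[OF st(1), of j] det[OF st(2), of j] by simp
      qed
    qed
  qed
  then have "card ?A \<le> card (Pow J)" using finJ by (intro card_inj_on_le[of "\<lambda>\<sigma>. \<sigma> \<inter> J"]) auto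
  also have "\<dots> \<le> 2 ^ r" using finJ cJ by (simp add: card_Pow)
  finally show ?thesis .
next
  case True
  show ?thesis unfolding True by simp
qed

text \<open>Double sampling: a sample lying inside a small set \<open>g\<close> typically comes with a second sample
  of which \<open>g\<close> contains at most half; exchanging entries of the two samples at random makes this
  unlikely.\<close>

lemma double_sampling_net:
  assumes fin: "finite \<T>" and ne: "\<T> \<noteq> {}"
    and \<G>: "\<And>g. g \<in> \<G> \<Longrightarrow> g \<subseteq> \<T> \<and> 4 * card g \<le> card \<T>"
    and traces: "\<And>U. U \<subseteq> \<T> \<Longrightarrow> card U \<le> 4 * r \<Longrightarrow> card ((\<lambda>g. g \<inter> U) ` \<G>) \<le> N"
    and N: "2 * N < 2 ^ r"
  obtains U where "U \<subseteq> \<T>" "card U \<le> 2 * r" "\<And>g. g \<in> \<G> \<Longrightarrow> \<not> U \<subseteq> g"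
proof (rule ccontr)
  note found = that
  assume contr: "\<not> thesis"
  define s where "s = 2 * r"
  define \<Omega> where "\<Omega> = PiE {..<s} (\<lambda>_. \<T>)"
  have fin\<Omega>: "finite \<Omega>" unfolding \<Omega>_def using fin by (simp add: finite_PiE)
  have \<Omega>T: "f j \<in> \<T>" if "f \<in> \<Omega>" "j < s" for f j using that unfolding \<Omega>_def by auto
  have ex: "\<exists>g\<in>\<G>. \<forall>j<s. f j \<in> g" if f: "f \<in> \<Omega>" for f
  proof -
    have sub: "f ` {..<s} \<subseteq> \<T>" using \<Omega>T[OF f] by auto
    have card: "card (f ` {..<s}) \<le> 2 * r" using card_image_le[of "{..<s}" f] unfolding s_def by simp
    show ?thesis
    proof (rule ccontr)
      assume "\<not> ?thesis"
      then have "thesis" by (intro found[OF sub card]) auto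
      then show False using contr by simp
    qed
  qed
  define bad where "bad z h \<longleftrightarrow> (\<forall>j<s. fst z j \<in> h) \<and> card {j\<in>{..<s}. snd z j \<in> h} \<le> r"
    for z :: "(nat \<Rightarrow> 'a) \<times> (nat \<Rightarrow> 'a)" and h
  define Bd where "Bd = {z\<in>\<Omega> \<times> \<Omega>. \<exists>g\<in>\<G>. bad z g}"
  have finBd: "finite Bd" using fin\<Omega> unfolding Bd_def by simp
  \<comment> \<open>Every first sample lies in some g by assumption, and at least half of the second
    samples are then bad for it.\<close>
  have lower: "card \<Omega> * card \<Omega> \<le> 2 * card Bd"
  proof -
    have "card \<Omega> \<le> 2 * card {f'\<in>\<Omega>. (f,f') \<in> Bd}" if f: "f \<in> \<Omega>" for f
    proof -
      obtain g where g: "g \<in> \<G>" "\<forall>j<s. f j \<in> g" using ex[OF f] by blast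
      have "card \<Omega> \<le> 2 * card {f'\<in>\<Omega>. card {j\<in>{..<s}. f' j \<in> g} \<le> r}"
        using markov_functions[OF fin, of g r] \<G>[OF g(1)] unfolding \<Omega>_def s_def by blast
      also have "card {f'\<in>\<Omega>. card {j\<in>{..<s}. f' j \<in> g} \<le> r} \<le> card {f'\<in>\<Omega>. (f,f') \<in> Bd}"
        using f g fin\<Omega> unfolding Bd_def bad_def by (intro card_mono) auto
      finally show ?thesis by simp
    qed
    then have "(\<Sum>f\<in>\<Omega>. card \<Omega>) \<le> (\<Sum>f\<in>\<Omega>. 2 * card {f'\<in>\<Omega>. (f,f') \<in> Bd})" by (intro sum_mono)
    also have "\<dots> = 2 * card (SIGMA f:\<Omega>. {f'\<in>\<Omega>. (f,f') \<in> Bd})"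
      using fin\<Omega> by (simp add: sum_distrib_left)
    also have "(SIGMA f:\<Omega>. {f'\<in>\<Omega>. (f,f') \<in> Bd}) = Bd" unfolding Bd_def by auto
    finally show ?thesis by simp
  qed
  have swap: "card {z\<in>\<Omega> \<times> \<Omega>. swap_on \<sigma> z \<in> Bd} = card Bd" if \<sigma>: "\<sigma> \<subseteq> {..<s}" for \<sigma>
  proof (rule bij_betw_same_card[of "swap_on \<sigma>"])
    have closed: "swap_on \<sigma> z \<in> \<Omega> \<times> \<Omega>" if "z \<in> \<Omega> \<times> \<Omega>" for z
      using that \<sigma> unfolding swap_on_def \<Omega>_def by (auto simp: PiE_def Pi_def extensional_def)
    show "bij_betw (swap_on \<sigma>) {z\<in>\<Omega> \<times> \<Omega>. swap_on \<sigma> z \<in> Bd} Bd"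
    proof (rule bij_betw_byWitness[of _ "swap_on \<sigma>"])
      show "swap_on \<sigma> ` Bd \<subseteq> {z\<in>\<Omega> \<times> \<Omega>. swap_on \<sigma> z \<in> Bd}"
      proof
        fix y assume "y \<in> swap_on \<sigma> ` Bd"
        then obtain z where z: "y = swap_on \<sigma> z" "z \<in> Bd" by blast
        then have "z \<in> \<Omega> \<times> \<Omega>" unfolding Bd_def by blast
        then show "y \<in> {z\<in>\<Omega> \<times> \<Omega>. swap_on \<sigma> z \<in> Bd}"
          using closed z by (simp add: swap_on_swap_on)
      qed
    qed (auto simp: swap_on_swap_on)
  qed
  have upper: "card {\<sigma>. \<sigma> \<subseteq> {..<s} \<and> swap_on \<sigma> z \<in> Bd} \<le> N * 2 ^ r" if z: "z \<in> \<Omega> \<times> \<Omega>" for z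
  proof -
    obtain f f' where ff: "z = (f,f')" "f \<in> \<Omega>" "f' \<in> \<Omega>" using z by auto
    define U where "U = f ` {..<s} \<union> f' ` {..<s}"
    have U: "U \<subseteq> \<T>" using \<Omega>T ff unfolding U_def by auto
    have "card U \<le> card (f ` {..<s}) + card (f' ` {..<s})" unfolding U_def by (rule card_Un_le)
    also have "\<dots> \<le> s + s" using card_image_le[of "{..<s}" f] card_image_le[of "{..<s}" f'] by simp
    finally have cU: "card U \<le> 4 * r" unfolding s_def by simp
    let ?A = "\<lambda>h. {\<sigma>. \<sigma> \<subseteq> {..<s} \<and> bad (swap_on \<sigma> z) h}"
    \<comment> \<open>Only the part of g on the at most 4r sampled elements matters, so the union
      bound runs over at most \<open>N\<close> traces.\<close>
    have same: "bad (swap_on \<sigma> z) g \<longleftrightarrow> bad (swap_on \<sigma> z) (g \<inter> U)" for \<sigma> g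
    proof -
      have "fst (swap_on \<sigma> z) j \<in> U" "snd (swap_on \<sigma> z) j \<in> U" if "j < s" for j
        using that unfolding ff(1) U_def swap_on_def by auto
      then show ?thesis unfolding bad_def by (auto cong: conj_cong)
    qed
    have finU: "finite ((\<lambda>g. g \<inter> U) ` \<G>)"
      by (rule finite_subset[of _ "Pow U"]) (use U fin finite_subset in auto)
    have "card {\<sigma>. \<sigma> \<subseteq> {..<s} \<and> swap_on \<sigma> z \<in> Bd} \<le> card (\<Union>h\<in>(\<lambda>g. g \<inter> U) ` \<G>. ?A h)"
    proof (rule card_mono)
      show "finite (\<Union>h\<in>(\<lambda>g. g \<inter> U) ` \<G>. ?A h)"
        by (rule finite_subset[of _ "Pow {..<s}"]) auto
      show "{\<sigma>. \<sigma> \<subseteq> {..<s} \<and> swap_on \<sigma> z \<in> Bd} \<subseteq> (\<Union>h\<in>(\<lambda>g. g \<inter> U) ` \<G>. ?A h)"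
        using same unfolding Bd_def by auto
    qed
    also have "\<dots> \<le> (\<Sum>h\<in>(\<lambda>g. g \<inter> U) ` \<G>. card (?A h))"
      by (rule card_UN_le[OF finU])
    also have "\<dots> \<le> (\<Sum>h\<in>(\<lambda>g. g \<inter> U) ` \<G>. 2 ^ r)"
      unfolding bad_def ff(1) by (intro sum_mono card_swaps_le)
    also have "\<dots> \<le> N * 2 ^ r" using traces[OF U cU] by simp
    finally show ?thesis .
  qed
  \<comment> \<open>Averaging over all swaps: each swap preserves the number of bad pairs, yet any
    given pair is made bad by at most \<open>N * 2 ^ r\<close> of the \<open>2 ^ (2 * r)\<close>
    swaps.\<close>
  have "2 ^ s * card Bd = (\<Sum>\<sigma>\<in>Pow {..<s}. card {z\<in>\<Omega> \<times> \<Omega>. swap_on \<sigma> z \<in> Bd})"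
    using swap by (simp add: card_Pow)
  also have "\<dots> = (\<Sum>\<sigma>\<in>Pow {..<s}. \<Sum>z\<in>\<Omega> \<times> \<Omega>. if swap_on \<sigma> z \<in> Bd then 1 else 0)"
    using fin\<Omega> by (simp add: sum.If_cases Int_def)
  also have "\<dots> = (\<Sum>z\<in>\<Omega> \<times> \<Omega>. \<Sum>\<sigma>\<in>Pow {..<s}. if swap_on \<sigma> z \<in> Bd then 1 else 0)"
    by (rule sum.swap)
  also have "\<dots> = (\<Sum>z\<in>\<Omega> \<times> \<Omega>. card {\<sigma>. \<sigma> \<subseteq> {..<s} \<and> swap_on \<sigma> z \<in> Bd})"
    by (simp add: sum.If_cases Int_def)
  also have "\<dots> \<le> (\<Sum>z\<in>\<Omega> \<times> \<Omega>. N * 2 ^ r)" using upper by (rule sum_mono)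
  also have "\<dots> = card \<Omega> * card \<Omega> * (N * 2 ^ r)" using fin\<Omega> by (simp add: card_cartesian_product)
  finally have "2 ^ s * card Bd \<le> card \<Omega> * card \<Omega> * (N * 2 ^ r)" .
  moreover have "2 ^ s * card Bd = 2 ^ r * (2 ^ r * card Bd)"
    unfolding s_def mult_2 power_add by (rule mult.assoc)
  moreover have "card \<Omega> * card \<Omega> * (N * 2 ^ r) = 2 ^ r * (card \<Omega> * card \<Omega> * N)"
    by (simp only: mult_ac)
  ultimately have Bd_le: "2 ^ r * card Bd \<le> card \<Omega> * card \<Omega> * N" by simp
  have "2 ^ r * (card \<Omega> * card \<Omega>) \<le> 2 ^ r * (2 * card Bd)"
    using lower by (rule mult_le_mono2)
  also have "\<dots> = 2 * (2 ^ r * card Bd)" by (rule mult.left_commute)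
  also have "\<dots> \<le> 2 * (card \<Omega> * card \<Omega> * N)" using Bd_le by (rule mult_le_mono2)
  also have "\<dots> = 2 * N * (card \<Omega> * card \<Omega>)" by (simp only: mult_ac)
  finally have "2 ^ r * (card \<Omega> * card \<Omega>) \<le> 2 * N * (card \<Omega> * card \<Omega>)" .
  moreover have "card \<Omega> * card \<Omega> > 0"
    unfolding \<Omega>_def using fin ne by (simp add: card_PiE card_gt_0_iff)
  ultimately have "2 ^ r \<le> 2 * N" by (simp only: mult_le_cancel2)
  then show False using N by simp
qed

section \<open>Sets of size t for hyperedges close to a fixed block\<close>

text \<open>The condition of double sampling for r = 60 t, where 4r sets of size t cover at most 4rt
  elements. The base is at most 256 t^2, hence at most 2^(8 + 2t); its fourth power, doubled, is at
  most 2^(33 + 8t), which 60 t exceeds in the exponent from t = 1 on.\<close>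

lemma net_arithmetic:
  assumes "t \<ge> (1::nat)"
  shows "2 * (4 * (60 * t) * t + 1) ^ 4 < 2 ^ (60 * t)"
proof -
  have "t < 2 ^ t" by (rule less_exp)
  then have "4 * (60 * t) * t + 1 \<le> 256 * (2 ^ t * 2 ^ t)"
  proof -
    have "t * t \<le> 2 ^ t * 2 ^ t" using \<open>t < 2 ^ t\<close> by (intro mult_mono) auto
    moreover have "t * t \<ge> 1" using assms by simp
    moreover have "4 * (60 * t) * t + 1 \<le> 256 * (t * t)" using \<open>t * t \<ge> 1\<close> by simp
    ultimately show ?thesis by linarith
  qed
  also have "\<dots> = 2 ^ (8 + 2 * t)" unfolding mult_2 power_add by simp
  finally have "(4 * (60 * t) * t + 1) ^ 4 \<le> (2 ^ (8 + 2 * t)) ^ 4" by (rule power_mono) simp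
  also have "\<dots> = 2 ^ (32 + 8 * t)" 
    unfolding power_mult[symmetric] by (rule arg_cong[where f="\<lambda>n. 2 ^ n"]) simp
  finally have "2 * (4 * (60 * t) * t + 1) ^ 4 \<le> 2 * 2 ^ (32 + 8 * t)" by simp
  also have "\<dots> = 2 ^ (33 + 8 * t)" by (simp add: power_add)
  also have "\<dots> < 2 ^ (60 * t)" using assms by (intro power_strict_increasing) auto
  finally show ?thesis .
qed

text \<open>Double sampling is applied with the t-subsets of \<open>P\<close> as ground set and, for
  each e, the set \<open>g e\<close> of those not contained in e. The set e misses at most
  \<open>card P / (4 * t)\<close> elements of \<open>P\<close>, and each lies in a fraction
  \<open>t / card P\<close> of the t-subsets, so at most a quarter of them fail.\<close>

lemma net_in_block:
  fixes P :: "'a set"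
  assumes "finite P" "1 \<le> t" "t \<le> card P"
    and close: "\<And>e. e \<in> \<E> \<Longrightarrow> 4 * t * card (P - e) \<le> card P"
    and traces: "\<And>U. U \<subseteq> P \<Longrightarrow> card ((\<lambda>e. e \<inter> U) ` \<E>) \<le> (card U + 1) ^ 4"
  obtains \<S> where "\<S> \<subseteq> nsets P t" "card \<S> \<le> 120 * t" "\<And>e. e \<in> \<E> \<Longrightarrow> \<exists>S\<in>\<S>. S \<subseteq> e"
proof -
  define g where "g e = {S\<in>nsets P t. \<not> S \<subseteq> e}" for e
  have cT: "card (nsets P t) = card P choose t" using assms(1) by (simp add: card_nsets)
  have finT: "finite (nsets P t)" using assms(1) by (simp add: finite_imp_finite_nsets)
  have neT: "nsets P t \<noteq> {}"
  proof
    assume "nsets P t = {}"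
    then have "card P choose t = 0" unfolding cT[symmetric] by (simp only: card.empty)
    then show False using assms(3) by simp
  qed
  have small: "4 * card (g e) \<le> card (nsets P t)" if e: "e \<in> \<E>" for e
  proof -
    have P0: "card P > 0" using assms(2,3) by simp
    have one: "card {S\<in>nsets P t. x \<in> S} = (card P - 1) choose (t - 1)" if x: "x \<in> P" for x
    proof -
      have "card {S\<in>nsets P t. x \<in> S} = card (nsets (P - {x}) (t - 1))"
      proof (rule bij_betw_same_card[of "\<lambda>S. S - {x}"], rule bij_betw_byWitness[of _ "insert x"])
        show "(\<lambda>S. S - {x}) ` {S\<in>nsets P t. x \<in> S} \<subseteq> nsets (P - {x}) (t - 1)"
          by (auto simp: nsets_def)
        show "insert x ` nsets (P - {x}) (t - 1) \<subseteq> {S\<in>nsets P t. x \<in> S}"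
        proof
          fix S assume "S \<in> insert x ` nsets (P - {x}) (t - 1)"
          then obtain S' where S': "S = insert x S'" "S' \<subseteq> P - {x}" "finite S'" "card S' = t - 1"
            by (auto simp: nsets_def)
          then have "x \<notin> S'" by auto
          then show "S \<in> {S\<in>nsets P t. x \<in> S}" using S' x assms(2) by (auto simp: nsets_def)
        qed
      qed (auto simp: nsets_def)
      then show ?thesis using assms(1) x by (simp add: card_nsets card_Diff_singleton)
    qed
    have "g e \<subseteq> (\<Union>x\<in>P - e. {S\<in>nsets P t. x \<in> S})"
      unfolding g_def nsets_def by auto
    then have "card (g e) \<le> card (\<Union>x\<in>P - e. {S\<in>nsets P t. x \<in> S})"
      using finT assms(1) by (intro card_mono) auto
    also have "\<dots> \<le> (\<Sum>x\<in>P - e. card {S\<in>nsets P t. x \<in> S})"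
      using assms(1) by (intro card_UN_le) auto
    also have "\<dots> = card (P - e) * ((card P - 1) choose (t - 1))" using one by simp
    finally have "card P * (4 * card (g e)) \<le> 4 * card (P - e) * (card P * ((card P - 1) choose (t - 1)))"
      using mult_le_mono2[of "card (g e)" _ "4 * card P"] by (simp add: mult_ac)
    also have "card P * ((card P - 1) choose (t - 1)) = t * (card P choose t)"
      using times_binomial_minus1_eq[of t "card P"] assms(2) by simp
    also have "4 * card (P - e) * (t * (card P choose t)) = 4 * t * card (P - e) * (card P choose t)"
      by (simp add: mult_ac)
    also have "\<dots> \<le> card P * (card P choose t)" using close[OF e] by (rule mult_le_mono1)
    finally show ?thesis using P0 by (simp add: cT)
  qed
  have tr: "card ((\<lambda>g. g \<inter> U) ` (g ` \<E>)) \<le> (4 * (60 * t) * t + 1) ^ 4"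
    if U: "U \<subseteq> nsets P t" "card U \<le> 4 * (60 * t)" for U
  proof -
    have UP: "\<Union>U \<subseteq> P" using U(1) by (auto simp: nsets_def)
    have finU: "finite U" using U(1) finT finite_subset by blast
    have fE: "finite ((\<lambda>e. e \<inter> \<Union>U) ` \<E>)"
      by (rule finite_subset[of _ "Pow (\<Union>U)"]) (use UP assms(1) finite_subset in auto)
    \<comment> \<open>Which of the sampled t-sets fail depends only on the trace of e on their
      union, so the bound on traces carries over to the new ground set.\<close>
    have "g e \<inter> U = {S\<in>U. \<not> S \<subseteq> e \<inter> \<Union>U}" for e
      using U(1) unfolding g_def by blast
    then have "(\<lambda>g. g \<inter> U) ` (g ` \<E>) = (\<lambda>T. {S\<in>U. \<not> S \<subseteq> T}) ` ((\<lambda>e. e \<inter> \<Union>U) ` \<E>)"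
      by (simp add: image_image)
    then have "card ((\<lambda>g. g \<inter> U) ` (g ` \<E>)) \<le> card ((\<lambda>e. e \<inter> \<Union>U) ` \<E>)"
      using fE by (simp add: card_image_le)
    also have "\<dots> \<le> (card (\<Union>U) + 1) ^ 4" by (rule traces[OF UP])
    also have "\<dots> \<le> (4 * (60 * t) * t + 1) ^ 4"
    proof (rule power_mono)
      have "card (\<Union>U) \<le> (\<Sum>S\<in>U. card S)" by (rule card_Union_le_sum_card)
      also have "\<dots> = card U * t" using U(1) by (simp add: nsets_def subset_iff)
      also have "\<dots> \<le> 4 * (60 * t) * t" using U(2) by (rule mult_le_mono1)
      finally show "card (\<Union>U) + 1 \<le> 4 * (60 * t) * t + 1" by simp
    qed simp
    finally show ?thesis .
  qed
  obtain U where U: "U \<subseteq> nsets P t" "card U \<le> 2 * (60 * t)" "\<And>h. h \<in> g ` \<E> \<Longrightarrow> \<not> U \<subseteq> h"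
  proof (rule double_sampling_net[OF finT neT _ tr net_arithmetic[OF assms(2)]])
    show "h \<subseteq> nsets P t \<and> 4 * card h \<le> card (nsets P t)" if "h \<in> g ` \<E>" for h
      using that small unfolding g_def by auto
  qed blast+
  show ?thesis
  proof (rule that[OF U(1)])
    show "card U \<le> 120 * t" using U(2) by simp
    show "\<exists>S\<in>U. S \<subseteq> e" if "e \<in> \<E>" for e
      using U(3)[of "g e"] U(1) that unfolding g_def by blast
  qed
qed

section \<open>Sparse hypergraphs\<close>

locale sparse_hypergraph =
  fixes V :: "'a set" and H :: "'a set set" and c :: nat
  assumes finite_V: "finite V" and H_sub: "H \<subseteq> Pow V"
    and vc: "\<And>S. S \<subseteq> V \<Longrightarrow> shatters H S \<Longrightarrow> card S \<le> 4"
    and sparse: "\<And>R. R \<subseteq> V \<Longrightarrow> card {S. card S = 2 \<and> (\<exists>e\<in>H. e \<inter> R = S)} \<le> c * card R"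
begin

text \<open>Clarkson--Shor: a pair lying in a small trace becomes a full trace on a random subset with
  probability of order \<open>1 / m\<^sup>2\<close>.\<close>

lemma card_pairs_in_shallow_traces:
  assumes R: "R \<subseteq> V" and m: "m \<ge> 1"
  shows "card {S. card S = 2 \<and> (\<exists>e\<in>H. S \<subseteq> e \<inter> R \<and> card (e \<inter> R) \<le> m)} \<le> 4 * c * m * card R"
proof -
  let ?G = "{S. card S = 2 \<and> (\<exists>e\<in>H. S \<subseteq> e \<inter> R \<and> card (e \<inter> R) \<le> m)}"
  let ?D = "\<lambda>R. {S. card S = 2 \<and> (\<exists>e\<in>H. e \<inter> R = S)}"
  \<comment> \<open>With this rate Bernoulli's inequality keeps the probability of missing up to m
    other elements at 1/2 or more.\<close>
  define p where "p = 1 / (2 * real m)"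
  have p: "0 < p" "p \<le> 1 / 2" using m by (auto simp: p_def divide_simps)
  have finR: "finite R" using R finite_V finite_subset by blast
  have finG: "finite ?G" by (rule finite_subset[of _ "Pow R"]) (use finR in auto)
  have bnn: "bern p R R' \<ge> 0" for R' using p by (intro bern_nonneg) auto
  have each: "p ^ 2 / 2 \<le> (\<Sum>R'\<in>Pow R. if S \<in> ?D R' then bern p R R' else 0)" if S: "S \<in> ?G" for S
  proof -
    obtain e where e: "e \<in> H" "S \<subseteq> e \<inter> R" "card (e \<inter> R) \<le> m" "card S = 2" using S by blast
    have le: "card (e \<inter> R - S) \<le> m"
      using card_mono[OF finite_Int[OF disjI2[OF finR]] Diff_subset[of "e \<inter> R" S]] e(3) by linarith
    have "1 / 2 \<le> 1 + real m * (- p)" using m by (simp add: p_def)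
    also have "\<dots> \<le> (1 + (- p)) ^ m" using p by (intro Bernoulli_inequality) auto
    also have "\<dots> \<le> (1 - p) ^ card (e \<inter> R - S)"
      using p le by (simp add: power_decreasing)
    finally have "p ^ 2 / 2 \<le> p ^ card S * (1 - p) ^ card (e \<inter> R - S)"
      using mult_left_mono[of "1/2" "(1 - p) ^ card (e \<inter> R - S)" "p ^ 2"] e(4) by simp
    also have "\<dots> = (\<Sum>R'\<in>Pow R. if R' \<inter> (e \<inter> R) = S then bern p R R' else 0)"
      using finR e(2) by (intro bern_cylinder[symmetric]) auto
    also have "\<dots> \<le> (\<Sum>R'\<in>Pow R. if S \<in> ?D R' then bern p R R' else 0)"
    proof (rule sum_mono)
      fix R' assume R': "R' \<in> Pow R"
      have "S \<in> ?D R'" if "R' \<inter> (e \<inter> R) = S"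
      proof -
        have "e \<inter> R' = S" using that R' by blast
        then show ?thesis using e by blast
      qed
      then show "(if R' \<inter> (e \<inter> R) = S then bern p R R' else 0) \<le> (if S \<in> ?D R' then bern p R R' else 0)"
        using bnn[of R'] by (cases "R' \<inter> (e \<inter> R) = S") auto
    qed
    finally show ?thesis .
  qed
  have "real (card ?G) * (p ^ 2 / 2) = (\<Sum>S\<in>?G. p ^ 2 / 2)" by simp
  also have "\<dots> \<le> (\<Sum>S\<in>?G. \<Sum>R'\<in>Pow R. if S \<in> ?D R' then bern p R R' else 0)"
    using each by (rule sum_mono)
  also have "\<dots> = (\<Sum>R'\<in>Pow R. \<Sum>S\<in>?G. if S \<in> ?D R' then bern p R R' else 0)" by (rule sum.swap)
  also have "\<dots> \<le> (\<Sum>R'\<in>Pow R. bern p R R' * (real c * real (card (R' \<inter> R))))"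
  proof (rule sum_mono)
    fix R' assume R': "R' \<in> Pow R"
    have fD: "finite (?D R')" by (rule finite_subset[of _ "Pow R'"]) (use R' finR finite_subset in auto)
    have "(\<Sum>S\<in>?G. if S \<in> ?D R' then bern p R R' else 0) = real (card (?G \<inter> ?D R')) * bern p R R'"
      using finG by (simp only: sum.inter_restrict[symmetric] sum_constant)
    also have "real (card (?G \<inter> ?D R')) \<le> real (card (?D R'))"
      using fD by (simp only: of_nat_le_iff) (rule card_mono, auto)
    also have "\<dots> \<le> real (c * card R')" using sparse[of R'] R' R by (simp only: of_nat_le_iff) auto
    finally show "(\<Sum>S\<in>?G. if S \<in> ?D R' then bern p R R' else 0) \<le> bern p R R' * (real c * real (card (R' \<inter> R)))"
      using bnn[of R'] R' by (simp add: mult_right_mono Int_absorb2 mult_ac)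
  qed
  also have "\<dots> = real c * (\<Sum>R'\<in>Pow R. bern p R R' * real (card (R' \<inter> R)))"
    by (simp add: sum_distrib_left mult_ac)
  also have "\<dots> = real c * (p * real (card R))" using bern_expected_card[OF finR subset_refl] by simp
  finally have "real (card ?G) * (p ^ 2 / 2) \<le> real c * (p * real (card R))" .
  then have "real (card ?G) * p \<le> 2 * real c * real (card R)"
    using p(1) by (simp add: power2_eq_square field_simps)
  then have "real (card ?G) \<le> real (4 * c * m * card R)"
    using m by (simp add: p_def field_simps)
  then show ?thesis by (simp only: of_nat_le_iff)
qed

text \<open>A nonempty set shattered by the small traces has at most four elements and lies in one
  of these traces, so it is a clique in the sparse graph of such pairs. Cliques of size up to
  \<open>Suc 3\<close> give the exponent 3; the summand 1 is the empty set.\<close>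

lemma card_shallow_traces:
  assumes R: "R \<subseteq> V" and m: "m \<ge> 1"
  shows "card {Q \<in> (\<lambda>e. e \<inter> R) ` H. card Q \<le> m} \<le> 1 + card R * (8 * c * m + 1) ^ 3"
proof -
  let ?F = "{Q \<in> (\<lambda>e. e \<inter> R) ` H. card Q \<le> m}"
  define G where "G = {S. card S = 2 \<and> (\<exists>e\<in>H. S \<subseteq> e \<inter> R \<and> card (e \<inter> R) \<le> m)}"
  let ?C = "{S. S \<subseteq> R \<and> S \<noteq> {} \<and> card S \<le> Suc 3 \<and> (\<forall>T\<subseteq>S. card T = 2 \<longrightarrow> T \<in> G)}"
  have finR: "finite R" using R finite_V finite_subset by blast
  have "card ?F \<le> card {S. S \<subseteq> R \<and> shatters ?F S}"
    by (rule card_le_shattered[OF finR]) auto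
  also have "\<dots> \<le> card (insert {} ?C)"
  proof (rule card_mono)
    show "finite (insert {} ?C)" using finR by simp
    show "{S. S \<subseteq> R \<and> shatters ?F S} \<subseteq> insert {} ?C"
    proof
      fix S assume "S \<in> {S. S \<subseteq> R \<and> shatters ?F S}"
      then have S: "S \<subseteq> R" "shatters ?F S" by auto
      have "shatters ((\<lambda>e. e \<inter> R) ` H) S" using S(2) by (rule shatters_mono) simp
      then have "shatters H S" by (rule shatters_traces[OF S(1)])
      then have "card S \<le> 4" by (rule vc[OF order_trans[OF S(1) R]])
      moreover obtain e where "e \<in> H" "e \<inter> R \<inter> S = S" "card (e \<inter> R) \<le> m"
        using shattersD[OF S(2) subset_refl] by auto
      then have "T \<in> G" if "T \<subseteq> S" "card T = 2" for T using that unfolding G_def by blast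
      ultimately show "S \<in> insert {} ?C" using S(1) by auto
    qed
  qed
  also have "\<dots> \<le> 1 + card ?C" by (rule order_trans[OF card_insert_le_m1]) (use finR in \<open>auto simp: card_insert_if\<close>)
  also have "card ?C \<le> card R * (2 * (4 * c * m) + 1) ^ 3"
  proof (rule card_small_cliques[OF finR])
    fix R' assume R': "R' \<subseteq> R"
    have finR': "finite R'" using R' finR finite_subset by blast
    \<comment> \<open>Traces only shrink on passing to \<open>R'\<close>, so the pairs inside
      \<open>R'\<close> again lie in small traces there; the sparsity is thereby inherited by
      induced subgraphs.\<close>
    have "{S\<in>G. S \<subseteq> R' \<and> card S = 2}
        \<subseteq> {S. card S = 2 \<and> (\<exists>e\<in>H. S \<subseteq> e \<inter> R' \<and> card (e \<inter> R') \<le> m)}"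
    proof
      fix S assume S: "S \<in> {S\<in>G. S \<subseteq> R' \<and> card S = 2}"
      then obtain e where e: "e \<in> H" "S \<subseteq> e \<inter> R" "card (e \<inter> R) \<le> m" unfolding G_def by blast
      have "card (e \<inter> R') \<le> card (e \<inter> R)" using R' finR by (intro card_mono) auto
      then show "S \<in> {S. card S = 2 \<and> (\<exists>e\<in>H. S \<subseteq> e \<inter> R' \<and> card (e \<inter> R') \<le> m)}"
        using S e by (auto intro!: bexI[of _ e])
    qed
    then have "card {S\<in>G. S \<subseteq> R' \<and> card S = 2}
        \<le> card {S. card S = 2 \<and> (\<exists>e\<in>H. S \<subseteq> e \<inter> R' \<and> card (e \<inter> R') \<le> m)}"
      by (rule card_mono[rotated]) (rule finite_subset[of _ "Pow R'"], use finR' in auto)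
    also have "\<dots> \<le> 4 * c * m * card R'"
      using R' R m by (intro card_pairs_in_shallow_traces) auto
    finally show "card {S\<in>G. S \<subseteq> R' \<and> card S = 2} \<le> 4 * c * m * card R'" .
  qed
  finally show ?thesis by (simp add: mult_ac)
qed

lemma card_traces_le:
  assumes "F \<subseteq> H" "U \<subseteq> V"
  shows "card ((\<lambda>e. e \<inter> U) ` F) \<le> (card U + 1) ^ 4"
proof -
  have finU: "finite U" using assms finite_V finite_subset by blast
  have "card ((\<lambda>e. e \<inter> U) ` F) \<le> card {S. S \<subseteq> U \<and> shatters ((\<lambda>e. e \<inter> U) ` F) S}"
    by (rule card_le_shattered[OF finU]) auto
  also have "\<dots> \<le> card {S. S \<subseteq> U \<and> card S \<le> 4}"
  proof (rule card_mono)
    show "{S. S \<subseteq> U \<and> shatters ((\<lambda>e. e \<inter> U) ` F) S} \<subseteq> {S. S \<subseteq> U \<and> card S \<le> 4}"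
    proof clarify
      fix S assume S: "S \<subseteq> U" "shatters ((\<lambda>e. e \<inter> U) ` F) S"
      have "shatters H S"
        using shatters_traces[OF S] assms(1) by (rule shatters_mono)
      then show "card S \<le> 4" using S(1) assms(2) by (intro vc) auto
    qed
  qed (use finU in simp)
  also have "\<dots> \<le> (card U + 1) ^ 4" by (rule card_subsets_le_power[OF finU])
  finally show ?thesis .
qed

text \<open>Since \<open>p * \<delta> / 2\<close> is at least 16 and the dimension at most 4, the
  size of \<open>F\<close> is at most 4/3 of the expected number of traces. Traces with at most m
  elements are counted by \<open>card_shallow_traces\<close>; by Markov's inequality at most a
  quarter of the members of \<open>F\<close> are expected to have a larger one, and this quarter is
  absorbed on the left.\<close>

lemma shallow_packing:
  assumes F: "F \<subseteq> H" and size: "\<And>e. e \<in> F \<Longrightarrow> real (card e) \<le> K"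
    and sep: "\<And>e e'. e \<in> F \<Longrightarrow> e' \<in> F \<Longrightarrow> e \<noteq> e' \<Longrightarrow> \<delta> \<le> real (card (e - e') + card (e' - e))"
    and p: "0 < p" "p < 1" "p * \<delta> \<ge> 32" and m: "m \<ge> 1" "4 * K * p \<le> real m"
  shows "real (card F) \<le> 2 * (1 + p * real (card V) * real ((8 * c * m + 1) ^ 3))"
proof -
  define B where "B = real ((8 * c * m + 1) ^ 3)"
  have FV: "F \<subseteq> Pow V" using F H_sub by blast
  have finF: "finite F" using FV finite_V finite_subset by blast
  have m0: "real m > 0" using m by simp
  let ?E = "\<lambda>h. \<Sum>R\<in>Pow V. bern p V R * h R"
  let ?T = "\<lambda>R. (\<lambda>e. e \<inter> R) ` F"
  let ?ET = "?E (\<lambda>R. real (card (?T R)))"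
  have bnn: "bern p V R \<ge> 0" for R using p by (intro bern_nonneg) auto
  have "p * \<delta> / 2 * (real (card F) - ?ET) \<le> real 4 * real (card F)"
  proof (rule haussler_packing[OF finite_V FV _ sep p(1,2)])
    fix S assume S: "S \<subseteq> V" "shatters F S"
    have "shatters H S" using S(2) F by (rule shatters_mono)
    then show "card S \<le> 4" using S(1) by (intro vc) auto
  qed
  then have main: "12 * real (card F) \<le> 16 * ?ET"
  proof (cases "real (card F) \<le> ?ET")
    case True
    then show ?thesis by simp
  next
    case False
    then have "16 * (real (card F) - ?ET) \<le> p * \<delta> / 2 * (real (card F) - ?ET)"
      using p(3) by (intro mult_right_mono) auto
    then show ?thesis using \<open>p * \<delta> / 2 * (real (card F) - ?ET) \<le> real 4 * real (card F)\<close> by simp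
  qed
  have pw: "real (card (?T R)) \<le> 1 + real (card (R \<inter> V)) * B + (\<Sum>e\<in>F. real (card (R \<inter> e)) / real m)"
    if R: "R \<in> Pow V" for R
  proof -
    let ?D = "{e\<in>F. \<not> card (e \<inter> R) \<le> m}"
    have finR: "finite R" using R finite_V finite_subset by auto
    have "?T R \<subseteq> {Q \<in> (\<lambda>e. e \<inter> R) ` H. card Q \<le> m} \<union> (\<lambda>e. e \<inter> R) ` ?D" using F by auto
    then have "card (?T R) \<le> card ({Q \<in> (\<lambda>e. e \<inter> R) ` H. card Q \<le> m} \<union> (\<lambda>e. e \<inter> R) ` ?D)"
      by (rule card_mono[rotated]) (rule finite_subset[of _ "Pow R"], use finR in auto)
    also have "\<dots> \<le> card {Q \<in> (\<lambda>e. e \<inter> R) ` H. card Q \<le> m} + card ((\<lambda>e. e \<inter> R) ` ?D)"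
      by (rule card_Un_le)
    also have "\<dots> \<le> (1 + card R * (8 * c * m + 1) ^ 3) + card ?D"
      using card_shallow_traces[of R m] R m(1) finF by (intro add_mono card_image_le) auto
    finally have "real (card (?T R)) \<le> real ((1 + card R * (8 * c * m + 1) ^ 3) + card ?D)"
      by (simp only: of_nat_le_iff)
    also have "\<dots> = 1 + real (card (R \<inter> V)) * B + real (card ?D)"
      using R by (simp add: B_def Int_absorb2)
    also have "real (card ?D) \<le> (\<Sum>e\<in>F. real (card (R \<inter> e)) / real m)"
    proof -
      have "real (card ?D) = (\<Sum>e\<in>?D. 1)" by simp
      also have "\<dots> \<le> (\<Sum>e\<in>?D. real (card (R \<inter> e)) / real m)"
        using m0 by (intro sum_mono) (auto simp: Int_commute)
      also have "\<dots> \<le> (\<Sum>e\<in>F. real (card (R \<inter> e)) / real m)"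
        using finF by (intro sum_mono2) auto
      finally show ?thesis .
    qed
    finally show ?thesis by simp
  qed
  have "?ET \<le> ?E (\<lambda>R. 1 + real (card (R \<inter> V)) * B + (\<Sum>e\<in>F. real (card (R \<inter> e)) / real m))"
    using pw bnn by (intro sum_mono mult_left_mono) auto
  also have "\<dots> = (\<Sum>R\<in>Pow V. bern p V R) + ?E (\<lambda>R. real (card (R \<inter> V))) * B
      + ?E (\<lambda>R. \<Sum>e\<in>F. real (card (R \<inter> e)) / real m)"
    by (simp add: sum.distrib distrib_left sum_distrib_right mult.assoc)
  also have "?E (\<lambda>R. \<Sum>e\<in>F. real (card (R \<inter> e)) / real m) = (\<Sum>e\<in>F. ?E (\<lambda>R. real (card (R \<inter> e))) / real m)"
    by (simp add: sum_distrib_left sum_divide_distrib sum.swap[of _ F "Pow V"])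
  also have "\<dots> = (\<Sum>e\<in>F. p * real (card e) / real m)"
    using bern_expected_card[OF finite_V, of _ p] FV by (intro sum.cong) auto
  also have "\<dots> \<le> (\<Sum>e\<in>F. 1 / 4)"
  proof (rule sum_mono)
    fix e assume "e \<in> F"
    then have "p * real (card e) \<le> p * K" using size p(1) by (intro mult_left_mono) auto
    also have "\<dots> \<le> real m / 4" using m(2) by (simp add: mult_ac)
    finally show "p * real (card e) / real m \<le> 1 / 4" using m0 by (simp add: field_simps)
  qed
  also have "(\<Sum>R\<in>Pow V. bern p V R) = 1" by (rule bern_sum[OF finite_V])
  also have "?E (\<lambda>R. real (card (R \<inter> V))) = p * real (card V)"
    by (rule bern_expected_card[OF finite_V subset_refl])
  finally have "?ET \<le> 1 + p * real (card V) * B + real (card F) / 4" by simp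
  then show ?thesis using main unfolding B_def[symmetric] by simp
qed

end

section \<open>From packings to nets, one dyadic size at a time\<close>

context sparse_hypergraph
begin

text \<open>The rate p = 128 t / k makes the separation k / (4 t) equal to 32 in expectation, and m
  = 1024 t is four times the expected trace of a set of size 2k. One factor t comes from the rate
  and three from the number of traces.\<close>

lemma packing_at_scale:
  fixes k :: real
  assumes t: "t \<ge> (1::nat)" and k: "k > 0" and F: "F \<subseteq> H"
    and size: "\<And>e. e \<in> F \<Longrightarrow> k \<le> real (card e) \<and> real (card e) < 2 * k"
    and sep: "\<And>e e'. e \<in> F \<Longrightarrow> e' \<in> F \<Longrightarrow> e \<noteq> e' \<Longrightarrow>
      k / (4 * real t) \<le> real (card (e - e') + card (e' - e))"
  shows "real (card F) \<le> 258 * real ((8192 * c + 1) ^ 3) * real t ^ 4 * (real (card V) / k)"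
proof (cases "F = {}")
  case True
  then show ?thesis using k by simp
next
  case False
  define m where "m = 1024 * t"
  define B where "B = real ((8 * c * m + 1) ^ 3)"
  define q where "q = 128 * real t / k * real (card V)"
  have m1: "m \<ge> 1" using t by (simp add: m_def)
  have B1: "B \<ge> 1" unfolding B_def by simp
  have q0: "q \<ge> 0" using k by (simp add: q_def)
  \<comment> \<open>For k at most 128 t the rate would not be below 1; but then the members have
    fewer than 256 t elements and can be counted directly, without sampling.\<close>
  have le: "real (card F) \<le> 2 * (1 + q * B)"
  proof (cases "k > 128 * real t")
    case True
    have "real (card F) \<le> 2 * (1 + 128 * real t / k * real (card V) * B)"
      unfolding B_def
    proof (rule shallow_packing[OF F _ sep])
      show "real (card e) \<le> 2 * k" if "e \<in> F" for e using size[OF that] by simp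
      show "0 < 128 * real t / k" "128 * real t / k < 1" using t k True by auto
      show "32 \<le> 128 * real t / k * (k / (4 * real t))" using t k by (simp add: field_simps)
      show "m \<ge> 1" by fact
      show "4 * (2 * k) * (128 * real t / k) \<le> real m" using k by (simp add: m_def)
    qed
    then show ?thesis by (simp add: q_def)
  next
    case False
    have "F \<subseteq> {Q \<in> (\<lambda>e. e \<inter> V) ` H. card Q \<le> m}"
    proof
      fix e assume e: "e \<in> F"
      have "e \<subseteq> V" using e F H_sub by blast
      then have "e \<inter> V = e" by blast
      moreover have "card e \<le> m" using size[OF e] False t unfolding m_def by linarith
      ultimately show "e \<in> {Q \<in> (\<lambda>e. e \<inter> V) ` H. card Q \<le> m}" using e F by force
    qed
    moreover have "finite {Q \<in> (\<lambda>e. e \<inter> V) ` H. card Q \<le> m}"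
      by (rule finite_subset[of _ "Pow V"]) (use finite_V in auto)
    ultimately have "card F \<le> card {Q \<in> (\<lambda>e. e \<inter> V) ` H. card Q \<le> m}" by (metis card_mono)
    also have "\<dots> \<le> 1 + card V * (8 * c * m + 1) ^ 3"
      by (rule card_shallow_traces[OF subset_refl m1])
    finally have "real (card F) \<le> 1 + real (card V) * B"
      unfolding B_def by (metis of_nat_1 of_nat_add of_nat_le_iff of_nat_mult)
    moreover have "real (card V) \<le> q"
    proof -
      have "1 \<le> 128 * real t / k" using False k by simp
      then show ?thesis unfolding q_def using mult_right_mono[of 1 "128 * real t / k" "real (card V)"] by simp
    qed
    then have "1 + real (card V) * B \<le> 1 + q * B" using B1 by (intro add_left_mono mult_right_mono) auto
    moreover have "1 + q * B \<le> 2 * (1 + q * B)" using B1 q0 by simp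
    ultimately show ?thesis by (meson order_trans)
  qed
  \<comment> \<open>A member of \<open>F\<close> shows that \<open>V\<close> has at least k
    elements; the additive 1 is then at most a 128th of \<open>q * B\<close>, which turns the factor
    2 into 258 / 128.\<close>
  have "q \<ge> 128"
  proof -
    obtain e where "e \<in> F" using False by blast
    then have "k \<le> real (card e)" "e \<subseteq> V" using size F H_sub by blast+
    then have "k \<le> real (card V)" using card_mono[OF finite_V, of e] by linarith
    then have "1 \<le> real (card V) / k" using k by simp
    then have "128 * 1 * 1 \<le> 128 * real t * (real (card V) / k)" using t by (intro mult_mono) auto
    then show ?thesis by (simp add: q_def)
  qed
  then have "128 * 1 \<le> q * B" using B1 by (intro mult_mono) auto
  then have two: "2 * (1 + q * B) \<le> 258 / 128 * (q * B)" by (simp add: mult.commute)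
  have "B \<le> real ((8192 * c + 1) ^ 3) * real t ^ 3"
  proof -
    have "8 * c * m + 1 \<le> (8192 * c + 1) * t" using t by (simp add: m_def algebra_simps)
    then have "(8 * c * m + 1) ^ 3 \<le> ((8192 * c + 1) * t) ^ 3" by (rule power_mono) simp
    then have "B \<le> real (((8192 * c + 1) * t) ^ 3)" unfolding B_def by (simp only: of_nat_le_iff)
    then show ?thesis by (simp only: power_mult_distrib of_nat_mult of_nat_power)
  qed
  then have "258 / 128 * (q * B) \<le> 258 / 128 * (q * (real ((8192 * c + 1) ^ 3) * real t ^ 3))"
    using q0 by (intro mult_left_mono) auto
  also have "\<dots> = 258 * real ((8192 * c + 1) ^ 3) * real t ^ 4 * (real (card V) / k)"
    by (simp add: q_def power4_eq_xxxx power3_eq_cube)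
  finally show ?thesis using order_trans[OF le two] by (rule order_trans[rotated])
qed

text \<open>In a maximal separated family every hyperedge of this size is closer than
  \<open>\<delta>\<close> to a member \<open>P\<close>. It misses fewer than k / (4 t) elements of
  \<open>P\<close>, at most a fraction 1 / (4 t) of it, as required by \<open>net_in_block\<close>.
  The constant is 120 times 258.\<close>

lemma net_at_scale:
  fixes k :: real
  assumes t: "t \<ge> (1::nat)" and k: "k \<ge> 2 * real t"
  obtains N where "N \<subseteq> nsets V t"
    "real (card N) \<le> 30960 * real ((8192 * c + 1) ^ 3) * real t ^ 5 * (real (card V) / k)"
    "\<And>e. e \<in> H \<Longrightarrow> k \<le> real (card e) \<Longrightarrow> real (card e) < 2 * k \<Longrightarrow> \<exists>S\<in>N. S \<subseteq> e"
proof -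
  define Hk where "Hk = {e\<in>H. k \<le> real (card e) \<and> real (card e) < 2 * k}"
  define \<delta> where "\<delta> = k / (4 * real t)"
  define d where "d e e' = real (card (e - e') + card (e' - e))" for e e' :: "'a set"
  have k0: "k > 0" using t k by simp
  have \<delta>0: "\<delta> > 0" using t k0 by (simp add: \<delta>_def)
  have finH: "finite H" using H_sub finite_V finite_subset by blast
  have d_sym: "d e e' = d e' e" for e e' unfolding d_def by simp
  define separated where "separated F \<longleftrightarrow> F \<subseteq> Hk \<and> (\<forall>e\<in>F. \<forall>e'\<in>F. e \<noteq> e' \<longrightarrow> \<delta> \<le> d e e')" for F
  have "finite {F. separated F}"
    by (rule finite_subset[of _ "Pow H"]) (use finH in \<open>auto simp: separated_def Hk_def\<close>)
  moreover have "{} \<in> {F. separated F}" by (simp add: separated_def)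
  ultimately obtain F where F: "separated F" and maxF: "\<And>F'. separated F' \<Longrightarrow> F \<subseteq> F' \<Longrightarrow> F = F'"
    using finite_has_maximal[of "{F. separated F}"] by blast
  have FH: "F \<subseteq> Hk" and Fsep: "\<And>e e'. e \<in> F \<Longrightarrow> e' \<in> F \<Longrightarrow> e \<noteq> e' \<Longrightarrow> \<delta> \<le> d e e'"
    using F unfolding separated_def by blast+
  have finF: "finite F" using FH finH finite_subset unfolding Hk_def by fastforce
  have near: "\<exists>P\<in>F. d e P < \<delta>" if e: "e \<in> Hk" for e
  proof (rule ccontr)
    assume far: "\<not> ?thesis"
    have "d e e = 0" unfolding d_def by simp
    then have "e \<notin> F" using far \<delta>0 by auto
    moreover have "separated (insert e F)"
      unfolding separated_def using e FH Fsep far d_sym by (auto simp: not_less)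
    ultimately show False using maxF[of "insert e F"] by blast
  qed
  have "\<exists>\<S>. \<S> \<subseteq> nsets P t \<and> card \<S> \<le> 120 * t \<and> (\<forall>e\<in>{e\<in>Hk. d e P < \<delta>}. \<exists>S\<in>\<S>. S \<subseteq> e)"
    if P: "P \<in> F" for P
  proof -
    have PV: "P \<subseteq> V" and Pk: "k \<le> real (card P)" using P FH H_sub unfolding Hk_def by blast+
    have finP: "finite P" using PV finite_V finite_subset by blast
    have tP: "t \<le> card P" using Pk k t by linarith
    show ?thesis
    proof (rule net_in_block[OF finP t tP, of "{e\<in>Hk. d e P < \<delta>}"])
      show "4 * t * card (P - e) \<le> card P" if "e \<in> {e\<in>Hk. d e P < \<delta>}" for e
      proof -
        have "real (card (P - e)) \<le> \<delta>" using that unfolding d_def by simp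
        then have "4 * real t * real (card (P - e)) \<le> 4 * real t * \<delta>" by (intro mult_left_mono) auto
        also have "\<dots> = k" using t by (simp add: \<delta>_def)
        finally have "real (4 * t * card (P - e)) \<le> real (card P)" using Pk by simp
        then show ?thesis by (simp only: of_nat_le_iff)
      qed
      show "card ((\<lambda>e. e \<inter> U) ` {e\<in>Hk. d e P < \<delta>}) \<le> (card U + 1) ^ 4" if "U \<subseteq> P" for U
        using that PV by (intro card_traces_le) (auto simp: Hk_def)
    qed blast
  qed
  then have "\<forall>P\<in>F. \<exists>\<S>. \<S> \<subseteq> nsets P t \<and> card \<S> \<le> 120 * t \<and>
      (\<forall>e\<in>{e\<in>Hk. d e P < \<delta>}. \<exists>S\<in>\<S>. S \<subseteq> e)" by (rule ballI)
  from bchoice[OF this] obtain \<S> where \<S>': "\<forall>P\<in>F. \<S> P \<subseteq> nsets P t \<and> card (\<S> P) \<le> 120 * t \<and>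
      (\<forall>e\<in>{e\<in>Hk. d e P < \<delta>}. \<exists>S\<in>\<S> P. S \<subseteq> e)" by (rule exE)
  note \<S> = bspec[OF \<S>']
  have card_F: "real (card F) \<le> 258 * real ((8192 * c + 1) ^ 3) * real t ^ 4 * (real (card V) / k)"
  proof (rule packing_at_scale[OF t k0])
    show "F \<subseteq> H" "\<And>e. e \<in> F \<Longrightarrow> k \<le> real (card e) \<and> real (card e) < 2 * k"
      using FH unfolding Hk_def by auto
    show "k / (4 * real t) \<le> real (card (e - e') + card (e' - e))"
      if "e \<in> F" "e' \<in> F" "e \<noteq> e'" for e e' using Fsep[OF that] unfolding \<delta>_def d_def .
  qed
  show ?thesis
  proof (rule that[of "\<Union>P\<in>F. \<S> P"])
    have "nsets P t \<subseteq> nsets V t" if "P \<in> F" for P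
      using that FH H_sub unfolding Hk_def by (intro nsets_mono) auto
    then show "(\<Union>P\<in>F. \<S> P) \<subseteq> nsets V t" using \<S> by blast
    have "card (\<Union>P\<in>F. \<S> P) \<le> (\<Sum>P\<in>F. card (\<S> P))" by (rule card_UN_le[OF finF])
    also have "\<dots> \<le> (\<Sum>P\<in>F. 120 * t)" using \<S> by (intro sum_mono) auto
    finally have "real (card (\<Union>P\<in>F. \<S> P)) \<le> real (card F * (120 * t))"
      by (simp only: of_nat_le_iff sum_constant of_nat_id)
    also have "\<dots> = 120 * real t * real (card F)" by simp
    also have "\<dots> \<le> 120 * real t * (258 * real ((8192 * c + 1) ^ 3) * real t ^ 4 * (real (card V) / k))"
      using card_F by (rule mult_left_mono) simp
    also have "\<dots> = 30960 * real ((8192 * c + 1) ^ 3) * real t ^ 5 * (real (card V) / k)"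
      by (simp add: power_Suc[of _ 4, simplified])
    finally show "real (card (\<Union>P\<in>F. \<S> P))
      \<le> 30960 * real ((8192 * c + 1) ^ 3) * real t ^ 5 * (real (card V) / k)" .
    show "\<exists>S\<in>(\<Union>P\<in>F. \<S> P). S \<subseteq> e" if "e \<in> H" "k \<le> real (card e)" "real (card e) < 2 * k" for e
    proof -
      have e: "e \<in> Hk" using that unfolding Hk_def by blast
      then obtain P where P: "P \<in> F" "d e P < \<delta>" using near by blast
      then obtain S where "S \<in> \<S> P" "S \<subseteq> e" using \<S>[OF P(1)] e by blast
      then show ?thesis using P(1) by blast
    qed
  qed
qed

text \<open>The nets for the sizes from \<open>k j\<close> to \<open>2 * k j\<close> shrink
  geometrically with j, so together they cost at most twice the bound for j = 0.\<close>

theorem eps_t_net_exists: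
  fixes \<epsilon> :: real
  assumes t: "t \<ge> (1::nat)" and \<epsilon>: "0 < \<epsilon>" and large: "\<epsilon> * real (card V) \<ge> 2 * real t"
  obtains N where "eps_t_net \<epsilon> t (V, H) N"
    "real (card N) \<le> 61920 * real ((8192 * c + 1) ^ 3) * real t ^ 5 / \<epsilon>"
proof -
  let ?n = "card V"
  define A where "A = 30960 * real ((8192 * c + 1) ^ 3) * real t ^ 5 / \<epsilon>"
  define k where "k j = \<epsilon> * real ?n * 2 ^ j" for j :: nat
  have A0: "A \<ge> 0" using \<epsilon> by (simp add: A_def)
  have n0: "real ?n > 0"
  proof (rule ccontr)
    assume "\<not> real ?n > 0"
    then have "real ?n = 0" by simp
    then show False using large t by simp
  qed
  have k2: "k j \<ge> 2 * real t" for j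
  proof -
    have "\<epsilon> * real ?n * 1 \<le> k j" unfolding k_def using \<epsilon> by (intro mult_left_mono) auto
    then show ?thesis using large by simp
  qed
  have "\<exists>N. N \<subseteq> nsets V t \<and> real (card N) \<le> A / 2 ^ j \<and>
      (\<forall>e\<in>H. k j \<le> real (card e) \<longrightarrow> real (card e) < 2 * k j \<longrightarrow> (\<exists>S\<in>N. S \<subseteq> e))" (is "?ex j") for j
  proof -
    obtain N where N: "N \<subseteq> nsets V t"
      "real (card N) \<le> 30960 * real ((8192 * c + 1) ^ 3) * real t ^ 5 * (real ?n / k j)"
      "\<And>e. e \<in> H \<Longrightarrow> k j \<le> real (card e) \<Longrightarrow> real (card e) < 2 * k j \<Longrightarrow> \<exists>S\<in>N. S \<subseteq> e"
      by (rule net_at_scale[OF t k2[of j]]) blast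
    have "real ?n / k j = 1 / \<epsilon> / 2 ^ j" using n0 by (simp add: k_def)
    then have "real (card N) \<le> A / 2 ^ j" using N(2) by (simp add: A_def)
    then show ?thesis using N by blast
  qed
  then have "\<forall>j. ?ex j" by (rule allI)
  from choice[OF this] obtain N where N': "\<forall>j. N j \<subseteq> nsets V t \<and> real (card (N j)) \<le> A / 2 ^ j \<and>
      (\<forall>e\<in>H. k j \<le> real (card e) \<longrightarrow> real (card e) < 2 * k j \<longrightarrow> (\<exists>S\<in>N j. S \<subseteq> e))" by (rule exE)
  note N = spec[OF N']
  show ?thesis
  proof (rule that[of "\<Union>j<?n. N j"])
    have "real (card (\<Union>j<?n. N j)) \<le> real (\<Sum>j<?n. card (N j))"
      by (simp only: of_nat_le_iff) (rule card_UN_le, simp)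
    also have "\<dots> \<le> (\<Sum>j<?n. A * (1 / 2) ^ j)"
      unfolding of_nat_sum using N by (intro sum_mono) (simp add: power_divide)
    also have "\<dots> = A * (\<Sum>j<?n. (1 / 2) ^ j)" by (simp add: sum_distrib_left)
    also have "\<dots> \<le> A * 2"
    proof (rule mult_left_mono[OF _ A0])
      have "(\<Sum>j<?n. (1 / 2 :: real) ^ j) = 2 * (1 - (1 / 2) ^ ?n)"
        by (subst sum_gp_strict) simp
      then show "(\<Sum>j<?n. (1 / 2 :: real) ^ j) \<le> 2" by simp
    qed
    finally show "real (card (\<Union>j<?n. N j)) \<le> 61920 * real ((8192 * c + 1) ^ 3) * real t ^ 5 / \<epsilon>"
      by (simp add: A_def)
    show "eps_t_net \<epsilon> t (V, H) (\<Union>j<?n. N j)"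
      unfolding eps_t_net_def fst_conv snd_conv
    proof (intro conjI ballI impI)
      show "(\<Union>j<?n. N j) \<subseteq> nsets V t" using N by blast
      fix e assume e: "e \<in> H" "\<epsilon> * real ?n \<le> real (card e)"
      have en: "card e \<le> ?n" using e(1) H_sub finite_V by (intro card_mono) auto
      define j where "j = (LEAST j. real (card e) < 2 * k j)"
      \<comment> \<open>As many scales as there are vertices are enough:
        \<open>\<epsilon> * real ?n\<close> is at least 1, and \<open>2 ^ ?n\<close> exceeds every
        hyperedge size.\<close>
      have top: "real (card e) < 2 * k (?n - 1)"
      proof -
        have "Suc (?n - 1) = ?n" using n0 by simp
        then have "2 * k (?n - 1) = \<epsilon> * real ?n * 2 ^ ?n"
          unfolding k_def by (metis mult.left_commute power_Suc)
        moreover have "1 * 2 ^ ?n \<le> \<epsilon> * real ?n * 2 ^ ?n" using large t by (intro mult_right_mono) auto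
        moreover have "real ?n < 2 ^ ?n" by (rule of_nat_less_two_power)
        ultimately show ?thesis using en by linarith
      qed
      have j1: "real (card e) < 2 * k j" unfolding j_def using top by (rule LeastI)
      have "j \<le> ?n - 1" unfolding j_def using top by (rule Least_le)
      then have jn: "j < ?n" using n0 by linarith
      have j2: "k j \<le> real (card e)"
      proof (cases j)
        case 0
        then show ?thesis using e(2) by (simp add: k_def)
      next
        \<comment> \<open>Minimality of j fails the bound at i, and \<open>2 * k i\<close> is
          \<open>k j\<close>.\<close>
        case (Suc i)
        then have "\<not> real (card e) < 2 * k i" unfolding j_def using not_less_Least by (metis lessI)
        then show ?thesis using Suc by (simp add: k_def)
      qed
      obtain S where "S \<in> N j" "S \<subseteq> e" using N[of j] e(1) j1 j2 by blast
      then show "\<exists>S\<in>(\<Union>j<?n. N j). S \<subseteq> e" using jn by blast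
    qed
  qed
qed

end

section \<open>Nets for pseudo-discs\<close>

text \<open>The trace of a hyperedge on a subfamily is what the same member of \<open>F2\<close>
  defines on that subfamily, so the two geometric bounds, applied to subfamilies, are exactly the
  axioms of the locale.\<close>

lemma sparse_intersection_hypergraph:
  assumes F: "pseudo_discs F1" "pseudo_discs F2" and fin: "finite F1"
  shows "sparse_hypergraph F1 (meeting F1 ` F2) 512"
proof -
  interpret two_pseudo_disc_families F1 F2 using F by unfold_locales
  have restrict: "meeting F1 b \<inter> R = meeting R b" if "R \<subseteq> F1" for R b
    using that unfolding meeting_def by blast
  show ?thesis
  proof
    show "meeting F1 ` F2 \<subseteq> Pow F1" unfolding meeting_def by blast
    show "card S \<le> 4" if S: "S \<subseteq> F1" "shatters (meeting F1 ` F2) S" for S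
    proof (rule ccontr)
      assume "\<not> card S \<le> 4"
      then obtain S' where S': "S' \<subseteq> S" "card S' = 5"
        using obtain_subset_with_card_n[of 5 S] by auto
      have S'F: "S' \<subseteq> F1" using S' S by blast
      have "\<exists>b\<in>F2. meeting S' b = T" if "T \<subseteq> S'" for T
      proof -
        obtain b where b: "b \<in> F2" "meeting F1 b \<inter> S = T"
          using shattersD[OF S(2), of T] \<open>T \<subseteq> S'\<close> S'(1) by blast
        have "meeting S' b = meeting F1 b \<inter> S \<inter> S'"
          using S'(1) restrict[OF S'F, of b] by blast
        also have "\<dots> = T" using b(2) \<open>T \<subseteq> S'\<close> by blast
        finally show ?thesis using b(1) by blast
      qed
      then show False using no_shattered_five[OF S'F S'(2)] by blast
    qed
    show "card {S. card S = 2 \<and> (\<exists>e\<in>meeting F1 ` F2. e \<inter> R = S)} \<le> 512 * card R" if R: "R \<subseteq> F1" for R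
    proof -
      have "{S. card S = 2 \<and> (\<exists>e\<in>meeting F1 ` F2. e \<inter> R = S)}
          = {S. card S = 2 \<and> (\<exists>b\<in>F2. meeting R b = S)}"
        using restrict[OF R] by auto
      then show ?thesis
        using delaunay_edges_linear[OF finite_subset[OF R fin] R] by simp
    qed
  qed (rule fin)
qed

theorem theorem7:
  shows "\<exists>C::real. C > 0 \<and>
    (\<forall>(t::nat) (\<epsilon>::real) (n::nat) (F1::complex set set) (F2::complex set set).
       t \<ge> 1 \<longrightarrow> 0 < \<epsilon> \<longrightarrow> \<epsilon> < 1 \<longrightarrow>
       pseudo_discs F1 \<longrightarrow> pseudo_discs F2 \<longrightarrow>
       finite F1 \<longrightarrow> card F1 = n \<longrightarrow> \<epsilon> * real n \<ge> 2 * real t \<longrightarrow>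
       (\<exists>N. eps_t_net \<epsilon> t (intersection_hypergraph F1 F2) N \<and>
            real (card N) \<le> C * real t ^ 5 / \<epsilon>))"
proof (intro exI[of _ "61920 * real ((8192 * 512 + 1) ^ 3)"] conjI allI impI)
  fix t n :: nat and \<epsilon> :: real and F1 F2 :: "complex set set"
  assume *: "t \<ge> 1" "0 < \<epsilon>" "\<epsilon> < 1" "pseudo_discs F1" "pseudo_discs F2" "finite F1" "card F1 = n"
    "\<epsilon> * real n \<ge> 2 * real t"
  interpret sparse_hypergraph F1 "meeting F1 ` F2" 512
    using * by (intro sparse_intersection_hypergraph)
  have "intersection_hypergraph F1 F2 = (F1, meeting F1 ` F2)"
    unfolding intersection_hypergraph_def meeting_def by simp
  then show "\<exists>N. eps_t_net \<epsilon> t (intersection_hypergraph F1 F2) N \<and>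
      real (card N) \<le> 61920 * real ((8192 * 512 + 1) ^ 3) * real t ^ 5 / \<epsilon>"
    using eps_t_net_exists[of t \<epsilon>] * by metis
qed simp

end
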